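(* Assume that $(a-b)^2\,\Phi^{(2)} \le q(a+b)$. For each $n$, let $G$ be an instance of the degree-corrected stochastic block model on $n$ vertices with $q\ge 2$ communities, parameters $a,b>0$ and weight law $\nu$ (see context). Let $u$ and $v$ be uniformly chosen vertices in $G$. Then, for any $s\in\{1,\dots,q\}$, $$\mathbb{P}\left(\sigma_u = s \,\middle|\, \sigma_v, G\right)\ \xrightarrow{\ \mathbb{P}\ }\ \frac1q \qquad\text{as } n\to\infty,$$ where $\xrightarrow{\mathbb{P}}$ denotes convergence in probability.
   Context: Degree-corrected stochastic block model (DC-SBM). Fix an integer $q\ge 2$, constants $a,b>0$, a constant $\phi_{\min}\in(0,\infty)$ and a probability law $\nu$ with support in a set $W\subset[\phi_{\min},\infty)$, all independent of $n$. It is assumed that there is an exponent $\beta>8$ such that $\nu([k,\infty))\le k^{-\beta}$ for all large enough $k$. Write $\Phi^{(k)}=\int_W x^k\,\mathrm d\nu(x)$ for the $k$-th moment of the weights. The graph $G=G(n)$ has vertex set $V=\{1,\dots,n\}$. Each vertex $w$ has a spin (community) $\sigma_w$ drawn independently and uniformly from $\{1,\dots,q\}$ and a weight $\phi_w$; the weights are i.i.d. with law $\nu$ and independent of the spins. Conditionally on spins and weights, each pair of distinct vertices $w,w'$ is joined by an edge, independently of other pairs, with probability $\frac{\phi_w\phi_{w'}}{n}a$ if $\sigma_w=\sigma_{w'}$ and $\frac{\phi_w\phi_{w'}}{n}b$ otherwise (these quantities are read as $1$ if they exceed $1$). The weights are not observed: the conditioning on $G$ is on the graph (vertex set and edges)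 only. The identities of the chosen vertices $u$ and $v$ are treated as known in the conditional probability. *)

theory Defs
  imports "HOL-Probability.Probability"
begin

definition sigma_gen :: "'w measure \<Rightarrow> ('w \<Rightarrow> 'x) \<Rightarrow> 'x measure \<Rightarrow> 'w measure" where
  "sigma_gen M X N = vimage_algebra (space M) X N"

text \<open>\<open>X\<close> is a random variable with values in \<open>N\<close>; the conditional probability of the event
  \<open>A\<close> given \<open>X\<close> is the conditional expectation of its indicator.\<close>

definition cond_prob_given ::
  "'w measure \<Rightarrow> 'w set \<Rightarrow> ('w \<Rightarrow> 'x) \<Rightarrow> 'x measure \<Rightarrow> 'w \<Rightarrow> real" where
  "cond_prob_given M A X N = real_cond_exp M (sigma_gen M X N) (indicator A)"

text \<open>Unlike \<^const>\<open>prob_space.indep_var\<close>, this allows the two random variables to have different types.\<close>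

definition (in prob_space) indep_rv ::
  "'x measure \<Rightarrow> ('a \<Rightarrow> 'x) \<Rightarrow> 'y measure \<Rightarrow> ('a \<Rightarrow> 'y) \<Rightarrow> bool" where
  "indep_rv N X N' Y \<longleftrightarrow> random_variable N X \<and> random_variable N' Y \<and>
     indep_set (sets (sigma_gen M X N)) (sets (sigma_gen M Y N'))"

text \<open>The \<open>n\<close>-th random variable lives on its own probability space \<open>M n\<close>.\<close>

definition tendsto_in_prob :: "(nat \<Rightarrow> 'w measure) \<Rightarrow> (nat \<Rightarrow> 'w \<Rightarrow> real) \<Rightarrow> real \<Rightarrow> bool" where
  "tendsto_in_prob M X c \<longleftrightarrow>
     (\<forall>\<epsilon>>0. (\<lambda>n. \<P>(\<omega> in M n. \<bar>X n \<omega> - c\<bar> > \<epsilon>)) \<longlonglongrightarrow> 0)"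

definition weight_moment :: "real measure \<Rightarrow> real set \<Rightarrow> nat \<Rightarrow> real" where
  "weight_moment \<nu> W k = (LINT x:W|\<nu>. x ^ k)"

abbreviation (input) verts :: "nat \<Rightarrow> nat set" where
  "verts n \<equiv> {1..n}"

definition vert_pairs :: "nat \<Rightarrow> (nat \<times> nat) set" where
  "vert_pairs n = {(i, j). i \<in> verts n \<and> j \<in> verts n \<and> i < j}"

text \<open>A simple graph on \<^term>\<open>verts n\<close> is identified with its set of edges.\<close>

definition graphs :: "nat \<Rightarrow> nat set set set" where
  "graphs n = Pow {{i, j} | i j. i \<in> verts n \<and> j \<in> verts n \<and> i \<noteq> j}"

definition edge_prob ::
  "real \<Rightarrow> real \<Rightarrow> nat \<Rightarrow> (nat \<Rightarrow> nat) \<Rightarrow> (nat \<Rightarrow> real) \<Rightarrow> nat \<Rightarrow> nat \<Rightarrow> real" where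
  "edge_prob a b n x y i j = min 1 (y i * y j / real n * (if x i = x j then a else b))"

definition graph_prob ::
  "real \<Rightarrow> real \<Rightarrow> nat \<Rightarrow> (nat \<Rightarrow> nat) \<Rightarrow> (nat \<Rightarrow> real) \<Rightarrow> nat set set \<Rightarrow> real" where
  "graph_prob a b n x y E =
     (\<Prod>(i, j) \<in> vert_pairs n.
        if {i, j} \<in> E then edge_prob a b n x y i j else 1 - edge_prob a b n x y i j)"

definition spin_space :: "nat \<Rightarrow> nat \<Rightarrow> (nat \<Rightarrow> nat) measure" where
  "spin_space q n = (\<Pi>\<^sub>M w\<in>verts n. count_space {1..q})"

definition weight_space :: "nat \<Rightarrow> (nat \<Rightarrow> real) measure" where
  "weight_space n = (\<Pi>\<^sub>M w\<in>verts n. borel)"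

text \<open>The variables \<open>\<sigma> w\<close>, \<open>\<phi> w\<close>, \<open>G\<close> on the probability space \<open>M\<close> are the spins, the weights
  and the graph of a degree-corrected stochastic block model on \<open>n\<close> vertices.\<close>

locale dcsbm = prob_space M
  for M :: "'w measure" and q n :: nat and a b :: real and \<nu> :: "real measure"
    and \<sigma> :: "nat \<Rightarrow> 'w \<Rightarrow> nat" and \<phi> :: "nat \<Rightarrow> 'w \<Rightarrow> real" and G :: "'w \<Rightarrow> nat set set" +
  assumes spins_indep: "indep_vars (\<lambda>_. count_space {1..q}) \<sigma> (verts n)"
    and spins_uniform: "\<And>w. w \<in> verts n \<Longrightarrow>
      distr M (count_space {1..q}) (\<sigma> w) = uniform_count_measure {1..q}"
    and weights_indep: "indep_vars (\<lambda>_. borel) \<phi> (verts n)"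
    and weights_law: "\<And>w. w \<in> verts n \<Longrightarrow> distr M borel (\<phi> w) = \<nu>"
    and spins_weights_indep:
      "indep_rv (spin_space q n) (\<lambda>\<omega>. \<lambda>w\<in>verts n. \<sigma> w \<omega>)
                (weight_space n) (\<lambda>\<omega>. \<lambda>w\<in>verts n. \<phi> w \<omega>)"
    and graph_measurable: "random_variable (count_space (graphs n)) G"
    and graph_cond_law: "\<And>E. E \<in> graphs n \<Longrightarrow>
      AE \<omega> in M.
        cond_prob_given M {\<omega> \<in> space M. G \<omega> = E}
          (\<lambda>\<omega>. (\<lambda>w\<in>verts n. \<sigma> w \<omega>, \<lambda>w\<in>verts n. \<phi> w \<omega>)) (spin_space q n \<Otimes>\<^sub>M weight_space n) \<omega>
        = graph_prob a b n (\<lambda>w. \<sigma> w \<omega>) (\<lambda>w. \<phi> w \<omega>) E"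

text \<open>The vertices \<open>u\<close> and \<open>v\<close> are drawn uniformly, independently of each other and of everything
  else; they may coincide.\<close>

locale dcsbm_two_vertices = dcsbm M q n a b \<nu> \<sigma> \<phi> G
  for M :: "'w measure" and q n :: nat and a b :: real and \<nu> :: "real measure"
    and \<sigma> :: "nat \<Rightarrow> 'w \<Rightarrow> nat" and \<phi> :: "nat \<Rightarrow> 'w \<Rightarrow> real" and G :: "'w \<Rightarrow> nat set set" +
  fixes u v :: "'w \<Rightarrow> nat"
  assumes u_uniform: "distr M (count_space (verts n)) u = uniform_count_measure (verts n)"
    and v_uniform: "distr M (count_space (verts n)) v = uniform_count_measure (verts n)"
    and uv_indep: "indep_var (count_space (verts n)) u (count_space (verts n)) v"
    and uv_model_indep:
      "indep_rv (count_space (verts n) \<Otimes>\<^sub>M count_space (verts n)) (\<lambda>\<omega>. (u \<omega>, v \<omega>))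
         ((spin_space q n \<Otimes>\<^sub>M weight_space n) \<Otimes>\<^sub>M count_space (graphs n))
         (\<lambda>\<omega>. ((\<lambda>w\<in>verts n. \<sigma> w \<omega>, \<lambda>w\<in>verts n. \<phi> w \<omega>), G \<omega>))"

text \<open>The conditional probability of \<open>\<sigma>\<^sub>u = s\<close> given \<open>\<sigma>\<^sub>v\<close> and \<open>G\<close>, the identities of \<open>u\<close> and \<open>v\<close>
  being known.\<close>

definition spin_posterior ::
  "'w measure \<Rightarrow> nat \<Rightarrow> nat \<Rightarrow> (nat \<Rightarrow> 'w \<Rightarrow> nat) \<Rightarrow> ('w \<Rightarrow> nat set set) \<Rightarrow> ('w \<Rightarrow> nat) \<Rightarrow> ('w \<Rightarrow> nat) \<Rightarrow>
   nat \<Rightarrow> 'w \<Rightarrow> real" where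
  "spin_posterior M q n \<sigma> G u v s =
     cond_prob_given M {\<omega> \<in> space M. \<sigma> (u \<omega>) \<omega> = s}
       (\<lambda>\<omega>. (u \<omega>, v \<omega>, \<sigma> (v \<omega>) \<omega>, G \<omega>))
       (count_space (verts n \<times> verts n \<times> {1..q} \<times> graphs n))"

end

theory Submission
  imports Defs
begin

text \<open>
  The argument has two halves: a reduction to a model with two communities, and a proof that in this
  model the graph and the spin of one vertex carry asymptotically no information about the spin of
  another one.

  \<^emph>\<open>Reduction.\<close> It suffices that \<open>s\<close> and \<open>s'\<close> are almost equally likely for \<open>\<sigma>\<^sub>u\<close>, for every pair of
  communities. More information can only increase the \<open>L\<^sup>1\<close> distance of the two, so all weights may be
  revealed, and for every vertex whether its spin lies in \<open>{s, s'}\<close>, and if not, which spin it is. What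
  remains hidden is a uniform sign at each vertex of the class \<open>{s, s'}\<close>, and only edges inside this
  class depend on the signs. Setting the weights of all other vertices to zero gives a model with two
  communities and i.i.d. weights whose second moment is \<open>2 / q\<close> times the original one
  (\<open>spin_difference\<close>, \<open>nn_integral_iid_thinned\<close>). In terms of \<open>\<kappa> = (a - b)\<^sup>2 / (2 (a + b))\<close> and this second
  moment \<open>m\<^sub>2\<close>, the assumption of the theorem is exactly \<open>\<kappa> m\<^sub>2 \<le> 1\<close>.

  \<^emph>\<open>Two communities.\<close> The information about the sign of \<open>w\<close> is measured by the mean square of its
  conditional expectation. Suppose that a new vertex \<open>u\<close> is joined to a graph and its edges are
  revealed one at a time. If the signs of \<open>u\<close> and \<open>w\<close> were conditionally independent, with conditional means
  \<open>\<alpha>\<close> and \<open>B\<close>, then an edge variable of small probability would increase the information about \<open>u\<close> by \<open>\<kappa> t B\<^sup>2 (1 - \<alpha>\<^sup>2)\<^sup>2 / (1 + \<theta> \<alpha> B)\<close>,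
  with \<open>\<theta> = (a - b) / (a + b)\<close> and \<open>t = \<phi>\<^sub>u \<phi>\<^sub>w / n\<close>. This is at most
  \<open>\<kappa> t (B\<^sup>2 - \<theta> \<alpha> B\<^sup>3 - k\<^sub>0 \<alpha>\<^sup>2 B\<^sup>2)\<close> with some \<open>k\<^sub>0 > 0\<close>. The term of odd order has mean zero, because \<open>\<alpha>\<close> has
  conditional mean zero given what was known before the edges of \<open>u\<close>, and the last one makes the growth
  strictly sublinear. Hence the information about \<open>u\<close> is bounded by a strictly concave function of the
  average information about the old vertices (\<open>cavity_inequality\<close>). At \<open>\<kappa> m\<^sub>2 \<le> 1\<close> this forces both to vanish,
  also in the critical case, provided that old and new vertices are comparable.

  The error of assuming conditional independence is bounded by the amount by which the information
  about \<open>w\<close> grows when \<open>u\<close> is added with its edges and its spin. To make this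
  small, \<open>\<epsilon> n\<close> vertices with revealed spins are added one after the other. Information is
  monotone and at most one, so it grows by at most \<open>1 / (\<epsilon> n)\<close> per vertex, on average over \<open>w\<close>, in one of the steps
  (\<open>chain_step\<close>). By exchangeability the new vertex of that step stands for any old one, and the
  recursion closes (\<open>pair_information_tendsto_0\<close>). No local comparison with a branching process is needed.
\<close>

section \<open>Conditional expectations on finite weighted spaces\<close>

text \<open>A finite set of outcomes with nonnegative weights. The total weight is not required to be one.\<close>

locale finite_weights =
  fixes \<Omega> :: "'a set" and w :: "'a \<Rightarrow> real"
  assumes finite_space: "finite \<Omega>"
    and weight_nonneg: "\<And>\<omega>. \<omega> \<in> \<Omega> \<Longrightarrow> 0 \<le> w \<omega>"
begin

text \<open>Expectation and conditional expectation given an observable \<open>Z\<close>, which may have any type. On a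
  fibre of \<open>Z\<close> of total weight zero the conditional expectation is \<open>0\<close>, by the convention on division.\<close>

definition wexp :: "('a \<Rightarrow> real) \<Rightarrow> real" where
  "wexp F = (\<Sum>\<omega>\<in>\<Omega>. w \<omega> * F \<omega>)"

definition cexp :: "('a \<Rightarrow> 'z) \<Rightarrow> ('a \<Rightarrow> real) \<Rightarrow> 'a \<Rightarrow> real" where
  "cexp Z F \<omega> = (\<Sum>\<omega>'\<in>{\<omega>' \<in> \<Omega>. Z \<omega>' = Z \<omega>}. w \<omega>' * F \<omega>') / (\<Sum>\<omega>'\<in>{\<omega>' \<in> \<Omega>. Z \<omega>' = Z \<omega>}. w \<omega>')"

text \<open>\<open>h\<close> is a function of the observable \<open>Z\<close>; this replaces measurability with respect to the
  \<open>\<sigma>\<close>-algebra of \<open>Z\<close>.\<close>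

definition determines :: "('a \<Rightarrow> 'z) \<Rightarrow> ('a \<Rightarrow> 'y) \<Rightarrow> bool" where
  "determines Z h \<longleftrightarrow> (\<forall>\<omega>\<in>\<Omega>. \<forall>\<omega>'\<in>\<Omega>. Z \<omega> = Z \<omega>' \<longrightarrow> h \<omega> = h \<omega>')"

lemma determinesI: "(\<And>\<omega> \<omega>'. \<omega> \<in> \<Omega> \<Longrightarrow> \<omega>' \<in> \<Omega> \<Longrightarrow> Z \<omega> = Z \<omega>' \<Longrightarrow> h \<omega> = h \<omega>') \<Longrightarrow> determines Z h"
  unfolding determines_def by metis

lemma determinesD: "determines Z h \<Longrightarrow> \<omega> \<in> \<Omega> \<Longrightarrow> \<omega>' \<in> \<Omega> \<Longrightarrow> Z \<omega> = Z \<omega>' \<Longrightarrow> h \<omega> = h \<omega>'"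
  unfolding determines_def by metis

lemma determines_trans: "determines Z Y \<Longrightarrow> determines Y h \<Longrightarrow> determines Z h"
  unfolding determines_def by metis

lemma determines_comp: "determines Z h \<Longrightarrow> determines Z (\<lambda>\<omega>. f (h \<omega>))"
  unfolding determines_def by metis

lemma determines_comp2: "determines Z h \<Longrightarrow> determines Z k \<Longrightarrow> determines Z (\<lambda>\<omega>. f (h \<omega>) (k \<omega>))"
  unfolding determines_def by metis

lemma determines_const: "determines Z (\<lambda>\<omega>. c)"
  by (auto simp: determines_def)

lemma determines_fst: "determines (\<lambda>\<omega>. (Z \<omega>, Y \<omega>)) Z"
  by (auto simp: determines_def)

lemma determines_cexp: "determines Z (cexp Z F)"
  by (auto simp: determines_def cexp_def)

lemma determines_cexp_trans: "determines Z' Z \<Longrightarrow> determines Z' (cexp Z F)"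
  using determines_trans determines_cexp by blast

lemma wexp_mono: "(\<And>\<omega>. \<omega> \<in> \<Omega> \<Longrightarrow> F \<omega> \<le> H \<omega>) \<Longrightarrow> wexp F \<le> wexp H"
  unfolding wexp_def by (intro sum_mono mult_left_mono) (auto simp: weight_nonneg)

lemma wexp_cong: "(\<And>\<omega>. \<omega> \<in> \<Omega> \<Longrightarrow> F \<omega> = H \<omega>) \<Longrightarrow> wexp F = wexp H"
  unfolding wexp_def by (intro sum.cong) auto

lemma wexp_nonneg: "(\<And>\<omega>. \<omega> \<in> \<Omega> \<Longrightarrow> 0 \<le> F \<omega>) \<Longrightarrow> 0 \<le> wexp F"
  unfolding wexp_def by (intro sum_nonneg mult_nonneg_nonneg) (auto simp: weight_nonneg)

lemma wexp_add: "wexp (\<lambda>\<omega>. F \<omega> + H \<omega>) = wexp F + wexp H"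
  by (simp add: wexp_def sum.distrib algebra_simps)

lemma wexp_diff: "wexp (\<lambda>\<omega>. F \<omega> - H \<omega>) = wexp F - wexp H"
  by (simp add: wexp_def sum_subtractf algebra_simps)

lemma wexp_cmult: "wexp (\<lambda>\<omega>. c * F \<omega>) = c * wexp F"
  unfolding wexp_def sum_distrib_left by (intro sum.cong) simp_all

lemma wexp_multc: "wexp (\<lambda>\<omega>. F \<omega> * c) = wexp F * c"
  unfolding wexp_def sum_distrib_right by (intro sum.cong) simp_all

lemma wexp_sum: "wexp (\<lambda>\<omega>. \<Sum>i\<in>I. F i \<omega>) = (\<Sum>i\<in>I. wexp (F i))"
  unfolding wexp_def by (subst sum.swap) (simp add: sum_distrib_left)

lemma wexp_abs: "\<bar>wexp F\<bar> \<le> wexp (\<lambda>\<omega>. \<bar>F \<omega>\<bar>)"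
proof -
  have "\<bar>wexp F\<bar> \<le> (\<Sum>\<omega>\<in>\<Omega>. \<bar>w \<omega> * F \<omega>\<bar>)" unfolding wexp_def by (rule sum_abs)
  also have "\<dots> = wexp (\<lambda>\<omega>. \<bar>F \<omega>\<bar>)" unfolding wexp_def
    by (intro sum.cong) (auto simp: abs_mult weight_nonneg)
  finally show ?thesis .
qed

lemma wexp_fibres: "wexp F = (\<Sum>z\<in>Z ` \<Omega>. \<Sum>\<omega>\<in>{\<omega> \<in> \<Omega>. Z \<omega> = z}. w \<omega> * F \<omega>)"
  unfolding wexp_def using sum.image_gen[OF finite_space, of "\<lambda>\<omega>. w \<omega> * F \<omega>" Z] by simp

text \<open>The defining property of a conditional expectation.\<close>

lemma tower:
  assumes "determines Z h"
  shows "wexp (\<lambda>\<omega>. h \<omega> * cexp Z F \<omega>) = wexp (\<lambda>\<omega>. h \<omega> * F \<omega>)"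
proof -
  have "(\<Sum>\<omega>\<in>{\<omega> \<in> \<Omega>. Z \<omega> = z}. w \<omega> * (h \<omega> * cexp Z F \<omega>)) =
        (\<Sum>\<omega>\<in>{\<omega> \<in> \<Omega>. Z \<omega> = z}. w \<omega> * (h \<omega> * F \<omega>))" if z: "z \<in> Z ` \<Omega>" for z
  proof -
    obtain \<omega>0 where w0: "\<omega>0 \<in> \<Omega>" "z = Z \<omega>0" using z by auto
    let ?A = "{\<omega> \<in> \<Omega>. Z \<omega> = Z \<omega>0}"
    let ?S = "\<Sum>\<omega>\<in>?A. w \<omega>" and ?T = "\<Sum>\<omega>\<in>?A. w \<omega> * F \<omega>"
    have hc: "h \<omega> = h \<omega>0" if "\<omega> \<in> ?A" for \<omega> using assms that w0 by (auto dest: determinesD)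
    have "(\<Sum>\<omega>\<in>?A. w \<omega> * (h \<omega> * cexp Z F \<omega>)) = (\<Sum>\<omega>\<in>?A. w \<omega> * (h \<omega>0 * (?T / ?S)))"
    proof (intro sum.cong refl)
      fix \<omega> assume "\<omega> \<in> ?A"
      then have "h \<omega> = h \<omega>0" "cexp Z F \<omega> = ?T / ?S" using hc by (auto simp: cexp_def)
      then show "w \<omega> * (h \<omega> * cexp Z F \<omega>) = w \<omega> * (h \<omega>0 * (?T / ?S))" by simp
    qed
    also have "\<dots> = ?S * (h \<omega>0 * (?T / ?S))" by (simp only: sum_distrib_right)
    also have "\<dots> = h \<omega>0 * ?T"
    proof (cases "?S = 0")
      case True
      then have "\<forall>\<omega>\<in>?A. w \<omega> = 0"
        using sum_nonneg_eq_0_iff[of ?A w] finite_space weight_nonneg by auto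
      then have "?T = 0" by (intro sum.neutral) auto
      then show ?thesis using True by simp
    next
      case False then show ?thesis by simp
    qed
    also have "\<dots> = (\<Sum>\<omega>\<in>?A. w \<omega> * (h \<omega> * F \<omega>))"
      unfolding sum_distrib_left by (intro sum.cong refl) (metis hc mult.left_commute)
    finally show ?thesis using w0 by simp
  qed
  then show ?thesis unfolding wexp_fibres[of _ Z] by (rule sum.cong[OF refl])
qed

lemma cexp_bound:
  assumes F: "\<And>\<omega>. \<omega> \<in> \<Omega> \<Longrightarrow> \<bar>F \<omega>\<bar> \<le> 1"
  shows "\<bar>cexp Z F \<omega>\<bar> \<le> 1"
proof -
  let ?A = "{\<omega>' \<in> \<Omega>. Z \<omega>' = Z \<omega>}"
  have "\<bar>\<Sum>\<omega>'\<in>?A. w \<omega>' * F \<omega>'\<bar> \<le> (\<Sum>\<omega>'\<in>?A. \<bar>w \<omega>' * F \<omega>'\<bar>)" by (rule sum_abs)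
  also have "\<dots> \<le> (\<Sum>\<omega>'\<in>?A. w \<omega>')"
    by (intro sum_mono) (auto simp: abs_mult weight_nonneg F intro: mult_left_le)
  finally have *: "\<bar>\<Sum>\<omega>'\<in>?A. w \<omega>' * F \<omega>'\<bar> \<le> (\<Sum>\<omega>'\<in>?A. w \<omega>')" .
  have "(\<Sum>\<omega>'\<in>?A. w \<omega>') \<ge> 0" by (intro sum_nonneg) (auto simp: weight_nonneg)
  with * show ?thesis unfolding cexp_def abs_divide
    by (cases "(\<Sum>\<omega>'\<in>?A. w \<omega>') = 0") (auto simp: divide_le_eq)
qed

text \<open>The mean square of a conditional expectation; for a centred spin it is a chi-square
  information.\<close>

definition info :: "('a \<Rightarrow> 'z) \<Rightarrow> ('a \<Rightarrow> real) \<Rightarrow> real" where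
  "info Z F = wexp (\<lambda>\<omega>. (cexp Z F \<omega>)\<^sup>2)"

lemma wexp_cexp_square:
  assumes "determines Z h"
  shows "wexp (\<lambda>\<omega>. h \<omega> * (cexp Z F \<omega>)\<^sup>2) = wexp (\<lambda>\<omega>. h \<omega> * cexp Z F \<omega> * F \<omega>)"
proof -
  have "determines Z (\<lambda>\<omega>. h \<omega> * cexp Z F \<omega>)"
    using assms determines_cexp by (rule determines_comp2)
  from tower[OF this, of F] show ?thesis by (simp add: power2_eq_square mult.assoc)
qed

text \<open>Refining an observable increases the information by the mean squared change of the conditional
  expectation.\<close>

lemma info_diff:
  assumes "determines Z' Z"
  shows "wexp (\<lambda>\<omega>. (cexp Z' F \<omega> - cexp Z F \<omega>)\<^sup>2) = info Z' F - info Z F"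
proof -
  have "wexp (\<lambda>\<omega>. cexp Z F \<omega> * cexp Z' F \<omega>) = wexp (\<lambda>\<omega>. cexp Z F \<omega> * F \<omega>)"
    by (intro tower determines_cexp_trans assms)
  also have "\<dots> = info Z F"
    using wexp_cexp_square[OF determines_const[where c=1], of Z F] by (simp add: info_def)
  finally have *: "wexp (\<lambda>\<omega>. cexp Z F \<omega> * cexp Z' F \<omega>) = info Z F" .
  have "wexp (\<lambda>\<omega>. (cexp Z' F \<omega> - cexp Z F \<omega>)\<^sup>2) =
        wexp (\<lambda>\<omega>. (cexp Z' F \<omega>)\<^sup>2 + (cexp Z F \<omega>)\<^sup>2 - 2 * (cexp Z F \<omega> * cexp Z' F \<omega>))"
    by (intro wexp_cong) (simp add: power2_eq_square algebra_simps)
  also have "\<dots> = info Z' F + info Z F - 2 * info Z F"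
    by (simp only: wexp_diff wexp_add wexp_cmult * info_def)
  finally show ?thesis by simp
qed

lemma info_mono: "determines Z' Z \<Longrightarrow> info Z F \<le> info Z' F"
  using info_diff[of Z' Z F] wexp_nonneg[of "\<lambda>\<omega>. (cexp Z' F \<omega> - cexp Z F \<omega>)\<^sup>2"] by simp

lemma info_nonneg: "0 \<le> info Z F"
  unfolding info_def by (intro wexp_nonneg) simp

lemma info_le_total: "(\<And>\<omega>. \<omega> \<in> \<Omega> \<Longrightarrow> \<bar>F \<omega>\<bar> \<le> 1) \<Longrightarrow> info Z F \<le> wexp (\<lambda>_. 1)"
  unfolding info_def by (intro wexp_mono) (use cexp_bound[of F Z] in \<open>auto simp: abs_square_le_1\<close>)

lemma info_determined:
  assumes "determines Z F" shows "info Z F = wexp (\<lambda>\<omega>. (F \<omega>)\<^sup>2)"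
proof -
  have "info Z F = wexp (\<lambda>\<omega>. cexp Z F \<omega> * F \<omega>)"
    using wexp_cexp_square[OF determines_const[where c=1], of Z F] by (simp add: info_def)
  also have "\<dots> = wexp (\<lambda>\<omega>. F \<omega> * F \<omega>)" using tower[OF assms, of F] by (simp add: mult.commute)
  finally show ?thesis by (simp add: power2_eq_square)
qed

lemma wexp_cauchy_schwarz:
  assumes "wexp (\<lambda>_. 1) = 1"
  shows "wexp (\<lambda>\<omega>. \<bar>F \<omega>\<bar>) \<le> sqrt (wexp (\<lambda>\<omega>. (F \<omega>)\<^sup>2))"
proof -
  let ?m = "wexp (\<lambda>\<omega>. \<bar>F \<omega>\<bar>)"
  have "0 \<le> wexp (\<lambda>\<omega>. (\<bar>F \<omega>\<bar> - ?m)\<^sup>2)" by (intro wexp_nonneg) simp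
  also have "\<dots> = wexp (\<lambda>\<omega>. (F \<omega>)\<^sup>2 + ?m\<^sup>2 * 1 - 2 * ?m * \<bar>F \<omega>\<bar>)"
    by (intro wexp_cong) (simp add: power2_eq_square algebra_simps)
  also have "\<dots> = wexp (\<lambda>\<omega>. (F \<omega>)\<^sup>2) - ?m\<^sup>2"
    unfolding wexp_diff wexp_add wexp_cmult assms by (simp add: power2_eq_square)
  finally show ?thesis by (intro real_le_rsqrt) simp
qed

lemma wexp_cexp_diff_le:
  assumes "wexp (\<lambda>_. 1) = 1" "determines Z' Z"
  shows "wexp (\<lambda>\<omega>. \<bar>cexp Z' F \<omega> - cexp Z F \<omega>\<bar>) \<le> sqrt (info Z' F - info Z F)"
  using wexp_cauchy_schwarz[OF assms(1), of "\<lambda>\<omega>. cexp Z' F \<omega> - cexp Z F \<omega>"] info_diff[OF assms(2), of F] by simp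

text \<open>The conditional covariance of \<open>A\<close> and \<open>F\<close> given \<open>Z\<close> is bounded by what observing \<open>A\<close> as well
  reveals about \<open>F\<close>.\<close>

lemma wexp_ccov_le:
  assumes one: "wexp (\<lambda>_. 1) = 1" and A: "\<And>\<omega>. \<omega> \<in> \<Omega> \<Longrightarrow> \<bar>A \<omega>\<bar> \<le> 1"
    and Z': "determines Z' Z" "determines Z' A"
  shows "wexp (\<lambda>\<omega>. \<bar>cexp Z (\<lambda>\<omega>. A \<omega> * F \<omega>) \<omega> - cexp Z A \<omega> * cexp Z F \<omega>\<bar>) \<le> sqrt (info Z' F - info Z F)"
proof -
  let ?c = "\<lambda>\<omega>. cexp Z (\<lambda>\<omega>. A \<omega> * F \<omega>) \<omega> - cexp Z A \<omega> * cexp Z F \<omega>"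
  define s where "s = (\<lambda>\<omega>. sgn (?c \<omega>))"
  have s: "determines Z s" unfolding s_def
    by (intro determines_comp[where f=sgn] determines_comp2[where f="(-)"] determines_comp2[where f="(*)"] determines_cexp)
  have s': "determines Z' s" using determines_trans[OF Z'(1) s] .
  have "wexp (\<lambda>\<omega>. \<bar>?c \<omega>\<bar>) = wexp (\<lambda>\<omega>. s \<omega> * cexp Z (\<lambda>\<omega>. A \<omega> * F \<omega>) \<omega> - s \<omega> * cexp Z F \<omega> * cexp Z A \<omega>)"
    by (intro wexp_cong) (simp add: s_def abs_sgn algebra_simps)
  also have "\<dots> = wexp (\<lambda>\<omega>. s \<omega> * cexp Z (\<lambda>\<omega>. A \<omega> * F \<omega>) \<omega>) - wexp (\<lambda>\<omega>. s \<omega> * cexp Z F \<omega> * cexp Z A \<omega>)"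
    by (simp add: wexp_diff)
  also have "wexp (\<lambda>\<omega>. s \<omega> * cexp Z (\<lambda>\<omega>. A \<omega> * F \<omega>) \<omega>) = wexp (\<lambda>\<omega>. s \<omega> * A \<omega> * F \<omega>)"
    using tower[OF s, of "\<lambda>\<omega>. A \<omega> * F \<omega>"] by (simp add: mult.assoc)
  also have "\<dots> = wexp (\<lambda>\<omega>. s \<omega> * A \<omega> * cexp Z' F \<omega>)"
    using tower[OF determines_comp2[OF s' Z'(2), of "(*)"], of F] by simp
  also have "wexp (\<lambda>\<omega>. s \<omega> * cexp Z F \<omega> * cexp Z A \<omega>) = wexp (\<lambda>\<omega>. s \<omega> * cexp Z F \<omega> * A \<omega>)"
    by (intro tower determines_comp2[where f="(*)"] s determines_cexp)
  also have "wexp (\<lambda>\<omega>. s \<omega> * A \<omega> * cexp Z' F \<omega>) - wexp (\<lambda>\<omega>. s \<omega> * cexp Z F \<omega> * A \<omega>)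
      = wexp (\<lambda>\<omega>. s \<omega> * A \<omega> * (cexp Z' F \<omega> - cexp Z F \<omega>))"
    unfolding wexp_diff[symmetric] by (intro wexp_cong) (simp add: algebra_simps)
  also have "\<dots> \<le> wexp (\<lambda>\<omega>. \<bar>cexp Z' F \<omega> - cexp Z F \<omega>\<bar>)"
  proof (intro wexp_mono)
    fix \<omega> assume "\<omega> \<in> \<Omega>"
    then have "\<bar>s \<omega> * A \<omega>\<bar> \<le> 1" using A by (auto simp: abs_mult s_def sgn_if)
    then have "\<bar>s \<omega> * A \<omega> * (cexp Z' F \<omega> - cexp Z F \<omega>)\<bar> \<le> 1 * \<bar>cexp Z' F \<omega> - cexp Z F \<omega>\<bar>"
      unfolding abs_mult by (intro mult_right_mono) auto
    then show "s \<omega> * A \<omega> * (cexp Z' F \<omega> - cexp Z F \<omega>) \<le> \<bar>cexp Z' F \<omega> - cexp Z F \<omega>\<bar>"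
      unfolding mult_1 by (rule order_trans[OF abs_ge_self])
  qed
  also have "\<dots> \<le> sqrt (info Z' F - info Z F)" by (rule wexp_cexp_diff_le[OF one Z'(1)])
  finally show ?thesis .
qed

text \<open>A further bit \<open>Y\<close> is observed whose conditional law depends on \<open>B\<close> only: it is one with
  probability \<open>p + d B\<close>. The mean square of the conditional expectation of \<open>A\<close> is then explicit in
  terms of the conditional expectations before the observation.\<close>

lemma wexp_cexp_square_bit:
  fixes Y :: "'a \<Rightarrow> bool"
  assumes Y: "\<And>h. determines (\<lambda>\<omega>. (Z \<omega>, A \<omega>, B \<omega>)) h \<Longrightarrow>
      wexp (\<lambda>\<omega>. h \<omega> * of_bool (Y \<omega>)) = wexp (\<lambda>\<omega>. h \<omega> * (p + d * B \<omega>))"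
    and h: "determines Z h"
  defines "\<alpha> \<equiv> cexp Z A" and "\<beta> \<equiv> cexp Z B" and "\<gamma> \<equiv> cexp Z (\<lambda>\<omega>. A \<omega> * B \<omega>)"
  shows "wexp (\<lambda>\<omega>. h \<omega> * (cexp (\<lambda>\<omega>. (Z \<omega>, Y \<omega>)) A \<omega>)\<^sup>2) =
    wexp (\<lambda>\<omega>. h \<omega> * ((p * \<alpha> \<omega> + d * \<gamma> \<omega>)\<^sup>2 / (p + d * \<beta> \<omega>) +
                  ((1 - p) * \<alpha> \<omega> - d * \<gamma> \<omega>)\<^sup>2 / (1 - p - d * \<beta> \<omega>)))"
proof -
  let ?ZY = "\<lambda>\<omega>. (Z \<omega>, Y \<omega>)" and ?ZAB = "\<lambda>\<omega>. (Z \<omega>, A \<omega>, B \<omega>)"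
  define r1 where "r1 = (\<lambda>\<omega>. (p * \<alpha> \<omega> + d * \<gamma> \<omega>) / (p + d * \<beta> \<omega>))"
  define r0 where "r0 = (\<lambda>\<omega>. ((1 - p) * \<alpha> \<omega> - d * \<gamma> \<omega>) / (1 - p - d * \<beta> \<omega>))"
  have ZAB: "determines ?ZAB Z" "determines ?ZAB A" "determines ?ZAB B"
    by (auto simp: determines_def)
  have r: "determines Z r1" "determines Z r0"
    unfolding r1_def r0_def determines_def \<alpha>_def \<beta>_def \<gamma>_def cexp_def by simp_all
  have ratio: "cexp ?ZY A \<omega> = (if Y \<omega> then r1 \<omega> else r0 \<omega>)" if om: "\<omega> \<in> \<Omega>" for \<omega>
  proof -
    define S where "S F = (\<Sum>\<omega>'\<in>{\<omega>'\<in>\<Omega>. Z \<omega>' = Z \<omega>}. w \<omega>' * F \<omega>')" for F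
    define i where "i = (\<lambda>\<omega>'. of_bool (Z \<omega>' = Z \<omega>) :: real)"
    have SE: "S F = wexp (\<lambda>\<omega>'. i \<omega>' * F \<omega>')" for F
      unfolding S_def wexp_def i_def using finite_space
      by (intro sum.mono_neutral_cong_left) auto
    have S_Y: "S (\<lambda>\<omega>'. K \<omega>' * of_bool (Y \<omega>')) = p * S K + d * S (\<lambda>\<omega>'. K \<omega>' * B \<omega>')"
      if K: "determines ?ZAB K" for K
    proof -
      have "determines ?ZAB (\<lambda>\<omega>'. i \<omega>' * K \<omega>')"
        unfolding i_def by (intro determines_comp2[where f="(*)"] K determines_comp[where f="\<lambda>z. of_bool (z = Z \<omega>)"] ZAB(1))
      from Y[OF this] have "S (\<lambda>\<omega>'. K \<omega>' * of_bool (Y \<omega>')) = S (\<lambda>\<omega>'. p * K \<omega>' + d * (K \<omega>' * B \<omega>'))"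
        unfolding SE by (simp add: algebra_simps)
      then show ?thesis unfolding S_def by (simp add: sum.distrib sum_distrib_left algebra_simps)
    qed
    have A1: "S (\<lambda>\<omega>'. A \<omega>' * of_bool (Y \<omega>')) = p * S A + d * S (\<lambda>\<omega>'. A \<omega>' * B \<omega>')"
      by (rule S_Y[OF ZAB(2)])
    have A2: "S (\<lambda>\<omega>'. of_bool (Y \<omega>')) = p * S (\<lambda>_. 1) + d * S B"
      using S_Y[OF determines_const[where c=1]] by simp
    have S_diff: "S (\<lambda>\<omega>'. K \<omega>' * of_bool (\<not> Y \<omega>')) = S K - S (\<lambda>\<omega>'. K \<omega>' * of_bool (Y \<omega>'))" for K
      unfolding S_def sum_subtractf[symmetric] by (intro sum.cong) auto
    have al: "\<alpha> \<omega> = S A / S (\<lambda>_. 1)" "\<beta> \<omega> = S B / S (\<lambda>_. 1)" "\<gamma> \<omega> = S (\<lambda>\<omega>'. A \<omega>' * B \<omega>') / S (\<lambda>_. 1)"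
      by (auto simp: \<alpha>_def \<beta>_def \<gamma>_def cexp_def S_def)
    have fibre: "(\<Sum>\<omega>'\<in>{\<omega>' \<in> \<Omega>. ?ZY \<omega>' = ?ZY \<omega>}. w \<omega>' * K \<omega>') =
        S (\<lambda>\<omega>'. K \<omega>' * of_bool (Y \<omega>' = Y \<omega>))" for K
      unfolding S_def using finite_space by (intro sum.mono_neutral_cong_left) auto
    have c: "cexp ?ZY A \<omega> = S (\<lambda>\<omega>'. A \<omega>' * of_bool (Y \<omega>' = Y \<omega>)) / S (\<lambda>\<omega>'. of_bool (Y \<omega>' = Y \<omega>))"
      using fibre[of A] fibre[of "\<lambda>_. 1"] by (simp add: cexp_def)
    show ?thesis
    proof (cases "S (\<lambda>_. 1) = 0")
      case True
      then have "\<forall>\<omega>'\<in>{\<omega>'\<in>\<Omega>. Z \<omega>' = Z \<omega>}. w \<omega>' = 0"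
        using sum_nonneg_eq_0_iff[of "{\<omega>'\<in>\<Omega>. Z \<omega>' = Z \<omega>}" w] finite_space weight_nonneg
        by (auto simp: S_def)
      then have "S K = 0" for K unfolding S_def by (intro sum.neutral) auto
      then show ?thesis using c al by (simp add: r1_def r0_def)
    next
      case False
      have q1: "r1 \<omega> = (p * S A + d * S (\<lambda>\<omega>'. A \<omega>' * B \<omega>')) / (p * S (\<lambda>_. 1) + d * S B)"
      proof -
        have "p * \<alpha> \<omega> + d * \<gamma> \<omega> = (p * S A + d * S (\<lambda>\<omega>'. A \<omega>' * B \<omega>')) / S (\<lambda>_. 1)"
          "p + d * \<beta> \<omega> = (p * S (\<lambda>_. 1) + d * S B) / S (\<lambda>_. 1)"
          using False by (auto simp: al field_simps)
        then show ?thesis unfolding r1_def using False by simp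
      qed
      have q0: "r0 \<omega> = (S A - (p * S A + d * S (\<lambda>\<omega>'. A \<omega>' * B \<omega>'))) / (S (\<lambda>_. 1) - (p * S (\<lambda>_. 1) + d * S B))"
      proof -
        have "(1 - p) * \<alpha> \<omega> - d * \<gamma> \<omega> = (S A - (p * S A + d * S (\<lambda>\<omega>'. A \<omega>' * B \<omega>'))) / S (\<lambda>_. 1)"
          "1 - p - d * \<beta> \<omega> = (S (\<lambda>_. 1) - (p * S (\<lambda>_. 1) + d * S B)) / S (\<lambda>_. 1)"
          using False by (auto simp: al field_simps)
        then show ?thesis unfolding r0_def using False by simp
      qed
      show ?thesis
        using c A1 A2 S_diff[of A] S_diff[of "\<lambda>_. 1"] by (cases "Y \<omega>") (simp_all add: q1 q0)
    qed
  qed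
  have hZY: "determines ?ZY h" using determines_trans[OF determines_fst h] .
  have dZ: "determines ?ZAB (\<lambda>\<omega>. h \<omega> * r1 \<omega> * A \<omega>)" "determines ?ZAB (\<lambda>\<omega>. h \<omega> * r0 \<omega> * A \<omega>)"
    by (intro determines_comp2[where f="(*)"] ZAB(2) determines_trans[OF ZAB(1) h]
          determines_trans[OF ZAB(1) r(1)] determines_trans[OF ZAB(1) r(2)])+
  have hr: "determines Z (\<lambda>\<omega>. h \<omega> * r1 \<omega>)" "determines Z (\<lambda>\<omega>. h \<omega> * r0 \<omega>)"
    by (intro determines_comp2[where f="(*)"] h r)+
  have T: "wexp (\<lambda>\<omega>. k \<omega> * A \<omega>) = wexp (\<lambda>\<omega>. k \<omega> * \<alpha> \<omega>)"
     "wexp (\<lambda>\<omega>. k \<omega> * (A \<omega> * B \<omega>)) = wexp (\<lambda>\<omega>. k \<omega> * \<gamma> \<omega>)" if "determines Z k" for k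
    using tower[OF that] by (simp_all add: \<alpha>_def \<gamma>_def)
  \<comment> \<open>one conditional expectation is unfolded to \<open>A\<close>, the other one is replaced by the two ratios\<close>
  have "wexp (\<lambda>\<omega>. h \<omega> * (cexp ?ZY A \<omega>)\<^sup>2) = wexp (\<lambda>\<omega>. h \<omega> * cexp ?ZY A \<omega> * A \<omega>)"
    by (rule wexp_cexp_square[OF hZY])
  also have "\<dots> = wexp (\<lambda>\<omega>. h \<omega> * r1 \<omega> * A \<omega> * of_bool (Y \<omega>) + (h \<omega> * r0 \<omega> * A \<omega> - h \<omega> * r0 \<omega> * A \<omega> * of_bool (Y \<omega>)))"
    by (intro wexp_cong) (auto simp: ratio)
  also have "\<dots> = wexp (\<lambda>\<omega>. h \<omega> * r1 \<omega> * A \<omega> * (p + d * B \<omega>)) +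
     (wexp (\<lambda>\<omega>. h \<omega> * r0 \<omega> * A \<omega>) - wexp (\<lambda>\<omega>. h \<omega> * r0 \<omega> * A \<omega> * (p + d * B \<omega>)))"
    unfolding wexp_add wexp_diff Y[OF dZ(1)] Y[OF dZ(2)] ..
  also have "wexp (\<lambda>\<omega>. h \<omega> * r1 \<omega> * A \<omega> * (p + d * B \<omega>)) = wexp (\<lambda>\<omega>. h \<omega> * r1 \<omega> * \<alpha> \<omega>) * p + wexp (\<lambda>\<omega>. h \<omega> * r1 \<omega> * \<gamma> \<omega>) * d"
    unfolding T(1)[OF hr(1), symmetric] T(2)[OF hr(1), symmetric] wexp_multc[symmetric] wexp_add[symmetric]
    by (intro wexp_cong) (simp add: algebra_simps)
  also have "wexp (\<lambda>\<omega>. h \<omega> * r0 \<omega> * A \<omega> * (p + d * B \<omega>)) = wexp (\<lambda>\<omega>. h \<omega> * r0 \<omega> * \<alpha> \<omega>) * p + wexp (\<lambda>\<omega>. h \<omega> * r0 \<omega> * \<gamma> \<omega>) * d"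
    unfolding T(1)[OF hr(2), symmetric] T(2)[OF hr(2), symmetric] wexp_multc[symmetric] wexp_add[symmetric]
    by (intro wexp_cong) (simp add: algebra_simps)
  also have "wexp (\<lambda>\<omega>. h \<omega> * r0 \<omega> * A \<omega>) = wexp (\<lambda>\<omega>. h \<omega> * r0 \<omega> * \<alpha> \<omega>)" by (rule T(1)[OF hr(2)])
  also have "wexp (\<lambda>\<omega>. h \<omega> * r1 \<omega> * \<alpha> \<omega>) * p + wexp (\<lambda>\<omega>. h \<omega> * r1 \<omega> * \<gamma> \<omega>) * d +
     (wexp (\<lambda>\<omega>. h \<omega> * r0 \<omega> * \<alpha> \<omega>) - (wexp (\<lambda>\<omega>. h \<omega> * r0 \<omega> * \<alpha> \<omega>) * p + wexp (\<lambda>\<omega>. h \<omega> * r0 \<omega> * \<gamma> \<omega>) * d))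
     = wexp (\<lambda>\<omega>. h \<omega> * (r1 \<omega> * (p * \<alpha> \<omega> + d * \<gamma> \<omega>) + r0 \<omega> * ((1 - p) * \<alpha> \<omega> - d * \<gamma> \<omega>)))"
    unfolding wexp_multc[symmetric] wexp_add[symmetric] wexp_diff[symmetric]
    by (intro wexp_cong) (simp add: algebra_simps)
  also have "\<dots> = wexp (\<lambda>\<omega>. h \<omega> * ((p * \<alpha> \<omega> + d * \<gamma> \<omega>)\<^sup>2 / (p + d * \<beta> \<omega>) +
                  ((1 - p) * \<alpha> \<omega> - d * \<gamma> \<omega>)\<^sup>2 / (1 - p - d * \<beta> \<omega>)))"
    by (intro wexp_cong) (simp add: r1_def r0_def power2_eq_square)
  finally show ?thesis .
qed

end

section \<open>The gain from one edge variable\<close>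

text \<open>For nonnegative arguments, a strictly concave function below the identity. It bounds the solution of \<open>f' = 1 - f\<close> with \<open>f 0 = 0\<close>,
  and unlike this solution it is rational.\<close>

definition sat :: "real \<Rightarrow> real" where "sat y = y / (1 + y / 2)"

lemma sat_nonneg: "0 \<le> y \<Longrightarrow> 0 \<le> sat y"
  by (simp add: sat_def)

lemma sat_0: "sat 0 = 0" by (simp add: sat_def)

text \<open>If \<open>f\<close> grows by \<open>y (1 - f)\<close> when \<open>Y\<close> grows by \<open>y\<close>, then \<open>f \<le> sat Y\<close> is preserved up to second order.\<close>

lemma sat_step:
  assumes "0 \<le> Y" "0 \<le> y" "y \<le> 1"
  shows "(1 - y) * sat Y + y \<le> sat (Y + y) + y\<^sup>2 / 2"
proof -
  have p: "1 + Y/2 > 0" "1 + (Y+y)/2 > 0" using assms by (auto intro: add_pos_nonneg)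
  have e1: "sat (Y + y) - sat Y = y / ((1 + Y/2) * (1 + (Y+y)/2))"
    using p by (simp add: sat_def field_simps)
  have e2: "1 - sat Y = (1 - Y/2) / (1 + Y/2)" using p by (simp add: sat_def field_simps)
  have "(1 - Y/2) * (1 + (Y+y)/2) \<le> 1 + (y/2) * ((1 + Y/2) * (1 + (Y+y)/2))"
  proof -
    have "0 \<le> Y*Y" "0 \<le> Y*y" using assms by auto
    then have "(1 - Y/2) * (1 + (Y+y)/2) \<le> 1 + (y/2) * 1" by (simp add: field_simps)
    moreover have "1 * 1 \<le> (1 + Y/2) * (1 + (Y+y)/2)" using assms by (intro mult_mono) auto
    then have "(y/2) * 1 \<le> (y/2) * ((1 + Y/2) * (1 + (Y+y)/2))" using assms by (intro mult_left_mono) auto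
    ultimately show ?thesis by linarith
  qed
  then have "(1 - Y/2) / (1 + Y/2) \<le> 1 / ((1 + Y/2) * (1 + (Y+y)/2)) + y/2"
  proof -
    assume le: "(1 - Y/2) * (1 + (Y+y)/2) \<le> 1 + (y/2) * ((1 + Y/2) * (1 + (Y+y)/2))"
    have gen: "N / P \<le> 1 / (P * Q) + z" if "P > 0" "Q > 0" "N * Q \<le> 1 + z * (P * Q)" for N P Q z :: real
      using that by (simp add: field_simps)
    show ?thesis by (rule gen[OF p le])
  qed
  then have "y * ((1 - Y/2) / (1 + Y/2)) \<le> y * (1 / ((1 + Y/2) * (1 + (Y+y)/2)) + y/2)"
    using assms by (intro mult_left_mono) auto
  then have "y * (1 - sat Y) \<le> (sat (Y + y) - sat Y) + y\<^sup>2/2"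
    unfolding e1 e2 by (simp add: algebra_simps power2_eq_square)
  then show ?thesis by (simp add: algebra_simps)
qed

lemma sat_tangent:
  assumes "0 \<le> y" "0 \<le> y0"
  shows "sat y \<le> sat y0 + (y - y0) / (1 + y0/2)\<^sup>2"
proof -
  have p: "1 + y/2 > 0" "1 + y0/2 > 0" using assms by auto
  have "sat y - sat y0 = (y - y0) / ((1 + y/2) * (1 + y0/2))"
    using p by (simp add: sat_def field_simps)
  also have "\<dots> \<le> (y - y0) / (1 + y0/2)\<^sup>2"
  proof -
    have "(y - y0) / ((1 + y/2) * (1 + y0/2)) - (y - y0) / (1 + y0/2)\<^sup>2
        = - (y - y0)\<^sup>2 / (2 * (1 + y/2) * (1 + y0/2)\<^sup>2)"
      using p by (simp add: divide_simps power2_eq_square) (simp add: algebra_simps)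
    also have "\<dots> \<le> 0" using p by (simp add: divide_nonpos_pos)
    finally show ?thesis by simp
  qed
  finally show ?thesis by simp
qed

text \<open>\<open>signal a b\<close> times the product of the two weights over \<open>n\<close> is, to leading order, the information that an
  edge variable carries about the product of the two signs, \<open>edge_corr a b\<close> is the correlation of the
  signs across an edge, and \<open>damping a b\<close> is the coefficient of the term that makes the growth of
  information sublinear.\<close>

definition signal :: "real \<Rightarrow> real \<Rightarrow> real" where "signal a b = (a - b)\<^sup>2 / (2 * (a + b))"
definition edge_corr :: "real \<Rightarrow> real \<Rightarrow> real" where "edge_corr a b = (a - b) / (a + b)"
definition damping :: "real \<Rightarrow> real \<Rightarrow> real" where "damping a b = (1 - (edge_corr a b)\<^sup>2) / 2"

text \<open>A constant for all error terms; only its independence of \<open>n\<close> and of the weights matters.\<close>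

definition err_const :: "real \<Rightarrow> real \<Rightarrow> real" where
  "err_const a b = 8 * signal a b / (1 - \<bar>edge_corr a b\<bar>)\<^sup>2 + 10 * (max a b)\<^sup>2"

context
  fixes a b :: real
  assumes ab: "a > 0" "b > 0"
begin

lemma edge_corr_bound: "\<bar>edge_corr a b\<bar> < 1"
  using ab by (auto simp: edge_corr_def abs_if divide_simps)

lemma damping_pos: "0 < damping a b" "damping a b \<le> 1 / 2"
proof -
  have "(edge_corr a b)\<^sup>2 < 1" using edge_corr_bound by (simp add: abs_square_less_1)
  then show "0 < damping a b" "damping a b \<le> 1 / 2" by (auto simp: damping_def)
qed

lemma signal_nonneg: "0 \<le> signal a b" using ab by (simp add: signal_def)

lemma err_const_bounds: "8 * signal a b / (1 - \<bar>edge_corr a b\<bar>)\<^sup>2 \<le> err_const a b" "10 * (max a b)\<^sup>2 \<le> err_const a b"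
  using signal_nonneg by (auto simp: err_const_def)

lemma err_const_nonneg: "0 \<le> err_const a b"
  using order_trans[OF _ err_const_bounds(2)] by simp

lemma signal_le: "signal a b \<le> max a b / 2"
proof -
  have "(a - b)\<^sup>2 \<le> max a b * (a + b)"
  proof (cases "a \<ge> b")
    case True
    then have "(a-b)\<^sup>2 \<le> a * (a + b)" using ab
      unfolding power2_eq_square by (intro mult_mono) auto
    then show ?thesis using True by (simp add: max_def)
  next
    case False
    then have "(b-a) * (b-a) \<le> b * (a + b)" using ab by (intro mult_mono) auto
    then have "(a-b)\<^sup>2 \<le> b * (a + b)" by (simp add: power2_eq_square algebra_simps)
    then show ?thesis using False by (simp add: max_def)
  qed
  then show ?thesis using ab by (simp add: signal_def field_simps)
qed

text \<open>The gain when the two signs are conditionally independent: \<open>\<alpha>\<close> is the conditional mean of one sign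
  and \<open>s\<close> is \<open>edge_corr a b\<close> times that of the other. It holds because
  \<open>(1 - \<alpha>\<^sup>2)\<^sup>2 - (1 - s\<^sup>2 \<alpha>\<^sup>2) = - \<alpha>\<^sup>2 (2 - \<alpha>\<^sup>2 - s\<^sup>2)\<close>.\<close>

lemma ideal_gain:
  fixes s \<alpha> :: real
  assumes s: "\<bar>s\<bar> \<le> \<bar>edge_corr a b\<bar>" and al: "\<bar>\<alpha>\<bar> \<le> 1"
  shows "(1 - \<alpha>\<^sup>2)\<^sup>2 / (1 + s * \<alpha>) \<le> 1 - s * \<alpha> - damping a b * \<alpha>\<^sup>2"
proof -
  let ?th = "edge_corr a b"
  have th: "?th\<^sup>2 < 1" using edge_corr_bound by (simp add: abs_square_less_1)
  have s2: "s\<^sup>2 \<le> ?th\<^sup>2" using s by (simp add: abs_le_square_iff)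
  have a2: "\<alpha>\<^sup>2 \<le> 1" using al by (simp add: abs_square_le_1)
  have sa: "\<bar>s * \<alpha>\<bar> < 1"
  proof -
    have "\<bar>s * \<alpha>\<bar> \<le> \<bar>s\<bar> * 1" unfolding abs_mult using al by (intro mult_left_mono) auto
    then show ?thesis using s edge_corr_bound by linarith
  qed
  have pos: "1 + s * \<alpha> > 0" "1 + s * \<alpha> \<le> 2" using sa by (auto simp: abs_if split: if_splits)
  have "damping a b * (1 + s * \<alpha>) \<le> damping a b * 2" using pos damping_pos by (intro mult_left_mono) auto
  also have "\<dots> \<le> 2 - \<alpha>\<^sup>2 - s\<^sup>2" using s2 a2 by (simp add: damping_def)
  finally have "\<alpha>\<^sup>2 * (damping a b * (1 + s * \<alpha>)) \<le> \<alpha>\<^sup>2 * (2 - \<alpha>\<^sup>2 - s\<^sup>2)"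
    by (intro mult_left_mono) auto
  then have "(1 - \<alpha>\<^sup>2)\<^sup>2 \<le> (1 - s * \<alpha> - damping a b * \<alpha>\<^sup>2) * (1 + s * \<alpha>)"
    by (simp add: power2_eq_square algebra_simps)
  then show ?thesis using pos by (simp add: pos_divide_le_eq)
qed

text \<open>The same without conditional independence: \<open>m\<close> and \<open>\<beta>\<close> are the conditional means of the second sign and of the
  product, \<open>B\<close> is an earlier conditional mean of the second sign. The ideal values are \<open>m = B\<close> and \<open>\<beta> = \<alpha> m\<close>.\<close>

lemma perturbed_gain:
  fixes \<alpha> \<beta> m B :: real
  assumes al: "\<bar>\<alpha>\<bar> \<le> 1" and be: "\<bar>\<beta>\<bar> \<le> 1" and m: "\<bar>m\<bar> \<le> 1" and B: "\<bar>B\<bar> \<le> 1"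
  defines "\<theta> \<equiv> edge_corr a b" and "C \<equiv> 8 / (1 - \<bar>edge_corr a b\<bar>)\<^sup>2"
  shows "(m - \<alpha> * \<beta>)\<^sup>2 / (1 + \<theta> * \<beta>)
    \<le> B\<^sup>2 - \<theta> * B ^ 3 * \<alpha> - damping a b * B\<^sup>2 * \<alpha>\<^sup>2 + C * (\<bar>m - B\<bar> + \<bar>\<beta> - \<alpha> * m\<bar>)"
proof -
  let ?e = "\<bar>m - B\<bar> + \<bar>\<beta> - \<alpha> * m\<bar>"
  let ?r = "1 - \<bar>\<theta>\<bar>"
  have r: "0 < ?r" "?r \<le> 1" using edge_corr_bound by (auto simp: \<theta>_def)
  have low: "?r \<le> 1 + \<theta> * x" if "\<bar>x\<bar> \<le> 1" for x
  proof -
    have "\<bar>\<theta> * x\<bar> \<le> \<bar>\<theta>\<bar> * 1" unfolding abs_mult using that by (intro mult_left_mono) auto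
    then show ?thesis by linarith
  qed
  have aB: "\<bar>\<alpha> * B\<bar> \<le> 1" using al B by (simp add: abs_mult mult_le_one)
  have ab': "\<bar>\<alpha> * \<beta>\<bar> \<le> 1" using al be by (simp add: abs_mult mult_le_one)
  let ?X = "m - \<alpha> * \<beta>" and ?Y = "B - \<alpha> * (\<alpha> * B)"
  let ?p = "1 + \<theta> * \<beta>" and ?q = "1 + \<theta> * (\<alpha> * B)"
  have p: "?r \<le> ?p" "?r \<le> ?q" using low[OF be] low[OF aB] by auto
  have bd: "\<bar>\<beta> - \<alpha> * B\<bar> \<le> ?e"
  proof -
    have "\<beta> - \<alpha> * B = (\<beta> - \<alpha> * m) + \<alpha> * (m - B)" by (simp add: algebra_simps)
    then have "\<bar>\<beta> - \<alpha> * B\<bar> \<le> \<bar>\<beta> - \<alpha> * m\<bar> + \<bar>\<alpha> * (m - B)\<bar>" by (simp only: abs_triangle_ineq)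
    moreover have "\<bar>\<alpha> * (m - B)\<bar> \<le> 1 * \<bar>m - B\<bar>" unfolding abs_mult using al by (intro mult_right_mono) auto
    ultimately show ?thesis by simp
  qed
  have dd: "\<bar>?X - ?Y\<bar> \<le> 2 * ?e"
  proof -
    have "?X - ?Y = (m - B) - \<alpha> * (\<beta> - \<alpha> * B)" by algebra
    then have "\<bar>?X - ?Y\<bar> \<le> \<bar>m - B\<bar> + \<bar>\<alpha> * (\<beta> - \<alpha> * B)\<bar>" by (simp only: abs_triangle_ineq4)
    moreover have "\<bar>\<alpha> * (\<beta> - \<alpha> * B)\<bar> \<le> 1 * \<bar>\<beta> - \<alpha> * B\<bar>" unfolding abs_mult using al by (intro mult_right_mono) auto
    moreover have "x \<le> 2 * (A + w)" if "x \<le> A + y" "y \<le> 1 * z" "z \<le> A + w" "0 \<le> w" for x y z A w :: real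
    proof -
      have "x \<le> A + (A + w)" using that by simp
      then show ?thesis using that(4) by simp
    qed
    ultimately show ?thesis using bd abs_ge_zero by blast
  qed
  have d_le: "\<bar>?X\<bar> \<le> 2" using m ab' by linarith
  have d0_le: "\<bar>?Y\<bar> \<le> 1"
  proof -
    have "?Y = B * (1 - \<alpha>\<^sup>2)" by (simp add: algebra_simps power2_eq_square)
    moreover have "0 \<le> 1 - \<alpha>\<^sup>2" "1 - \<alpha>\<^sup>2 \<le> 1" using al by (auto simp: abs_square_le_1)
    ultimately show ?thesis using B by (simp add: abs_mult mult_le_one)
  qed
  have sq: "\<bar>?X\<^sup>2 - ?Y\<^sup>2\<bar> \<le> 6 * ?e"
  proof -
    have "?X\<^sup>2 - ?Y\<^sup>2 = (?X + ?Y) * (?X - ?Y)" by (simp add: algebra_simps power2_eq_square)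
    then have "\<bar>?X\<^sup>2 - ?Y\<^sup>2\<bar> = \<bar>?X + ?Y\<bar> * \<bar>?X - ?Y\<bar>" by (simp only: abs_mult)
    also have "\<dots> \<le> 3 * (2 * ?e)" using dd d_le d0_le by (intro mult_mono) auto
    finally show ?thesis by simp
  qed
  have "?X\<^sup>2 / ?p - ?Y\<^sup>2 / ?q = (?X\<^sup>2 - ?Y\<^sup>2) / ?p + ?Y\<^sup>2 * (\<theta> * (\<alpha> * B - \<beta>)) / (?p * ?q)"
    using p r by (simp add: divide_simps) (simp add: algebra_simps)
  also have "\<dots> \<le> 6 * ?e / ?r\<^sup>2 + ?e / ?r\<^sup>2"
  proof (intro add_mono)
    have "(?X\<^sup>2 - ?Y\<^sup>2) / ?p \<le> 6 * ?e / ?p" using p r sq by (intro divide_right_mono) auto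
    also have "\<dots> \<le> 6 * ?e / ?r\<^sup>2"
    proof (intro divide_left_mono)
      show "?r\<^sup>2 \<le> ?p" using p r by (smt (verit) power2_eq_square mult_left_le)
    qed (use p r in auto)
    finally show "(?X\<^sup>2 - ?Y\<^sup>2) / ?p \<le> 6 * ?e / ?r\<^sup>2" .
    have "\<bar>?Y\<^sup>2 * (\<theta> * (\<alpha> * B - \<beta>))\<bar> \<le> 1 * (1 * ?e)"
      unfolding abs_mult using d0_le bd r
      by (intro mult_mono) (auto simp: abs_square_le_1 abs_minus_commute)
    then have "?Y\<^sup>2 * (\<theta> * (\<alpha> * B - \<beta>)) / (?p * ?q) \<le> ?e / (?p * ?q)"
      using p r by (intro divide_right_mono) auto
    also have "\<dots> \<le> ?e / ?r\<^sup>2"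
    proof (intro divide_left_mono)
      show "?r\<^sup>2 \<le> ?p * ?q" unfolding power2_eq_square using p r by (intro mult_mono) auto
    qed (use p r in auto)
    finally show "?Y\<^sup>2 * (\<theta> * (\<alpha> * B - \<beta>)) / (?p * ?q) \<le> ?e / ?r\<^sup>2" .
  qed
  also have "\<dots> \<le> C * ?e" using r by (simp add: C_def \<theta>_def field_simps)
  finally have 1: "?X\<^sup>2 / ?p \<le> ?Y\<^sup>2 / ?q + C * ?e" by simp
  have "?Y\<^sup>2 / ?q = B\<^sup>2 * ((1 - \<alpha>\<^sup>2)\<^sup>2 / (1 + (\<theta> * B) * \<alpha>))"
    by (simp add: power2_eq_square algebra_simps)
  also have "\<dots> \<le> B\<^sup>2 * (1 - (\<theta> * B) * \<alpha> - damping a b * \<alpha>\<^sup>2)"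
    by (intro mult_left_mono ideal_gain al) (use B in \<open>auto simp: \<theta>_def abs_mult mult_left_le\<close>)
  also have "\<dots> = B\<^sup>2 - \<theta> * B ^ 3 * \<alpha> - damping a b * B\<^sup>2 * \<alpha>\<^sup>2"
    by (simp add: algebra_simps power2_eq_square power3_eq_cube)
  finally show ?thesis using 1 by simp
qed

text \<open>The information after observing one edge variable, which is present with probability \<open>a t\<close> for equal and
  \<open>b t\<close> for opposite signs. The first fraction belongs to an edge, the second one to a non-edge, whose
  contribution is of order \<open>t\<^sup>2\<close>.\<close>

lemma edge_gain:
  fixes \<alpha> \<beta> m B t :: real
  assumes al: "\<bar>\<alpha>\<bar> \<le> 1" and be: "\<bar>\<beta>\<bar> \<le> 1" and m: "\<bar>m\<bar> \<le> 1" and B: "\<bar>B\<bar> \<le> 1"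
    and t: "0 \<le> t" "max a b * t \<le> 1 / 2"
  defines "p \<equiv> (a + b) * t / 2" and "d \<equiv> (a - b) * t / 2"
  shows "(p * \<alpha> + d * m)\<^sup>2 / (p + d * \<beta>) + ((1 - p) * \<alpha> - d * m)\<^sup>2 / (1 - p - d * \<beta>)
    \<le> \<alpha>\<^sup>2 + signal a b * t * (B\<^sup>2 - edge_corr a b * B ^ 3 * \<alpha> - damping a b * B\<^sup>2 * \<alpha>\<^sup>2)
       + 8 * signal a b / (1 - \<bar>edge_corr a b\<bar>)\<^sup>2 * t * (\<bar>m - B\<bar> + \<bar>\<beta> - \<alpha> * m\<bar>) + 8 * (max a b)\<^sup>2 * t\<^sup>2"
proof (cases "t = 0")
  case True then show ?thesis by (simp add: p_def d_def)
next
  case False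
  then have t0: "t > 0" using t by simp
  let ?\<delta> = "m - \<alpha> * \<beta>" and ?th = "edge_corr a b"
  have s: "a + b > 0" using ab by simp
  have d_eq: "d = ?th * p" using s by (simp add: d_def p_def edge_corr_def)
  have p0: "p > 0" using s t0 by (simp add: p_def)
  have thb: "\<bar>?th * \<beta>\<bar> < 1"
  proof -
    have "\<bar>?th * \<beta>\<bar> \<le> \<bar>?th\<bar> * 1" unfolding abs_mult using be by (intro mult_left_mono) auto
    then show ?thesis using edge_corr_bound by linarith
  qed
  have P: "p + d * \<beta> = p * (1 + ?th * \<beta>)" by (simp add: d_eq algebra_simps)
  have P0: "p + d * \<beta> > 0" unfolding P using p0 thb by (intro mult_pos_pos) (auto simp: abs_if split: if_splits)
  have d_abs: "p + \<bar>d\<bar> \<le> 1/2" "\<bar>d\<bar> \<le> max a b * t"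
  proof -
    have "p + \<bar>d\<bar> = max a b * t" using t0 by (auto simp: p_def d_def max_def abs_mult field_simps)
    then show "p + \<bar>d\<bar> \<le> 1/2" "\<bar>d\<bar> \<le> max a b * t" using t p0 by auto
  qed
  have dbe: "\<bar>d * \<beta>\<bar> \<le> \<bar>d\<bar>" unfolding abs_mult using be by (intro mult_left_le) auto
  have Q: "1 - p - d * \<beta> \<ge> 1/2" using d_abs dbe by (simp add: abs_if split: if_splits)
  have e: "(p * \<alpha> + d * m)\<^sup>2 / (p + d * \<beta>) + ((1 - p) * \<alpha> - d * m)\<^sup>2 / (1 - p - d * \<beta>)
     = \<alpha>\<^sup>2 + d\<^sup>2 * ?\<delta>\<^sup>2 / (p + d * \<beta>) + d\<^sup>2 * ?\<delta>\<^sup>2 / (1 - p - d * \<beta>)"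
  proof -
    let ?P = "p + d * \<beta>" and ?Q = "1 - p - d * \<beta>"
    have "p * \<alpha> + d * m = ?P * \<alpha> + d * ?\<delta>" "(1 - p) * \<alpha> - d * m = ?Q * \<alpha> - d * ?\<delta>"
      by (simp_all add: algebra_simps)
    moreover have "(P * \<alpha> + x)\<^sup>2 / P + (Q * \<alpha> - x)\<^sup>2 / Q = \<alpha>\<^sup>2 + x\<^sup>2 / P + x\<^sup>2 / Q"
      if "P \<noteq> 0" "Q \<noteq> 0" "P + Q = 1" for P Q x :: real
    proof -
      have "(P * \<alpha> + x)\<^sup>2 / P = P * \<alpha>\<^sup>2 + 2 * \<alpha> * x + x\<^sup>2 / P"
        "(Q * \<alpha> - x)\<^sup>2 / Q = Q * \<alpha>\<^sup>2 - 2 * \<alpha> * x + x\<^sup>2 / Q"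
        using that by (simp_all add: power2_eq_square field_simps)
      moreover have "P * \<alpha>\<^sup>2 + Q * \<alpha>\<^sup>2 = \<alpha>\<^sup>2" using that by (metis distrib_right mult_1)
      ultimately show ?thesis by linarith
    qed
    ultimately show ?thesis using P0 Q by (simp add: power_mult_distrib)
  qed
  have "d\<^sup>2 * ?\<delta>\<^sup>2 / (p + d * \<beta>) = signal a b * t * (?\<delta>\<^sup>2 / (1 + ?th * \<beta>))"
  proof -
    have "signal a b * (2 * (a + b)) = (a - b)\<^sup>2"
      unfolding signal_def using ab by (intro nonzero_eq_divide_eq[THEN iffD1]) auto
    then have "d\<^sup>2 = signal a b * (2 * (a + b)) * t\<^sup>2 / 4" by (simp add: d_def power_mult_distrib power_divide)
    then have "d\<^sup>2 = signal a b * t * p" by (simp add: p_def power2_eq_square field_simps)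
    then have "d\<^sup>2 / p = signal a b * t" using p0 by simp
    moreover have "x * D / (p * R) = x / p * (D / R)" for x D R :: real by simp
    ultimately show ?thesis unfolding P by metis
  qed
  also have "\<dots> \<le> signal a b * t * (B\<^sup>2 - ?th * B ^ 3 * \<alpha> - damping a b * B\<^sup>2 * \<alpha>\<^sup>2
      + 8 / (1 - \<bar>?th\<bar>)\<^sup>2 * (\<bar>m - B\<bar> + \<bar>\<beta> - \<alpha> * m\<bar>))"
    using signal_nonneg t by (intro mult_left_mono perturbed_gain al be m B) auto
  finally have 1: "d\<^sup>2 * ?\<delta>\<^sup>2 / (p + d * \<beta>) \<le> \<dots>" .
  have "d\<^sup>2 * ?\<delta>\<^sup>2 / (1 - p - d * \<beta>) \<le> d\<^sup>2 * ?\<delta>\<^sup>2 / (1/2)"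
    using Q by (intro divide_left_mono) auto
  also have "\<dots> \<le> 8 * (max a b)\<^sup>2 * t\<^sup>2"
  proof -
    have "d\<^sup>2 \<le> (max a b * t)\<^sup>2" using d_abs(2) t0 ab by (simp add: abs_le_square_iff[symmetric] abs_mult)
    moreover have "?\<delta>\<^sup>2 \<le> 4"
    proof -
      have "\<bar>\<alpha> * \<beta>\<bar> \<le> 1" using al be by (simp add: abs_mult mult_le_one)
      then have "\<bar>?\<delta>\<bar> \<le> \<bar>2\<bar>" using m by linarith
      then show ?thesis unfolding abs_le_square_iff by simp
    qed
    ultimately have "d\<^sup>2 * ?\<delta>\<^sup>2 \<le> (max a b * t)\<^sup>2 * 4" by (intro mult_mono) auto
    then show ?thesis by (simp add: power_mult_distrib algebra_simps)
  qed
  finally show ?thesis unfolding e using 1 by (simp add: algebra_simps)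
qed

end

section \<open>Two communities on a finite set of vertices\<close>

context finite_weights
begin

lemma cexp_cong_observable:
  assumes "determines Z Z'" "determines Z' Z" "\<omega> \<in> \<Omega>"
  shows "cexp Z F \<omega> = cexp Z' F \<omega>"
proof -
  have "{\<omega>' \<in> \<Omega>. Z \<omega>' = Z \<omega>} = {\<omega>' \<in> \<Omega>. Z' \<omega>' = Z' \<omega>}"
    using assms unfolding determines_def by blast
  then show ?thesis by (simp add: cexp_def)
qed

lemma info_cong_observable:
  "determines Z Z' \<Longrightarrow> determines Z' Z \<Longrightarrow> info Z F = info Z' F"
  unfolding info_def by (intro wexp_cong) (simp add: cexp_cong_observable[of Z Z'])

end

text \<open>The possible edges on the vertex set \<open>V\<close>.\<close>

definition pairs :: "nat set \<Rightarrow> nat set set" where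
  "pairs V = {e. e \<subseteq> V \<and> card e = 2}"

text \<open>A configuration of signs is given by the set \<open>x\<close> of the vertices with sign \<open>1\<close>. The edge \<open>e\<close> has
  rate \<open>a\<close> if its ends have the same sign, that is, if \<open>e\<close> lies inside \<open>x\<close> or outside. The denominator \<open>n\<close> is a
  parameter that need not be the number of vertices.\<close>

definition eprob :: "real \<Rightarrow> real \<Rightarrow> nat \<Rightarrow> (nat \<Rightarrow> real) \<Rightarrow> nat set \<Rightarrow> nat set \<Rightarrow> real" where
  "eprob a b n \<phi> x e = min 1 ((if e \<subseteq> x \<or> e \<inter> x = {} then a else b) * (\<Prod>i\<in>e. \<phi> i) / real n)"

text \<open>An outcome consists of the signs and of the set of edges that are present; only edges from \<open>E\<close> are
  considered. The signs are uniform, and given the signs the edges are independent.\<close>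

definition worlds :: "nat set \<Rightarrow> nat set set \<Rightarrow> (nat set \<times> nat set set) set" where
  "worlds V E = Pow V \<times> Pow E"

definition world_weight ::
  "real \<Rightarrow> real \<Rightarrow> nat \<Rightarrow> (nat \<Rightarrow> real) \<Rightarrow> nat set \<Rightarrow> nat set set \<Rightarrow> nat set \<times> nat set set \<Rightarrow> real" where
  "world_weight a b n \<phi> V E \<omega> = (1/2) ^ card V *
     (\<Prod>e\<in>E. if e \<in> snd \<omega> then eprob a b n \<phi> (fst \<omega>) e else 1 - eprob a b n \<phi> (fst \<omega>) e)"

lemma world_weight_pair: "world_weight a b n \<phi> V E (x, g) = (1/2) ^ card V *
     (\<Prod>e\<in>E. if e \<in> g then eprob a b n \<phi> x e else 1 - eprob a b n \<phi> x e)"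
  by (simp only: world_weight_def fst_conv snd_conv)

definition spin :: "nat \<Rightarrow> nat set \<times> nat set set \<Rightarrow> real" where
  "spin i \<omega> = (if i \<in> fst \<omega> then 1 else -1)"

text \<open>What is observed: the signs of the vertices in \<open>T\<close> and the graph on the vertices in \<open>V\<close>.\<close>

definition obs :: "nat set \<Rightarrow> nat set \<Rightarrow> nat set \<times> nat set set \<Rightarrow> nat set \<times> nat set set" where
  "obs V T \<omega> = (fst \<omega> \<inter> T, snd \<omega> \<inter> Pow V)"

lemma sum_Pow_insert:
  fixes f :: "'c set \<Rightarrow> real"
  assumes "finite A" "c \<notin> A"
  shows "(\<Sum>B\<in>Pow (insert c A). f B) = (\<Sum>B\<in>Pow A. f (insert c B) + f B)"
proof -
  have inj: "inj_on (insert c) (Pow A)" using assms by (auto simp: inj_on_def)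
  have "(\<Sum>B\<in>Pow (insert c A). f B) = (\<Sum>B\<in>Pow A. f B) + (\<Sum>B\<in>insert c ` Pow A. f B)"
    unfolding Pow_insert using assms by (intro sum.union_disjoint) auto
  also have "(\<Sum>B\<in>insert c ` Pow A. f B) = (\<Sum>B\<in>Pow A. f (insert c B))"
    using inj by (simp add: sum.reindex)
  finally show ?thesis by (simp add: sum.distrib)
qed

lemma finite_pairs: "finite V \<Longrightarrow> finite (pairs V)"
  by (rule finite_subset[of _ "Pow V"]) (auto simp: pairs_def)

lemma eprob_insert: "u \<notin> e \<Longrightarrow> eprob a b n \<phi> (insert u x) e = eprob a b n \<phi> x e"
  by (auto simp: eprob_def)

locale two_block =
  fixes a b :: real and n :: nat
  assumes a_pos: "a > 0" and b_pos: "b > 0" and n_pos: "n > 0"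
begin

text \<open>The expectation as an explicit double sum; it makes sense for all weights \<open>\<phi>\<close>.\<close>

definition ev :: "(nat \<Rightarrow> real) \<Rightarrow> nat set \<Rightarrow> nat set set \<Rightarrow> (nat set \<times> nat set set \<Rightarrow> real) \<Rightarrow> real" where
  "ev \<phi> V E F = (\<Sum>x\<in>Pow V. \<Sum>g\<in>Pow E. world_weight a b n \<phi> V E (x, g) * F (x, g))"

lemma eprob_range:
  assumes "\<And>i. i \<in> e \<Longrightarrow> 0 \<le> \<phi> i"
  shows "0 \<le> eprob a b n \<phi> x e" "eprob a b n \<phi> x e \<le> 1"
  using assms a_pos b_pos by (auto simp: eprob_def intro!: mult_nonneg_nonneg divide_nonneg_nonneg prod_nonneg)

lemma finite_weights_worlds:
  assumes "finite V" "finite E" "\<And>i. i \<in> \<Union>E \<Longrightarrow> 0 \<le> \<phi> i"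
  shows "finite_weights (worlds V E) (world_weight a b n \<phi> V E)"
proof
  show "finite (worlds V E)" using assms by (simp add: worlds_def)
  fix \<omega> assume "\<omega> \<in> worlds V E"
  have "0 \<le> eprob a b n \<phi> (fst \<omega>) e \<and> eprob a b n \<phi> (fst \<omega>) e \<le> 1" if "e \<in> E" for e
    using assms(3) that by (intro conjI eprob_range) auto
  then show "0 \<le> world_weight a b n \<phi> V E \<omega>"
    unfolding world_weight_def by (intro mult_nonneg_nonneg prod_nonneg) auto
qed

lemma wexp_eq_ev:
  assumes "finite V" "finite E" "\<And>i. i \<in> \<Union>E \<Longrightarrow> 0 \<le> \<phi> i"
  shows "finite_weights.wexp (worlds V E) (world_weight a b n \<phi> V E) F = ev \<phi> V E F"
proof -
  interpret finite_weights "worlds V E" "world_weight a b n \<phi> V E" by (rule finite_weights_worlds[OF assms])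
  show ?thesis unfolding wexp_def unfolding ev_def worlds_def sum.cartesian_product by (simp add: case_prod_beta)
qed

lemma ev_cong: "(\<And>x g. x \<subseteq> V \<Longrightarrow> g \<subseteq> E \<Longrightarrow> F (x, g) = H (x, g)) \<Longrightarrow> ev \<phi> V E F = ev \<phi> V E H"
  unfolding ev_def by (intro sum.cong refl) auto

lemma ev_insert_edge:
  assumes "finite E" "e \<notin> E"
  shows "ev \<phi> V (insert e E) F =
    ev \<phi> V E (\<lambda>(x, g). eprob a b n \<phi> x e * F (x, insert e g) + (1 - eprob a b n \<phi> x e) * F (x, g))"
  unfolding ev_def
proof (rule sum.cong[OF refl])
  fix x
  let ?W = "world_weight a b n \<phi> V" and ?p = "eprob a b n \<phi> x"
  have W: "?W (insert e E) (x, insert e g) = ?p e * ?W E (x, g)"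
    "?W (insert e E) (x, g) = (1 - ?p e) * ?W E (x, g)" if "g \<in> Pow E" for g
  proof -
    have "(\<Prod>c\<in>E. if c \<in> insert e g then ?p c else 1 - ?p c) = (\<Prod>c\<in>E. if c \<in> g then ?p c else 1 - ?p c)"
      using assms by (intro prod.cong) auto
    then show "?W (insert e E) (x, insert e g) = ?p e * ?W E (x, g)"
      using assms by (simp add: world_weight_pair)
    show "?W (insert e E) (x, g) = (1 - ?p e) * ?W E (x, g)"
      using assms that by (auto simp add: world_weight_pair)
  qed
  have "(\<Sum>g\<in>Pow (insert e E). ?W (insert e E) (x, g) * F (x, g)) =
    (\<Sum>g\<in>Pow E. ?W (insert e E) (x, insert e g) * F (x, insert e g) + ?W (insert e E) (x, g) * F (x, g))"
    by (rule sum_Pow_insert[OF assms])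
  also have "\<dots> = (\<Sum>g\<in>Pow E. ?W E (x, g) *
      (case (x, g) of (x, g) \<Rightarrow> eprob a b n \<phi> x e * F (x, insert e g) + (1 - eprob a b n \<phi> x e) * F (x, g)))"
    by (intro sum.cong refl) (simp add: W algebra_simps)
  finally show "(\<Sum>g\<in>Pow (insert e E). ?W (insert e E) (x, g) * F (x, g)) = (\<Sum>g\<in>Pow E. ?W E (x, g) *
      (case (x, g) of (x, g) \<Rightarrow> eprob a b n \<phi> x e * F (x, insert e g) + (1 - eprob a b n \<phi> x e) * F (x, g)))" .
qed

lemma ev_insert_vertex:
  assumes "finite V" "u \<notin> V" "u \<notin> \<Union>E"
  shows "ev \<phi> (insert u V) E F = ev \<phi> V E (\<lambda>(x, g). (F (insert u x, g) + F (x, g)) / 2)"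
proof -
  let ?W = "world_weight a b n \<phi>"
  have W: "?W (insert u V) E (insert u x, g) = ?W V E (x, g) / 2"
    "?W (insert u V) E (x, g) = ?W V E (x, g) / 2" for x g
  proof -
    have "(\<Prod>c\<in>E. if c \<in> g then eprob a b n \<phi> (insert u x) c else 1 - eprob a b n \<phi> (insert u x) c)
        = (\<Prod>c\<in>E. if c \<in> g then eprob a b n \<phi> x c else 1 - eprob a b n \<phi> x c)"
      using assms by (intro prod.cong refl) (auto simp: eprob_insert)
    then show "?W (insert u V) E (insert u x, g) = ?W V E (x, g) / 2"
      using assms by (simp add: world_weight_pair)
    show "?W (insert u V) E (x, g) = ?W V E (x, g) / 2" using assms by (simp add: world_weight_pair)
  qed
  show ?thesis unfolding ev_def sum_Pow_insert[OF assms(1,2)]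
    unfolding sum.distrib[symmetric]
  proof (intro sum.cong refl)
    fix x g
    show "?W (insert u V) E (insert u x, g) * F (insert u x, g) + ?W (insert u V) E (x, g) * F (x, g) =
        ?W V E (x, g) * (case (x, g) of (x, g) \<Rightarrow> (F (insert u x, g) + F (x, g)) / 2)"
      unfolding W(1)[of x g] W(2)[of x g] by (simp add: field_simps)
  qed
qed

text \<open>Edges and vertices that a function does not look at can be removed.\<close>

lemma ev_marginal_edges:
  assumes "finite E" "E' \<subseteq> E"
    and F: "\<And>x g. x \<subseteq> V \<Longrightarrow> g \<subseteq> E \<Longrightarrow> F (x, g) = F (x, g \<inter> E')"
  shows "ev \<phi> V E F = ev \<phi> V E' F"
proof -
  have "finite (E - E')" using assms by simp
  have "D \<subseteq> E - E' \<Longrightarrow> ev \<phi> V (E' \<union> D) F = ev \<phi> V E' F" if "finite D" for D using that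
  proof (induction D)
    case empty then show ?case by simp
  next
    case (insert e D)
    have fin: "finite (E' \<union> D)" "e \<notin> E' \<union> D" using insert assms by (auto intro: finite_subset)
    have "ev \<phi> V (insert e (E' \<union> D)) F = ev \<phi> V (E' \<union> D)
      (\<lambda>(x, g). eprob a b n \<phi> x e * F (x, insert e g) + (1 - eprob a b n \<phi> x e) * F (x, g))"
      by (rule ev_insert_edge[OF fin])
    also have "\<dots> = ev \<phi> V (E' \<union> D) F"
    proof (rule ev_cong)
      fix x g assume xg: "x \<subseteq> V" "g \<subseteq> E' \<union> D"
      have "insert e g \<inter> E' = g \<inter> E'" using fin by auto
      then have "F (x, insert e g) = F (x, g)"
        using F[of x "insert e g"] F[of x g] xg insert.prems assms(2) by (metis (no_types, lifting) Diff_subset Un_subset_iff insert_subset order_trans)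
      then show "(case (x, g) of (x, g) \<Rightarrow> eprob a b n \<phi> x e * F (x, insert e g) + (1 - eprob a b n \<phi> x e) * F (x, g)) = F (x, g)"
        by (simp add: algebra_simps)
    qed
    also have "\<dots> = ev \<phi> V E' F" using insert by simp
    finally show ?case by simp
  qed
  from this[OF \<open>finite (E - E')\<close>] assms(2) show ?thesis by (simp add: Un_absorb1)
qed

lemma ev_marginal:
  assumes "finite V" "finite E" "E' \<subseteq> E" "V' \<subseteq> V" "\<Union>E' \<subseteq> V'"
    and F: "\<And>x g. x \<subseteq> V \<Longrightarrow> g \<subseteq> E \<Longrightarrow> F (x, g) = F (x \<inter> V', g \<inter> E')"
  shows "ev \<phi> V E F = ev \<phi> V' E' F"
proof -
  have "F (x, g) = F (x, g \<inter> E')" if "x \<subseteq> V" "g \<subseteq> E" for x g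
  proof -
    have "g \<inter> E' \<subseteq> E" "g \<inter> E' \<inter> E' = g \<inter> E'" using that by auto
    then show ?thesis using F[OF that] F[OF that(1), of "g \<inter> E'"] by simp
  qed
  then have 1: "ev \<phi> V E F = ev \<phi> V E' F" using assms by (intro ev_marginal_edges) auto
  have "D \<subseteq> V - V' \<Longrightarrow> ev \<phi> (V' \<union> D) E' F = ev \<phi> V' E' F" if "finite D" for D using that
  proof (induction D)
    case empty then show ?case by simp
  next
    case (insert u D)
    have fin: "finite (V' \<union> D)" "u \<notin> V' \<union> D" "u \<notin> \<Union>E'" using insert assms by (auto intro: finite_subset)
    have "ev \<phi> (insert u (V' \<union> D)) E' F = ev \<phi> (V' \<union> D) E' (\<lambda>(x, g). (F (insert u x, g) + F (x, g)) / 2)"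
      by (rule ev_insert_vertex[OF fin])
    also have "\<dots> = ev \<phi> (V' \<union> D) E' F"
    proof (rule ev_cong)
      fix x g assume xg: "x \<subseteq> V' \<union> D" "g \<subseteq> E'"
      have "insert u x \<inter> V' = x \<inter> V'" using fin by auto
      then have "F (insert u x, g) = F (x, g)"
        proof -
        have "x \<subseteq> V" "insert u x \<subseteq> V" "g \<subseteq> E" using xg insert.prems assms(3,4) by auto
        then show ?thesis using F[of "insert u x" g] F[of x g] \<open>insert u x \<inter> V' = x \<inter> V'\<close> by simp
      qed
      then show "(case (x, g) of (x, g) \<Rightarrow> (F (insert u x, g) + F (x, g)) / 2) = F (x, g)" by simp
    qed
    also have "\<dots> = ev \<phi> V' E' F" using insert by simp
    finally show ?case by simp
  qed
  from this[of "V - V'"] assms(1,4) have "ev \<phi> V E' F = ev \<phi> V' E' F" by (simp add: Un_absorb1)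
  with 1 show ?thesis by simp
qed

lemma ev_one: assumes "finite V" "finite E" shows "ev \<phi> V E (\<lambda>_. 1) = 1"
proof -
  have "ev \<phi> V E (\<lambda>_. 1) = ev \<phi> {} {} (\<lambda>_. 1)" by (rule ev_marginal) (use assms in auto)
  also have "\<dots> = 1" by (simp add: ev_def world_weight_pair)
  finally show ?thesis .
qed

text \<open>Against a function that ignores the edge \<open>e\<close>, its indicator acts like its probability.\<close>

lemma ev_edge_toggle:
  assumes "finite E" "e \<in> E"
    and F: "\<And>x g. x \<subseteq> V \<Longrightarrow> g \<subseteq> E - {e} \<Longrightarrow> F (x, insert e g) = F (x, g)"
  shows "ev \<phi> V E (\<lambda>\<omega>. F \<omega> * of_bool (e \<in> snd \<omega>)) = ev \<phi> V E (\<lambda>\<omega>. F \<omega> * eprob a b n \<phi> (fst \<omega>) e)"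
proof -
  have "finite (E - {e})" "e \<notin> E - {e}" using assms by auto
  note ins = ev_insert_edge[OF this, of \<phi> V]
  have E: "insert e (E - {e}) = E" using assms by auto
  show ?thesis unfolding ins[unfolded E]
  proof (rule ev_cong)
    fix x g assume "x \<subseteq> V" "g \<subseteq> E - {e}"
    then have "F (x, insert e g) = F (x, g)" "e \<notin> g" using F by auto
    then show "(case (x, g) of (x, g) \<Rightarrow>
          eprob a b n \<phi> x e * (F (x, insert e g) * of_bool (e \<in> snd (x, insert e g))) +
          (1 - eprob a b n \<phi> x e) * (F (x, g) * of_bool (e \<in> snd (x, g)))) =
        (case (x, g) of (x, g) \<Rightarrow>
          eprob a b n \<phi> x e * (F (x, insert e g) * eprob a b n \<phi> (fst (x, insert e g)) e) +
          (1 - eprob a b n \<phi> x e) * (F (x, g) * eprob a b n \<phi> (fst (x, g)) e))"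
      by (simp add: algebra_simps)
  qed
qed

text \<open>A function that sees neither the sign of \<open>u\<close> nor its edges is uncorrelated with this sign.\<close>

lemma ev_spin_flip:
  assumes "finite V" "finite E" "u \<in> V"
    and F: "\<And>x g. x \<subseteq> V \<Longrightarrow> g \<subseteq> E \<Longrightarrow> F (x, g) = F (x - {u}, {e \<in> g. u \<notin> e})"
  shows "ev \<phi> V E (\<lambda>\<omega>. F \<omega> * spin u \<omega>) = 0"
proof -
  let ?E = "{e \<in> E. u \<notin> e}"
  have step: "ev \<phi> (insert u (V - {u})) ?E (\<lambda>\<omega>. F \<omega> * spin u \<omega>) = ev \<phi> (V - {u}) ?E (\<lambda>_. 0)"
  proof (subst ev_insert_vertex; (rule ev_cong)?)
    fix x g assume xg: "x \<subseteq> V - {u}" "g \<subseteq> ?E"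
    have "insert u x \<subseteq> V" "x \<subseteq> V" "g \<subseteq> E" "insert u x - {u} = x - {u}" using xg assms(3) by auto
    then have "F (insert u x, g) = F (x, g)" using F[of "insert u x" g] F[of x g] by simp
    moreover have "u \<notin> x" using xg by auto
    ultimately show "(case (x, g) of (x, g) \<Rightarrow> (F (insert u x, g) * spin u (insert u x, g) + F (x, g) * spin u (x, g)) / 2) = 0"
      by (simp add: spin_def)
  qed (use assms in auto)
  have V: "insert u (V - {u}) = V" using assms by auto
  have "ev \<phi> V E (\<lambda>\<omega>. F \<omega> * spin u \<omega>) = ev \<phi> V ?E (\<lambda>\<omega>. F \<omega> * spin u \<omega>)"
  proof (rule ev_marginal_edges)
    fix x g assume xg: "x \<subseteq> V" "g \<subseteq> E"
    then have "{e \<in> g. u \<notin> e} = {e \<in> g \<inter> ?E. u \<notin> e}" by auto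
    moreover have "g \<inter> ?E \<subseteq> E" by auto
    ultimately have "F (x, g) = F (x, g \<inter> ?E)" using F[OF xg] F[OF xg(1), of "g \<inter> ?E"] by simp
    then show "F (x, g) * spin u (x, g) = F (x, g \<inter> ?E) * spin u (x, g \<inter> ?E)" by (simp add: spin_def)
  qed (use assms in auto)
  also have "\<dots> = ev \<phi> (V - {u}) ?E (\<lambda>_. 0)" using step unfolding V .
  also have "\<dots> = 0" by (simp add: ev_def)
  finally show ?thesis .
qed

end

section \<open>The cavity inequality\<close>

lemma pair_in_pairs: "u \<in> U \<Longrightarrow> w \<in> U \<Longrightarrow> u \<noteq> w \<Longrightarrow> {u, w} \<in> pairs U"
  by (auto simp: pairs_def)

lemma spin_bound: "\<bar>spin i \<omega>\<bar> \<le> 1" "spin i \<omega> * spin i \<omega> = 1" "(spin i \<omega>)\<^sup>2 = 1"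
  by (auto simp: spin_def)

text \<open>A weighted vertex set with all its pairs.\<close>

locale two_block_graph = two_block +
  fixes \<phi> :: "nat \<Rightarrow> real" and U :: "nat set"
  assumes finite_U: "finite U" and \<phi>_nonneg: "\<And>i. i \<in> U \<Longrightarrow> 0 \<le> \<phi> i"

sublocale two_block_graph \<subseteq> finite_weights "worlds U (pairs U)" "world_weight a b n \<phi> U (pairs U)"
  by (rule finite_weights_worlds) (use finite_U finite_pairs \<phi>_nonneg in \<open>auto simp: pairs_def\<close>)

context two_block_graph
begin

lemma wexp_ev: "wexp F = ev \<phi> U (pairs U) F"
  by (rule wexp_eq_ev) (use finite_U finite_pairs \<phi>_nonneg in \<open>auto simp: pairs_def\<close>)

lemma wexp_one: "wexp (\<lambda>_. 1) = 1"
  unfolding wexp_ev by (intro ev_one finite_U finite_pairs)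

definition pair_scale :: "nat \<Rightarrow> nat \<Rightarrow> real" where "pair_scale u w = \<phi> u * \<phi> w / real n"

lemma pair_scale_nonneg: "u \<in> U \<Longrightarrow> w \<in> U \<Longrightarrow> 0 \<le> pair_scale u w"
  using \<phi>_nonneg by (auto simp: pair_scale_def)

lemma eprob_linear:
  assumes uw: "u \<in> U" "w \<in> U" "u \<noteq> w" and t: "max a b * pair_scale u w \<le> 1 / 2"
  shows "eprob a b n \<phi> (fst \<omega>) {u, w} =
    (a + b) * pair_scale u w / 2 + (a - b) * pair_scale u w / 2 * (spin u \<omega> * spin w \<omega>)"
proof -
  have t0: "pair_scale u w \<ge> 0" using uw pair_scale_nonneg by auto
  have "a * pair_scale u w \<le> max a b * pair_scale u w" "b * pair_scale u w \<le> max a b * pair_scale u w"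
    using t0 by (auto intro: mult_right_mono)
  then have ab: "a * pair_scale u w \<le> 1" "b * pair_scale u w \<le> 1" using t by linarith+
  have pr: "(\<Prod>i\<in>{u, w}. \<phi> i) / real n = pair_scale u w" using uw by (simp add: pair_scale_def)
  have e: "eprob a b n \<phi> (fst \<omega>) {u, w} = min 1 ((if {u, w} \<subseteq> fst \<omega> \<or> {u, w} \<inter> fst \<omega> = {} then a else b) * pair_scale u w)"
    unfolding eprob_def times_divide_eq_right[symmetric] pr ..
  show ?thesis unfolding e using ab by (auto simp: spin_def algebra_simps add_divide_distrib diff_divide_distrib)
qed

text \<open>Given an observable that ignores the edge \<open>{u, w}\<close>, this edge is present with a probability that is
  affine in the product of the two signs.\<close>

lemma edge_bit_law:
  assumes uw: "u \<in> U" "w \<in> U" "u \<noteq> w" and t: "max a b * pair_scale u w \<le> 1 / 2"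
    and h: "determines Z h"
    and Z: "\<And>x g. x \<subseteq> U \<Longrightarrow> g \<subseteq> pairs U - {{u, w}} \<Longrightarrow> Z (x, insert {u, w} g) = Z (x, g)"
  shows "wexp (\<lambda>\<omega>. h \<omega> * of_bool ({u, w} \<in> snd \<omega>)) =
    wexp (\<lambda>\<omega>. h \<omega> * ((a + b) * pair_scale u w / 2 + (a - b) * pair_scale u w / 2 * (spin u \<omega> * spin w \<omega>)))"
proof -
  have e: "{u, w} \<in> pairs U" using uw by (rule pair_in_pairs)
  have "h (x, insert {u, w} g) = h (x, g)" if "x \<subseteq> U" "g \<subseteq> pairs U - {{u, w}}" for x g
    by (rule determinesD[OF h]) (use that e Z in \<open>auto simp: worlds_def\<close>)
  then have "wexp (\<lambda>\<omega>. h \<omega> * of_bool ({u, w} \<in> snd \<omega>)) = wexp (\<lambda>\<omega>. h \<omega> * eprob a b n \<phi> (fst \<omega>) {u, w})"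
    unfolding wexp_ev by (intro ev_edge_toggle finite_pairs finite_U e)
  then show ?thesis by (simp only: eprob_linear[OF uw t])
qed

lemma spin_flip:
  assumes "u \<in> U" and h: "determines Z h"
    and Z: "\<And>x g. x \<subseteq> U \<Longrightarrow> g \<subseteq> pairs U \<Longrightarrow> Z (x, g) = Z (x - {u}, {e \<in> g. u \<notin> e})"
  shows "wexp (\<lambda>\<omega>. h \<omega> * spin u \<omega>) = 0"
  unfolding wexp_ev
proof (rule ev_spin_flip)
  fix x g assume "x \<subseteq> U" "g \<subseteq> pairs U"
  then show "h (x, g) = h (x - {u}, {e \<in> g. u \<notin> e})"
    using Z by (intro determinesD[OF h]) (auto simp: worlds_def)
qed (use assms finite_U finite_pairs in auto)

lemma obs_mono: "V \<subseteq> V' \<Longrightarrow> T \<subseteq> T' \<Longrightarrow> determines (obs V' T') (obs V T)"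
proof (rule determinesI)
  fix \<omega> \<omega>' assume "V \<subseteq> V'" "T \<subseteq> T'" "obs V' T' \<omega> = obs V' T' \<omega>'"
  moreover have "obs V T \<omega> = (fst (obs V' T' \<omega>) \<inter> T, snd (obs V' T' \<omega>) \<inter> Pow V)" if "V \<subseteq> V'" "T \<subseteq> T'" for \<omega>
    using that by (auto simp: obs_def)
  ultimately show "obs V T \<omega> = obs V T \<omega>'" by simp
qed

lemma obs_determines_spin: "i \<in> T \<Longrightarrow> determines (obs V T) (spin i)"
  by (rule determinesI) (auto simp: obs_def spin_def)

text \<open>The edges from \<open>u\<close> to the vertices in \<open>D\<close> are observed on top of the graph on \<open>V\<close> and the spins on \<open>T\<close>.\<close>

definition partial_obs where
  "partial_obs V T u D \<omega> = (obs V T \<omega>, snd \<omega> \<inter> (\<lambda>w. {u, w}) ` D)"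

lemma obs_determines_partial:
  assumes "D \<subseteq> V"
  shows "determines (obs (insert u V) T) (partial_obs V T u D)"
proof (rule determinesI)
  fix \<omega> \<omega>' assume *: "obs (insert u V) T \<omega> = obs (insert u V) T \<omega>'"
  have "partial_obs V T u D \<omega> = ((fst (obs (insert u V) T \<omega>), snd (obs (insert u V) T \<omega>) \<inter> Pow V),
      snd (obs (insert u V) T \<omega>) \<inter> (\<lambda>w. {u, w}) ` D)" for \<omega>
    using assms by (auto simp: obs_def partial_obs_def)
  then show "partial_obs V T u D \<omega> = partial_obs V T u D \<omega>'" using * by simp
qed

lemma partial_determines_obs:
  assumes "u \<notin> V"
  shows "determines (partial_obs V T u V) (obs (insert u V) T)"
proof (rule determinesI)
  fix \<omega> \<omega>' assume w: "\<omega> \<in> worlds U (pairs U)" "\<omega>' \<in> worlds U (pairs U)"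
    and *: "partial_obs V T u V \<omega> = partial_obs V T u V \<omega>'"
  have "snd \<omega> \<inter> Pow (insert u V) = (snd \<omega> \<inter> Pow V) \<union> (snd \<omega> \<inter> (\<lambda>w. {u, w}) ` V)"
    if "\<omega> \<in> worlds U (pairs U)" for \<omega>
  proof (intro equalityI subsetI)
    fix e assume e: "e \<in> snd \<omega> \<inter> Pow (insert u V)"
    then have "card e = 2" using that by (auto simp: worlds_def pairs_def)
    then obtain i j where ij: "e = {i, j}" "i \<noteq> j" by (auto simp: card_2_iff)
    show "e \<in> (snd \<omega> \<inter> Pow V) \<union> (snd \<omega> \<inter> (\<lambda>w. {u, w}) ` V)"
    proof (cases "u \<in> e")
      case True
      then obtain w where "e = {u, w}" "w \<noteq> u" using ij by auto
      then show ?thesis using e by auto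
    next
      case False then show ?thesis using e by auto
    qed
  qed auto
  then have "obs (insert u V) T \<omega> = (fst (fst (partial_obs V T u V \<omega>)),
     snd (fst (partial_obs V T u V \<omega>)) \<union> snd (partial_obs V T u V \<omega>))"
    if "\<omega> \<in> worlds U (pairs U)" for \<omega> using that by (simp add: obs_def partial_obs_def)
  then show "obs (insert u V) T \<omega> = obs (insert u V) T \<omega>'" using w * by simp
qed

lemma partial_obs_insert:
  "determines (\<lambda>\<omega>. (partial_obs V T u D \<omega>, {u, w} \<in> snd \<omega>)) (partial_obs V T u (insert w D))"
  "determines (partial_obs V T u (insert w D)) (\<lambda>\<omega>. (partial_obs V T u D \<omega>, {u, w} \<in> snd \<omega>))"
   if "w \<notin> D" "u \<notin> insert w D"
proof -
  have 1: "partial_obs V T u (insert w D) \<omega> = (fst (partial_obs V T u D \<omega>),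
     snd (partial_obs V T u D \<omega>) \<union> (if {u, w} \<in> snd \<omega> then {{u, w}} else {}))" for \<omega>
    by (auto simp: partial_obs_def)
  show "determines (\<lambda>\<omega>. (partial_obs V T u D \<omega>, {u, w} \<in> snd \<omega>)) (partial_obs V T u (insert w D))"
    by (rule determinesI) (auto simp: 1)
  have 2: "(partial_obs V T u D \<omega>, {u, w} \<in> snd \<omega>) = ((fst (partial_obs V T u (insert w D) \<omega>),
      snd (partial_obs V T u (insert w D) \<omega>) - {{u, w}}), {u, w} \<in> snd (partial_obs V T u (insert w D) \<omega>))" for \<omega>
    using that by (auto simp: partial_obs_def doubleton_eq_iff)
  show "determines (partial_obs V T u (insert w D)) (\<lambda>\<omega>. (partial_obs V T u D \<omega>, {u, w} \<in> snd \<omega>))"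
    unfolding 2 by (rule determinesI) auto
qed

lemma obs_flip_invariant:
  assumes "u \<notin> V" "T \<subseteq> V"
  shows "obs V T (x, g) = obs V T (x - {u}, {e \<in> g. u \<notin> e})"
  using assms by (auto simp: obs_def)

end

context two_block_graph
begin

text \<open>The edges from \<open>u\<close> to \<open>D\<close> are revealed one at a time. The statement is conditional on what was known
  before these edges, which is expressed by the factor \<open>h\<close>. This makes the induction close: the gain
  \<open>y (1 - k\<^sub>0 f)\<close> from an edge is absorbed by applying the induction hypothesis to \<open>h (1 - y)\<close>.
  The quantity \<open>\<Delta> w\<close> is the growth of the information about \<open>w\<close> when \<open>u\<close> is added with its edges and its sign; it
  controls both the change of the conditional mean of \<open>w\<close> and its conditional covariance with \<open>u\<close>.\<close>

lemma sequential_gain: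
  fixes V T D :: "nat set" and u :: nat
  assumes u: "u \<in> U" "u \<notin> V" and V: "V \<subseteq> U" and T: "T \<subseteq> V" and D: "finite D" "D \<subseteq> V"
  defines "Z\<^sub>0 \<equiv> obs V T" and "k0 \<equiv> damping a b" and "\<kappa> \<equiv> signal a b"
  defines "B \<equiv> (\<lambda>w. cexp Z\<^sub>0 (spin w))"
  defines "\<Delta> \<equiv> (\<lambda>w. info (obs (insert u V) (insert u T)) (spin w) - info Z\<^sub>0 (spin w))"
  assumes h: "determines Z\<^sub>0 h" "\<And>\<omega>. \<omega> \<in> worlds U (pairs U) \<Longrightarrow> 0 \<le> h \<omega> \<and> h \<omega> \<le> 1"
  shows "k0 * wexp (\<lambda>\<omega>. h \<omega> * (cexp (partial_obs V T u D) (spin u) \<omega>)\<^sup>2)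
    \<le> wexp (\<lambda>\<omega>. h \<omega> * sat (\<Sum>w\<in>D. k0 * (\<kappa> * pair_scale u w * (B w \<omega>)\<^sup>2)))
       + err_const a b * (\<Sum>w\<in>D. (pair_scale u w)\<^sup>2 + pair_scale u w * sqrt (\<Delta> w))"
  using D h
proof (induction D arbitrary: h)
  case empty
  have eq: "determines (partial_obs V T u {}) Z\<^sub>0" "determines Z\<^sub>0 (partial_obs V T u {})"
    by (auto simp: partial_obs_def Z\<^sub>0_def intro!: determinesI)
  have "wexp (\<lambda>\<omega>. h \<omega> * (cexp (partial_obs V T u {}) (spin u) \<omega>)\<^sup>2) =
      wexp (\<lambda>\<omega>. h \<omega> * (cexp Z\<^sub>0 (spin u) \<omega>)\<^sup>2)"
    by (intro wexp_cong) (simp add: cexp_cong_observable[OF eq])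
  also have "\<dots> = wexp (\<lambda>\<omega>. h \<omega> * cexp Z\<^sub>0 (spin u) \<omega> * spin u \<omega>)"
    by (rule wexp_cexp_square[OF empty.prems(2)])
  also have "\<dots> = 0"
    by (rule spin_flip[OF u(1) determines_comp2[OF empty.prems(2) determines_cexp]])
      (unfold Z\<^sub>0_def, rule obs_flip_invariant, use u T in auto)
  finally show ?case by (simp add: sat_0 wexp_def)
next
  case (insert w D)
  let ?D = "insert w D"
  let ?Z = "partial_obs V T u D" and ?Z' = "partial_obs V T u (insert w D)"
  define t where "t = pair_scale u w"
  define R where "R = (\<Sum>w\<in>D. (pair_scale u w)\<^sup>2 + pair_scale u w * sqrt (\<Delta> w))"
  define Y where "Y = (\<lambda>\<omega>. \<Sum>w\<in>D. k0 * (\<kappa> * pair_scale u w * (B w \<omega>)\<^sup>2))"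
  define y where "y = (\<lambda>\<omega>. k0 * (\<kappa> * t * (B w \<omega>)\<^sup>2))"
  have w: "w \<in> V" "w \<in> U" "u \<noteq> w" "w \<notin> D" "u \<notin> insert w D" "D \<subseteq> V" using insert.prems insert.hyps u V by auto
  have k0: "0 < k0" "k0 \<le> 1/2" using damping_pos[OF a_pos b_pos] by (auto simp: k0_def)
  have \<kappa>: "0 \<le> \<kappa>" "\<kappa> \<le> max a b / 2" using signal_nonneg[OF a_pos b_pos] signal_le[OF a_pos b_pos] by (auto simp: \<kappa>_def)
  have M: "max a b > 0" using a_pos by auto
  have t0: "0 \<le> t" unfolding t_def using u w by (intro pair_scale_nonneg) auto
  have tD: "0 \<le> pair_scale u w'" if "w' \<in> D" for w' using that w u V by (intro pair_scale_nonneg) auto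
  have Bb: "\<bar>B w' \<omega>\<bar> \<le> 1" for w' \<omega> unfolding B_def by (rule cexp_bound) (rule spin_bound)
  have Z_Z0: "determines ?Z Z\<^sub>0" by (rule determinesI) (simp add: partial_obs_def Z\<^sub>0_def)
  have Zp: "determines (obs (insert u V) (insert u T)) ?Z" if "D \<subseteq> V"
    by (rule determines_trans[OF obs_mono obs_determines_partial[OF that]]) auto
  have F_Z0: "determines (obs (insert u V) (insert u T)) Z\<^sub>0" unfolding Z\<^sub>0_def by (rule obs_mono) auto
  have \<Delta>0: "0 \<le> \<Delta> w'" for w' unfolding \<Delta>_def using info_mono[OF F_Z0] by simp
  have sqrt0: "0 \<le> sqrt (\<Delta> w')" for w' using \<Delta>0 by simp
  have R0: "0 \<le> R" unfolding R_def by (intro sum_nonneg add_nonneg_nonneg mult_nonneg_nonneg tD sqrt0) auto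
  have Y0: "0 \<le> Y \<omega>" for \<omega> unfolding Y_def using k0 \<kappa> tD by (intro sum_nonneg mult_nonneg_nonneg) auto
  have y0: "0 \<le> y \<omega>" for \<omega> unfolding y_def using k0 \<kappa> t0 by (intro mult_nonneg_nonneg) auto
  have Yy: "(\<Sum>w\<in>?D. k0 * (\<kappa> * pair_scale u w * (B w \<omega>)\<^sup>2)) = Y \<omega> + y \<omega>" for \<omega>
    using insert.hyps by (simp add: Y_def y_def t_def)
  have Rw: "(\<Sum>w\<in>?D. (pair_scale u w)\<^sup>2 + pair_scale u w * sqrt (\<Delta> w)) = R + t\<^sup>2 + t * sqrt (\<Delta> w)"
    using insert.hyps by (simp add: R_def t_def)
  have errc: "0 \<le> err_const a b" by (rule err_const_nonneg[OF a_pos b_pos])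
  let ?h = h
  have h01: "0 \<le> h \<omega>" "h \<omega> \<le> 1" if "\<omega> \<in> worlds U (pairs U)" for \<omega> using insert.prems(3)[OF that] by auto
  have h_Z: "determines ?Z h" using determines_trans[OF Z_Z0 insert.prems(2)] .
  have wexp_h_le: "wexp (\<lambda>\<omega>. h \<omega> * f \<omega>) \<le> wexp f" if "\<And>\<omega>. 0 \<le> f \<omega>" for f
    by (intro wexp_mono) (use h01 that in \<open>auto intro: mult_left_le_one_le\<close>)
  show ?case unfolding Yy Rw
  proof (cases "max a b * t \<le> 1/2")
    case False
    \<comment> \<open>for heavy pairs the trivial bound is smaller than the error term\<close>
    have "k0 * wexp (\<lambda>\<omega>. h \<omega> * (cexp ?Z' (spin u) \<omega>)\<^sup>2) \<le> k0 * wexp (\<lambda>_. 1)"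
    proof (intro mult_left_mono wexp_mono)
      fix \<omega> assume "\<omega> \<in> worlds U (pairs U)"
      moreover have "(cexp ?Z' (spin u) \<omega>)\<^sup>2 \<le> 1"
        unfolding abs_square_le_1 by (rule cexp_bound) (rule spin_bound)
      ultimately show "h \<omega> * (cexp ?Z' (spin u) \<omega>)\<^sup>2 \<le> 1" using h01 by (simp add: mult_le_one)
    qed (use k0 in auto)
    also have "\<dots> \<le> 10 * (max a b)\<^sup>2 * t\<^sup>2"
    proof -
      have "(1/2)\<^sup>2 \<le> (max a b * t)\<^sup>2" using False by (intro power_mono) auto
      then have "1/4 \<le> (max a b * t)\<^sup>2" by (simp add: power_divide)
      then have "k0 \<le> 10 * (max a b * t)\<^sup>2" using k0 by linarith
      then show ?thesis unfolding wexp_one by (simp add: power_mult_distrib)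
    qed
    also have "\<dots> \<le> err_const a b * t\<^sup>2" by (intro mult_right_mono err_const_bounds[OF a_pos b_pos]) auto
    also have "\<dots> \<le> 0 + err_const a b * (R + t\<^sup>2 + t * sqrt (\<Delta> w))"
      unfolding add_0 using errc R0 t0 sqrt0 by (intro mult_left_mono) auto
    also have "\<dots> \<le> wexp (\<lambda>\<omega>. h \<omega> * sat (Y \<omega> + y \<omega>)) + err_const a b * (R + t\<^sup>2 + t * sqrt (\<Delta> w))"
      using Y0 y0 h01 by (intro add_right_mono wexp_nonneg mult_nonneg_nonneg sat_nonneg add_nonneg_nonneg)
    finally show "k0 * wexp (\<lambda>\<omega>. h \<omega> * (cexp ?Z' (spin u) \<omega>)\<^sup>2)
      \<le> wexp (\<lambda>\<omega>. h \<omega> * sat (Y \<omega> + y \<omega>)) + err_const a b * (R + t\<^sup>2 + t * sqrt (\<Delta> w))" .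
  next
    case True
    define \<alpha> where "\<alpha> = cexp ?Z (spin u)"
    define \<beta> where "\<beta> = cexp ?Z (\<lambda>\<omega>. spin u \<omega> * spin w \<omega>)"
    define m where "m = cexp ?Z (spin w)"
    define p where "p = (a + b) * t / 2"
    define d where "d = (a - b) * t / 2"
    define C1 where "C1 = 8 * \<kappa> / (1 - \<bar>edge_corr a b\<bar>)\<^sup>2"
    define e where "e = (\<lambda>\<omega>. \<bar>m \<omega> - B w \<omega>\<bar> + \<bar>\<beta> \<omega> - \<alpha> \<omega> * m \<omega>\<bar>)"
    have C1: "0 \<le> C1" "C1 + 10 * (max a b)\<^sup>2 = err_const a b"
      using \<kappa> by (auto simp: C1_def err_const_def \<kappa>_def)
    have ab1: "\<bar>\<alpha> \<omega>\<bar> \<le> 1" "\<bar>m \<omega>\<bar> \<le> 1" "\<bar>\<beta> \<omega>\<bar> \<le> 1" for \<omega>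
      unfolding \<alpha>_def m_def \<beta>_def by (rule cexp_bound, simp add: spin_def)+
    have gam: "cexp ?Z (\<lambda>\<omega>. spin u \<omega> * (spin u \<omega> * spin w \<omega>)) = m"
      unfolding m_def mult.assoc[symmetric] spin_bound(2) by simp
    have bit: "wexp (\<lambda>\<omega>. k \<omega> * of_bool ({u, w} \<in> snd \<omega>)) = wexp (\<lambda>\<omega>. k \<omega> * (p + d * (spin u \<omega> * spin w \<omega>)))"
      if "determines (\<lambda>\<omega>. (?Z \<omega>, spin u \<omega>, spin u \<omega> * spin w \<omega>)) k" for k
      unfolding p_def d_def t_def
    proof (rule edge_bit_law[OF u(1) w(2,3) _ that])
      show "max a b * pair_scale u w \<le> 1 / 2" using True by (simp add: t_def)
      fix x g
      have "insert {u, w} g \<inter> Pow V = g \<inter> Pow V" using u(2) by auto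
      moreover have "insert {u, w} g \<inter> (\<lambda>w. {u, w}) ` D = g \<inter> (\<lambda>w. {u, w}) ` D"
        using w by (auto simp: doubleton_eq_iff)
      ultimately show "(?Z (x, insert {u, w} g), spin u (x, insert {u, w} g), spin u (x, insert {u, w} g) * spin w (x, insert {u, w} g))
         = (?Z (x, g), spin u (x, g), spin u (x, g) * spin w (x, g))"
        by (simp add: partial_obs_def obs_def spin_def)
    qed
    have pi: "determines (\<lambda>\<omega>. (?Z \<omega>, {u, w} \<in> snd \<omega>)) ?Z'" "determines ?Z' (\<lambda>\<omega>. (?Z \<omega>, {u, w} \<in> snd \<omega>))"
      by (rule partial_obs_insert[OF w(4,5)])+
    have "wexp (\<lambda>\<omega>. h \<omega> * (cexp ?Z' (spin u) \<omega>)\<^sup>2) =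
        wexp (\<lambda>\<omega>. h \<omega> * (cexp (\<lambda>\<omega>. (?Z \<omega>, {u, w} \<in> snd \<omega>)) (spin u) \<omega>)\<^sup>2)"
      by (intro wexp_cong) (simp add: cexp_cong_observable[OF pi])
    also have "\<dots> = wexp (\<lambda>\<omega>. h \<omega> * ((p * \<alpha> \<omega> + d * m \<omega>)\<^sup>2 / (p + d * \<beta> \<omega>) +
                  ((1 - p) * \<alpha> \<omega> - d * m \<omega>)\<^sup>2 / (1 - p - d * \<beta> \<omega>)))"
      using wexp_cexp_square_bit[of ?Z "spin u" "\<lambda>\<omega>. spin u \<omega> * spin w \<omega>" "\<lambda>\<omega>. {u, w} \<in> snd \<omega>" p d h, OF bit h_Z]
      unfolding gam \<alpha>_def[symmetric] \<beta>_def[symmetric] by simp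
    also have "\<dots> \<le> wexp (\<lambda>\<omega>. h \<omega> * ((\<alpha> \<omega>)\<^sup>2 + \<kappa> * t * ((B w \<omega>)\<^sup>2 - edge_corr a b * (B w \<omega>) ^ 3 * \<alpha> \<omega>
           - k0 * (B w \<omega>)\<^sup>2 * (\<alpha> \<omega>)\<^sup>2) + C1 * t * e \<omega> + 8 * (max a b)\<^sup>2 * t\<^sup>2))"
      unfolding p_def d_def e_def C1_def \<kappa>_def k0_def
      by (intro wexp_mono mult_left_mono edge_gain a_pos b_pos ab1 Bb t0 True h01)
    also have "\<dots> = wexp (\<lambda>\<omega>. h \<omega> * (\<alpha> \<omega>)\<^sup>2 + h \<omega> * (\<kappa> * t * (B w \<omega>)\<^sup>2) - h \<omega> * (k0 * (\<kappa> * t * (B w \<omega>)\<^sup>2)) * (\<alpha> \<omega>)\<^sup>2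
         - \<kappa> * t * edge_corr a b * (h \<omega> * (B w \<omega>) ^ 3 * \<alpha> \<omega>) + C1 * t * (h \<omega> * e \<omega>) + 8 * (max a b)\<^sup>2 * t\<^sup>2 * (h \<omega> * 1))"
      by (intro wexp_cong) (simp add: algebra_simps)
    also have "\<dots> = wexp (\<lambda>\<omega>. h \<omega> * (\<alpha> \<omega>)\<^sup>2) + wexp (\<lambda>\<omega>. h \<omega> * (\<kappa> * t * (B w \<omega>)\<^sup>2)) - wexp (\<lambda>\<omega>. h \<omega> * y \<omega> * (\<alpha> \<omega>)\<^sup>2)
         - \<kappa> * t * edge_corr a b * wexp (\<lambda>\<omega>. h \<omega> * (B w \<omega>) ^ 3 * \<alpha> \<omega>) + C1 * t * wexp (\<lambda>\<omega>. h \<omega> * e \<omega>)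
         + 8 * (max a b)\<^sup>2 * t\<^sup>2 * wexp (\<lambda>\<omega>. h \<omega> * 1)"
      unfolding y_def wexp_add wexp_diff wexp_cmult by (rule refl)
    \<comment> \<open>the term of odd order vanishes: \<open>h\<close> and \<open>B w\<close> were known before the edges of \<open>u\<close>\<close>
    also have "wexp (\<lambda>\<omega>. h \<omega> * (B w \<omega>) ^ 3 * \<alpha> \<omega>) = 0"
    proof -
      have dB: "determines Z\<^sub>0 (\<lambda>\<omega>. h \<omega> * (B w \<omega>) ^ 3)"
        unfolding B_def by (intro determines_comp2[where f="(*)"] insert.prems(2) determines_comp[where f="\<lambda>x. x ^ 3"] determines_cexp)
      have "wexp (\<lambda>\<omega>. h \<omega> * (B w \<omega>) ^ 3 * \<alpha> \<omega>) = wexp (\<lambda>\<omega>. h \<omega> * (B w \<omega>) ^ 3 * spin u \<omega>)"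
        unfolding \<alpha>_def by (rule tower[OF determines_trans[OF Z_Z0 dB]])
      also have "\<dots> = 0"
        by (rule spin_flip[OF u(1) dB]) (unfold Z\<^sub>0_def, rule obs_flip_invariant, use u T in auto)
      finally show ?thesis .
    qed
    finally have g1: "wexp (\<lambda>\<omega>. h \<omega> * (cexp ?Z' (spin u) \<omega>)\<^sup>2) \<le>
        wexp (\<lambda>\<omega>. h \<omega> * (\<alpha> \<omega>)\<^sup>2) + wexp (\<lambda>\<omega>. h \<omega> * (\<kappa> * t * (B w \<omega>)\<^sup>2)) - wexp (\<lambda>\<omega>. h \<omega> * y \<omega> * (\<alpha> \<omega>)\<^sup>2)
         + C1 * t * wexp (\<lambda>\<omega>. h \<omega> * e \<omega>) + 8 * (max a b)\<^sup>2 * t\<^sup>2 * wexp (\<lambda>\<omega>. h \<omega> * 1)" by simp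
    have e_le: "wexp (\<lambda>\<omega>. h \<omega> * e \<omega>) \<le> 2 * sqrt (\<Delta> w)"
    proof -
      have "wexp (\<lambda>\<omega>. h \<omega> * e \<omega>) \<le> wexp e" by (rule wexp_h_le) (simp add: e_def)
      also have "\<dots> = wexp (\<lambda>\<omega>. \<bar>m \<omega> - B w \<omega>\<bar>) + wexp (\<lambda>\<omega>. \<bar>\<beta> \<omega> - \<alpha> \<omega> * m \<omega>\<bar>)"
        unfolding e_def by (rule wexp_add)
      also have "wexp (\<lambda>\<omega>. \<bar>m \<omega> - B w \<omega>\<bar>) \<le> sqrt (info ?Z (spin w) - info Z\<^sub>0 (spin w))"
        unfolding m_def B_def by (rule wexp_cexp_diff_le[OF wexp_one Z_Z0])
      also have "\<dots> \<le> sqrt (\<Delta> w)"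
        unfolding \<Delta>_def using info_mono[OF Zp[OF w(6)], of "spin w"] by simp
      also have "wexp (\<lambda>\<omega>. \<bar>\<beta> \<omega> - \<alpha> \<omega> * m \<omega>\<bar>) \<le> sqrt (info (obs (insert u V) (insert u T)) (spin w) - info ?Z (spin w))"
        unfolding \<beta>_def \<alpha>_def m_def
        by (rule wexp_ccov_le[OF wexp_one _ Zp[OF w(6)] obs_determines_spin]) (auto simp: spin_bound)
      also have "\<dots> \<le> sqrt (\<Delta> w)"
        unfolding \<Delta>_def using info_mono[OF Z_Z0, of "spin w"] by simp
      finally show ?thesis by simp
    qed
    have h1: "wexp (\<lambda>\<omega>. h \<omega> * 1) \<le> 1" using wexp_h_le[of "\<lambda>_. 1"] wexp_one by simp
    have y_le: "y \<omega> \<le> 1" "(y \<omega>)\<^sup>2 / 2 \<le> (max a b)\<^sup>2 * t\<^sup>2" for \<omega>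
    proof -
      have "\<kappa> * t * (B w \<omega>)\<^sup>2 \<le> \<kappa> * t * 1"
        using Bb[of w \<omega>] \<kappa> t0 by (intro mult_left_mono) (auto simp: abs_square_le_1)
      also have "\<dots> \<le> max a b * t" using \<kappa> t0 M unfolding mult_1_right by (intro mult_right_mono) linarith+
      finally have *: "\<kappa> * t * (B w \<omega>)\<^sup>2 \<le> max a b * t" .
      have "y \<omega> \<le> 1 * (\<kappa> * t * (B w \<omega>)\<^sup>2)" unfolding y_def using k0 \<kappa> t0 by (intro mult_right_mono mult_nonneg_nonneg) auto
      with * have **: "y \<omega> \<le> max a b * t" by simp
      then show "y \<omega> \<le> 1" using True by simp
      have "(y \<omega>)\<^sup>2 \<le> (max a b * t)\<^sup>2" using ** y0 by (intro power_mono) auto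
      then show "(y \<omega>)\<^sup>2 / 2 \<le> (max a b)\<^sup>2 * t\<^sup>2" by (simp add: power_mult_distrib) (smt (verit) zero_le_power2 mult_nonneg_nonneg)
    qed
    define h' where "h' = (\<lambda>\<omega>. h \<omega> * (1 - y \<omega>))"
    have dy: "determines Z\<^sub>0 y" unfolding y_def B_def
      by (rule determines_comp[where f="\<lambda>x. k0 * (\<kappa> * t * x\<^sup>2)"]) (rule determines_cexp)
    have h': "determines Z\<^sub>0 h'" "\<And>\<omega>. \<omega> \<in> worlds U (pairs U) \<Longrightarrow> 0 \<le> h' \<omega> \<and> h' \<omega> \<le> 1"
    proof -
      show "determines Z\<^sub>0 h'" unfolding h'_def
        by (rule determines_comp2[where f="\<lambda>x y. x * (1 - y)"]) (rule insert.prems(2), rule dy)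
      fix \<omega> assume om: "\<omega> \<in> worlds U (pairs U)"
      show "0 \<le> h' \<omega> \<and> h' \<omega> \<le> 1" unfolding h'_def
        using h01[OF om] y0[of \<omega>] y_le(1)[of \<omega>] by (auto intro: mult_le_one)
    qed
    have IH: "k0 * wexp (\<lambda>\<omega>. h' \<omega> * (\<alpha> \<omega>)\<^sup>2) \<le> wexp (\<lambda>\<omega>. h' \<omega> * sat (Y \<omega>)) + err_const a b * R"
      using insert.IH[OF w(6) h'] unfolding \<alpha>_def Y_def R_def .
    have split_h': "wexp (\<lambda>\<omega>. h \<omega> * (\<alpha> \<omega>)\<^sup>2) - wexp (\<lambda>\<omega>. h \<omega> * y \<omega> * (\<alpha> \<omega>)\<^sup>2) = wexp (\<lambda>\<omega>. h' \<omega> * (\<alpha> \<omega>)\<^sup>2)"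
      unfolding wexp_diff[symmetric] h'_def by (intro wexp_cong) (simp add: algebra_simps)
    have sat_part: "wexp (\<lambda>\<omega>. h' \<omega> * sat (Y \<omega>)) + wexp (\<lambda>\<omega>. h \<omega> * y \<omega>)
       \<le> wexp (\<lambda>\<omega>. h \<omega> * sat (Y \<omega> + y \<omega>)) + (max a b)\<^sup>2 * t\<^sup>2"
    proof -
      have "wexp (\<lambda>\<omega>. h' \<omega> * sat (Y \<omega>)) + wexp (\<lambda>\<omega>. h \<omega> * y \<omega>) = wexp (\<lambda>\<omega>. h \<omega> * ((1 - y \<omega>) * sat (Y \<omega>) + y \<omega>))"
        unfolding wexp_add[symmetric] h'_def by (intro wexp_cong) (simp add: algebra_simps)
      also have "\<dots> \<le> wexp (\<lambda>\<omega>. h \<omega> * (sat (Y \<omega> + y \<omega>) + (max a b)\<^sup>2 * t\<^sup>2))"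
      proof (intro wexp_mono mult_left_mono h01)
        fix \<omega>
        show "(1 - y \<omega>) * sat (Y \<omega>) + y \<omega> \<le> sat (Y \<omega> + y \<omega>) + (max a b)\<^sup>2 * t\<^sup>2"
          using sat_step[OF Y0[of \<omega>] y0[of \<omega>] y_le(1)[of \<omega>]] y_le(2)[of \<omega>] by linarith
      qed
      also have "\<dots> = wexp (\<lambda>\<omega>. h \<omega> * sat (Y \<omega> + y \<omega>)) + (max a b)\<^sup>2 * t\<^sup>2 * wexp (\<lambda>\<omega>. h \<omega> * 1)"
        unfolding wexp_add[symmetric] wexp_cmult[symmetric] by (intro wexp_cong) (simp add: algebra_simps)
      also have "\<dots> \<le> wexp (\<lambda>\<omega>. h \<omega> * sat (Y \<omega> + y \<omega>)) + (max a b)\<^sup>2 * t\<^sup>2 * 1"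
        using h1 by (intro add_left_mono mult_left_mono) auto
      finally show ?thesis by simp
    qed
    have ky: "k0 * wexp (\<lambda>\<omega>. h \<omega> * (\<kappa> * t * (B w \<omega>)\<^sup>2)) = wexp (\<lambda>\<omega>. h \<omega> * y \<omega>)"
      unfolding wexp_cmult[symmetric] y_def by (intro wexp_cong) (simp add: algebra_simps)
    have rest: "k0 * (C1 * t * wexp (\<lambda>\<omega>. h \<omega> * e \<omega>) + 8 * (max a b)\<^sup>2 * t\<^sup>2 * wexp (\<lambda>\<omega>. h \<omega> * 1))
        \<le> C1 * (t * sqrt (\<Delta> w)) + 4 * (max a b)\<^sup>2 * t\<^sup>2"
    proof -
      have "C1 * t * wexp (\<lambda>\<omega>. h \<omega> * e \<omega>) \<le> C1 * t * (2 * sqrt (\<Delta> w))"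
        using C1 t0 by (intro mult_left_mono e_le) auto
      moreover have "8 * (max a b)\<^sup>2 * t\<^sup>2 * wexp (\<lambda>\<omega>. h \<omega> * 1) \<le> 8 * (max a b)\<^sup>2 * t\<^sup>2 * 1"
        using h1 by (intro mult_left_mono) auto
      ultimately have "k0 * (C1 * t * wexp (\<lambda>\<omega>. h \<omega> * e \<omega>) + 8 * (max a b)\<^sup>2 * t\<^sup>2 * wexp (\<lambda>\<omega>. h \<omega> * 1))
         \<le> k0 * (C1 * t * (2 * sqrt (\<Delta> w)) + 8 * (max a b)\<^sup>2 * t\<^sup>2 * 1)"
        using k0 by (intro mult_left_mono[OF add_mono]) auto
      also have "\<dots> \<le> 1/2 * (C1 * t * (2 * sqrt (\<Delta> w)) + 8 * (max a b)\<^sup>2 * t\<^sup>2 * 1)"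
        using k0 C1 t0 sqrt0 by (intro mult_right_mono add_nonneg_nonneg mult_nonneg_nonneg) auto
      finally show ?thesis by simp
    qed
    have "k0 * wexp (\<lambda>\<omega>. h \<omega> * (cexp ?Z' (spin u) \<omega>)\<^sup>2) \<le>
      k0 * (wexp (\<lambda>\<omega>. h' \<omega> * (\<alpha> \<omega>)\<^sup>2) + wexp (\<lambda>\<omega>. h \<omega> * (\<kappa> * t * (B w \<omega>)\<^sup>2))
         + (C1 * t * wexp (\<lambda>\<omega>. h \<omega> * e \<omega>) + 8 * (max a b)\<^sup>2 * t\<^sup>2 * wexp (\<lambda>\<omega>. h \<omega> * 1)))"
      using g1 split_h' k0 by (intro mult_left_mono) auto
    also have "\<dots> = k0 * wexp (\<lambda>\<omega>. h' \<omega> * (\<alpha> \<omega>)\<^sup>2) + wexp (\<lambda>\<omega>. h \<omega> * y \<omega>)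
         + k0 * (C1 * t * wexp (\<lambda>\<omega>. h \<omega> * e \<omega>) + 8 * (max a b)\<^sup>2 * t\<^sup>2 * wexp (\<lambda>\<omega>. h \<omega> * 1))"
      unfolding distrib_left[of k0] ky by (rule refl)
    also have "\<dots> \<le> wexp (\<lambda>\<omega>. h \<omega> * sat (Y \<omega> + y \<omega>)) + (max a b)\<^sup>2 * t\<^sup>2 + err_const a b * R
         + (C1 * (t * sqrt (\<Delta> w)) + 4 * (max a b)\<^sup>2 * t\<^sup>2)"
      using IH sat_part rest by linarith
    also have "\<dots> \<le> wexp (\<lambda>\<omega>. h \<omega> * sat (Y \<omega> + y \<omega>)) + err_const a b * (R + t\<^sup>2 + t * sqrt (\<Delta> w))"
    proof -
      have "C1 * (t * sqrt (\<Delta> w)) \<le> err_const a b * (t * sqrt (\<Delta> w))"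
      proof (intro mult_right_mono mult_nonneg_nonneg)
        show "C1 \<le> err_const a b" unfolding C1(2)[symmetric] by simp
      qed (use t0 sqrt0 in auto)
      moreover have "(max a b)\<^sup>2 * t\<^sup>2 + 4 * (max a b)\<^sup>2 * t\<^sup>2 \<le> err_const a b * t\<^sup>2"
      proof -
        have "5 * (max a b)\<^sup>2 \<le> 10 * (max a b)\<^sup>2" by simp
        also have "\<dots> \<le> err_const a b" by (rule err_const_bounds[OF a_pos b_pos])
        finally have "5 * (max a b)\<^sup>2 * t\<^sup>2 \<le> err_const a b * t\<^sup>2" by (intro mult_right_mono) auto
        then show ?thesis by (simp add: algebra_simps)
      qed
      ultimately show ?thesis unfolding distrib_left[of "err_const a b"] by linarith
    qed
    finally show "k0 * wexp (\<lambda>\<omega>. h \<omega> * (cexp ?Z' (spin u) \<omega>)\<^sup>2)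
      \<le> wexp (\<lambda>\<omega>. h \<omega> * sat (Y \<omega> + y \<omega>)) + err_const a b * (R + t\<^sup>2 + t * sqrt (\<Delta> w))" .
  qed
qed

text \<open>The cavity inequality: what the graph reveals about a new vertex \<open>u\<close> in terms of what it
  reveals about the old vertices. The parameter \<open>y0\<close> is the point at which \<open>sat\<close> is linearised.\<close>

lemma cavity_inequality:
  fixes V T :: "nat set" and u :: nat and y0 :: real
  assumes u: "u \<in> U" "u \<notin> V" and V: "V \<subseteq> U" and T: "T \<subseteq> V" and y0: "0 \<le> y0"
  defines "Z\<^sub>0 \<equiv> obs V T"
  defines "\<Delta> \<equiv> (\<lambda>w. info (obs (insert u V) (insert u T)) (spin w) - info Z\<^sub>0 (spin w))"
  shows "damping a b * info (obs (insert u V) T) (spin u)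
    \<le> sat y0 + (damping a b * signal a b * (\<Sum>w\<in>V. pair_scale u w * info Z\<^sub>0 (spin w)) - y0) / (1 + y0 / 2)\<^sup>2
       + err_const a b * (\<Sum>w\<in>V. (pair_scale u w)\<^sup>2 + pair_scale u w * sqrt (\<Delta> w))"
proof -
  let ?B = "\<lambda>w. cexp Z\<^sub>0 (spin w)"
  let ?Y = "\<lambda>\<omega>. \<Sum>w\<in>V. damping a b * (signal a b * pair_scale u w * (?B w \<omega>)\<^sup>2)"
  have finV: "finite V" using V finite_U finite_subset by blast
  have eq: "determines (obs (insert u V) T) (partial_obs V T u V)" "determines (partial_obs V T u V) (obs (insert u V) T)"
    by (rule obs_determines_partial[OF order_refl], rule partial_determines_obs[OF u(2)])
  have "damping a b * info (obs (insert u V) T) (spin u) = damping a b * wexp (\<lambda>\<omega>. 1 * (cexp (partial_obs V T u V) (spin u) \<omega>)\<^sup>2)"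
    unfolding info_cong_observable[OF eq] by (simp add: info_def)
  also have "\<dots> \<le> wexp (\<lambda>\<omega>. 1 * sat (?Y \<omega>)) + err_const a b * (\<Sum>w\<in>V. (pair_scale u w)\<^sup>2 + pair_scale u w * sqrt (\<Delta> w))"
    unfolding Z\<^sub>0_def \<Delta>_def by (rule sequential_gain[OF u V T finV order_refl]) (auto intro: determines_const)
  also have "wexp (\<lambda>\<omega>. 1 * sat (?Y \<omega>)) \<le> wexp (\<lambda>\<omega>. sat y0 + (?Y \<omega> - y0) / (1 + y0/2)\<^sup>2)"
  proof (rule wexp_mono)
    fix \<omega>
    have "0 \<le> ?Y \<omega>" using damping_pos(1)[OF a_pos b_pos] signal_nonneg[OF a_pos b_pos] u V
      by (intro sum_nonneg mult_nonneg_nonneg pair_scale_nonneg) auto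
    then show "1 * sat (?Y \<omega>) \<le> sat y0 + (?Y \<omega> - y0) / (1 + y0/2)\<^sup>2"
      using sat_tangent[OF _ y0] by simp
  qed
  also have "\<dots> = wexp (\<lambda>\<omega>. (\<Sum>w\<in>V. damping a b * (signal a b * pair_scale u w) / (1 + y0/2)\<^sup>2 * (?B w \<omega>)\<^sup>2)
      + (sat y0 - y0 / (1 + y0/2)\<^sup>2) * 1)"
    by (intro wexp_cong) (simp add: diff_divide_distrib sum_divide_distrib mult.assoc)
  also have "\<dots> = (\<Sum>w\<in>V. damping a b * (signal a b * pair_scale u w) / (1 + y0/2)\<^sup>2 * info Z\<^sub>0 (spin w))
      + (sat y0 - y0 / (1 + y0/2)\<^sup>2)"
    unfolding wexp_add wexp_sum wexp_cmult info_def wexp_one by simp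
  also have "\<dots> = sat y0 + (damping a b * signal a b * (\<Sum>w\<in>V. pair_scale u w * info Z\<^sub>0 (spin w)) - y0) / (1 + y0 / 2)\<^sup>2"
    by (simp add: diff_divide_distrib sum_divide_distrib sum_distrib_left mult.assoc)
  finally show ?thesis by simp
qed

end

section \<open>Information as a function of the weights\<close>

lemma (in finite_weights) info_fibres:
  assumes "finite K" "Z ` \<Omega> \<subseteq> K"
  shows "info Z F = (\<Sum>z\<in>K. (wexp (\<lambda>\<omega>. of_bool (Z \<omega> = z) * F \<omega>))\<^sup>2 / wexp (\<lambda>\<omega>. of_bool (Z \<omega> = z)))"
proof -
  define S where "S H z = wexp (\<lambda>\<omega>. of_bool (Z \<omega> = z) * H \<omega>)" for H z
  have fib: "(\<Sum>\<omega>\<in>{\<omega>\<in>\<Omega>. Z \<omega> = z}. w \<omega> * H \<omega>) = S H z" for H z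
    unfolding S_def wexp_def using finite_space by (intro sum.mono_neutral_cong_left) auto
  have S1: "S (\<lambda>_. 1) z = wexp (\<lambda>\<omega>. of_bool (Z \<omega> = z))" for z by (simp add: S_def)
  have c: "cexp Z F \<omega> = S F (Z \<omega>) / S (\<lambda>_. 1) (Z \<omega>)" for \<omega>
    unfolding cexp_def fib using fib[of "\<lambda>_. 1" "Z \<omega>"] by simp
  have "info Z F = wexp (\<lambda>\<omega>. (S F (Z \<omega>) / S (\<lambda>_. 1) (Z \<omega>))\<^sup>2)" unfolding info_def c ..
  also have "\<dots> = wexp (\<lambda>\<omega>. \<Sum>z\<in>K. (S F z / S (\<lambda>_. 1) z)\<^sup>2 * of_bool (Z \<omega> = z))"
  proof (rule wexp_cong)
    fix \<omega> assume "\<omega> \<in> \<Omega>"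
    then have "Z \<omega> \<in> K" using assms by auto
    then show "(S F (Z \<omega>) / S (\<lambda>_. 1) (Z \<omega>))\<^sup>2 = (\<Sum>z\<in>K. (S F z / S (\<lambda>_. 1) z)\<^sup>2 * of_bool (Z \<omega> = z))"
      using assms(1) by (simp add: of_bool_def if_distrib cong: if_cong)
  qed
  also have "\<dots> = (\<Sum>z\<in>K. (S F z / S (\<lambda>_. 1) z)\<^sup>2 * S (\<lambda>_. 1) z)"
    unfolding wexp_sum wexp_cmult S1 ..
  also have "\<dots> = (\<Sum>z\<in>K. (S F z)\<^sup>2 / S (\<lambda>_. 1) z)"
    by (intro sum.cong refl) (simp add: power2_eq_square)
  finally show ?thesis by (simp add: S_def)
qed

lemma pairs_mono: "V \<subseteq> U \<Longrightarrow> pairs V \<subseteq> pairs U"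
  by (auto simp: pairs_def)

lemma Union_pairs_subset: "\<Union> (pairs V) \<subseteq> V"
  by (auto simp: pairs_def)

lemma pairs_image: "inj \<pi> \<Longrightarrow> pairs (\<pi> ` V) = (`) \<pi> ` pairs V"
proof (intro equalityI subsetI)
  fix e assume inj: "inj \<pi>" and "e \<in> pairs (\<pi> ` V)"
  then have e: "e \<subseteq> \<pi> ` V" "card e = 2" by (auto simp: pairs_def)
  then obtain d where d: "d \<subseteq> V" "e = \<pi> ` d" by (meson subset_image_iff)
  then have "card d = 2" using e inj card_image[of \<pi> d] inj_on_subset by fastforce
  then show "e \<in> (`) \<pi> ` pairs V" using d by (auto simp: pairs_def)
next
  fix e assume "inj \<pi>" "e \<in> (`) \<pi> ` pairs V"
  then show "e \<in> pairs (\<pi> ` V)" by (auto simp: pairs_def card_image inj_on_subset)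
qed

lemma image_Pow_eq: "Pow (f ` A) = (`) f ` Pow A"
  by (metis image_Pow_surj)

text \<open>Relabelling of the vertices of an outcome, or of an observation, along \<open>\<pi>\<close>.\<close>

definition relabel :: "(nat \<Rightarrow> nat) \<Rightarrow> nat set \<times> nat set set \<Rightarrow> nat set \<times> nat set set" where
  "relabel \<pi> \<omega> = (\<pi> ` fst \<omega>, (`) \<pi> ` snd \<omega>)"

context two_block
begin

text \<open>The information about the spin of \<open>w\<close> in the graph on \<open>V\<close> and the spins on \<open>T\<close>, as an
  explicit function of the weights.\<close>

definition vinfo :: "(nat \<Rightarrow> real) \<Rightarrow> nat set \<Rightarrow> nat set \<Rightarrow> nat \<Rightarrow> real" where
  "vinfo \<phi> V T w = (\<Sum>z\<in>Pow T \<times> Pow (pairs V).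
     (ev \<phi> V (pairs V) (\<lambda>\<omega>. of_bool (obs V T \<omega> = z) * spin w \<omega>))\<^sup>2 /
      ev \<phi> V (pairs V) (\<lambda>\<omega>. of_bool (obs V T \<omega> = z)))"

lemma eprob_cong: "(\<And>i. i \<in> e \<Longrightarrow> \<phi> i = \<phi>' i) \<Longrightarrow> eprob a b n \<phi> x e = eprob a b n \<phi>' x e"
  unfolding eprob_def by (simp cong: prod.cong)

lemma ev_weight_cong:
  assumes "\<And>i. i \<in> \<Union>E \<Longrightarrow> \<phi> i = \<phi>' i"
  shows "ev \<phi> V E F = ev \<phi>' V E F"
proof -
  have "eprob a b n \<phi> x e = eprob a b n \<phi>' x e" if "e \<in> E" for x e
    using assms that by (intro eprob_cong) auto
  then have "world_weight a b n \<phi> V E (x, g) = world_weight a b n \<phi>' V E (x, g)" for x g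
    unfolding world_weight_pair by (intro arg_cong[where f="\<lambda>y. (1/2) ^ card V * y"] prod.cong) auto
  then show ?thesis unfolding ev_def by simp
qed

lemma vinfo_weight_cong:
  assumes "\<And>i. i \<in> V \<Longrightarrow> \<phi> i = \<phi>' i"
  shows "vinfo \<phi> V T w = vinfo \<phi>' V T w"
proof -
  have "ev \<phi> V (pairs V) F = ev \<phi>' V (pairs V) F" for F
    using assms Union_pairs_subset[of V] by (intro ev_weight_cong) auto
  then show ?thesis unfolding vinfo_def by simp
qed

lemma world_weight_act:
  assumes inj: "inj \<pi>"
  shows "world_weight a b n \<phi> (\<pi> ` V) ((`) \<pi> ` E) (relabel \<pi> (x, g)) = world_weight a b n (\<phi> \<circ> \<pi>) V E (x, g)"
proof -
  have inj': "inj_on ((`) \<pi>) E" by (intro inj_onI) (simp only: inj_image_eq_iff[OF inj])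
  have ep: "eprob a b n \<phi> (\<pi> ` x) (\<pi> ` e) = eprob a b n (\<phi> \<circ> \<pi>) x e" for e
  proof -
    have "\<pi> ` e \<inter> \<pi> ` x = \<pi> ` (e \<inter> x)" using inj by (simp add: image_Int)
    then have 1: "\<pi> ` e \<inter> \<pi> ` x = {} \<longleftrightarrow> e \<inter> x = {}" by simp
    have 2: "(\<Prod>i\<in>\<pi> ` e. \<phi> i) = (\<Prod>i\<in>e. (\<phi> \<circ> \<pi>) i)" using inj by (subst prod.reindex) (auto intro: inj_on_subset)
    show ?thesis unfolding eprob_def 1 2 inj_image_subset_iff[OF inj] ..
  qed
  have mem: "\<pi> ` e \<in> (`) \<pi> ` g \<longleftrightarrow> e \<in> g" for e using inj by (auto simp: inj_image_eq_iff)
  have card: "card (\<pi> ` V) = card V" using inj by (intro card_image) (auto intro: inj_on_subset)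
  show ?thesis unfolding relabel_def fst_conv snd_conv world_weight_pair card
    by (subst prod.reindex[OF inj']) (simp add: ep mem cong: if_cong)
qed

lemma ev_act:
  assumes inj: "inj \<pi>"
  shows "ev \<phi> (\<pi> ` V) ((`) \<pi> ` E) F = ev (\<phi> \<circ> \<pi>) V E (\<lambda>\<omega>. F (relabel \<pi> \<omega>))"
proof -
  have i1: "inj_on ((`) \<pi>) A" for A by (intro inj_onI) (simp only: inj_image_eq_iff[OF inj])
  have i2: "inj_on ((`) ((`) \<pi>)) A" for A
    by (intro inj_onI) (simp only: inj_image_eq_iff[OF i1[of UNIV]])
  have a: "(\<pi> ` x, (`) \<pi> ` g) = relabel \<pi> (x, g)" for x g by (simp add: relabel_def)
  show ?thesis unfolding ev_def image_Pow_eq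
    unfolding sum.reindex[OF i1] sum.reindex[OF i2] comp_def a world_weight_act[OF inj, unfolded comp_def] ..
qed

lemma vinfo_permute:
  assumes inj: "inj \<pi>"
  shows "vinfo \<phi> (\<pi> ` V) (\<pi> ` T) (\<pi> w) = vinfo (\<phi> \<circ> \<pi>) V T w"
proof -
  have i1: "inj_on ((`) \<pi>) A" for A by (intro inj_onI) (simp only: inj_image_eq_iff[OF inj])
  have i1': "inj ((`) \<pi>)" by (rule i1)
  have act_inj: "inj_on (relabel \<pi>) A" for A
    by (intro inj_onI prod_eqI) (simp_all only: relabel_def prod.inject inj_image_eq_iff[OF inj] inj_image_eq_iff[OF i1'])
  have act_eq: "relabel \<pi> x = relabel \<pi> y \<longleftrightarrow> x = y" for x y
    by (rule inj_eq[OF act_inj])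
  have o: "obs (\<pi> ` V) (\<pi> ` T) (relabel \<pi> \<omega>) = relabel \<pi> (obs V T \<omega>)" for \<omega>
    unfolding obs_def relabel_def fst_conv snd_conv image_Pow_eq
    using inj i1' by (simp add: image_Int)
  have s: "spin (\<pi> w) (relabel \<pi> \<omega>) = spin w \<omega>" for \<omega>
    using inj by (auto simp: spin_def relabel_def inj_image_mem_iff)
  have dom: "Pow (\<pi> ` T) \<times> Pow (pairs (\<pi> ` V)) = relabel \<pi> ` (Pow T \<times> Pow (pairs V))"
  proof -
    have "relabel \<pi> ` (A \<times> B) = ((`) \<pi> ` A) \<times> ((`) ((`) \<pi>) ` B)" for A B
    proof (intro equalityI subsetI)
      fix z assume "z \<in> ((`) \<pi> ` A) \<times> ((`) ((`) \<pi>) ` B)"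
      then obtain x g where "x \<in> A" "g \<in> B" "z = relabel \<pi> (x, g)" by (auto simp: relabel_def)
      then show "z \<in> relabel \<pi> ` (A \<times> B)" by blast
    qed (auto simp: relabel_def)
    then show ?thesis unfolding pairs_image[OF inj] image_Pow_eq by simp
  qed
  show ?thesis unfolding vinfo_def dom
    unfolding sum.reindex[OF act_inj] pairs_image[OF inj] ev_act[OF inj] o s act_eq comp_def[of _ "relabel \<pi>"] ..
qed

lemma eprob_measurable:
  assumes "e \<subseteq> U" "finite e"
  shows "(\<lambda>\<phi>. eprob a b n \<phi> x e) \<in> borel_measurable (\<Pi>\<^sub>M i\<in>U. (borel :: real measure))"
proof -
  have "(\<lambda>\<phi>. \<Prod>i\<in>e. \<phi> i) \<in> borel_measurable (\<Pi>\<^sub>M i\<in>U. (borel :: real measure))"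
    using assms by (intro borel_measurable_prod) (auto intro!: measurable_component_singleton)
  then show ?thesis unfolding eprob_def
    by (intro borel_measurable_min borel_measurable_divide borel_measurable_times borel_measurable_const)
qed

lemma ev_measurable:
  assumes "\<Union>E \<subseteq> U" "\<And>e. e \<in> E \<Longrightarrow> finite e"
  shows "(\<lambda>\<phi>. ev \<phi> V E F) \<in> borel_measurable (\<Pi>\<^sub>M i\<in>U. (borel :: real measure))"
proof -
  have [measurable]: "(\<lambda>\<phi>. world_weight a b n \<phi> V E (x, g)) \<in> borel_measurable (\<Pi>\<^sub>M i\<in>U. (borel :: real measure))" for x g
    unfolding world_weight_pair
  proof (intro borel_measurable_times borel_measurable_const borel_measurable_prod)
    fix e assume "e \<in> E"
    then have [measurable]: "(\<lambda>\<phi>. eprob a b n \<phi> x e) \<in> borel_measurable (\<Pi>\<^sub>M i\<in>U. (borel :: real measure))"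
      using assms by (intro eprob_measurable) auto
    show "(\<lambda>\<phi>. if e \<in> g then eprob a b n \<phi> x e else 1 - eprob a b n \<phi> x e) \<in> borel_measurable (\<Pi>\<^sub>M i\<in>U. (borel :: real measure))"
      by measurable
  qed
  show ?thesis unfolding ev_def by measurable
qed

lemma vinfo_measurable:
  assumes "V \<subseteq> U"
  shows "(\<lambda>\<phi>. vinfo \<phi> V T w) \<in> borel_measurable (\<Pi>\<^sub>M i\<in>U. (borel :: real measure))"
proof -
  have [measurable]: "(\<lambda>\<phi>. ev \<phi> V (pairs V) F) \<in> borel_measurable (\<Pi>\<^sub>M i\<in>U. (borel :: real measure))" for F
    using assms by (intro ev_measurable) (auto simp: pairs_def intro: card_ge_0_finite)
  show ?thesis unfolding vinfo_def by measurable
qed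

end

lemma (in two_block_graph) info_eq_vinfo:
  assumes "V \<subseteq> U" "T \<subseteq> V" "w \<in> V"
  shows "info (obs V T) (spin w) = vinfo \<phi> V T w"
proof -
  have fin: "finite V" "finite T"
    using finite_subset[OF assms(1) finite_U] finite_subset[OF assms(2)] by auto
  have K: "obs V T ` worlds U (pairs U) \<subseteq> Pow T \<times> Pow (pairs V)"
  proof
    fix z assume "z \<in> obs V T ` worlds U (pairs U)"
    then obtain x g where z: "z = obs V T (x, g)" "g \<subseteq> pairs U" by (auto simp: worlds_def)
    then have "g \<inter> Pow V \<subseteq> pairs V" by (auto simp: pairs_def)
    then show "z \<in> Pow T \<times> Pow (pairs V)" by (simp add: z obs_def)
  qed
  have obs_restrict: "obs V T (x, g) = obs V T (x \<inter> V, g \<inter> pairs V)" if "g \<subseteq> pairs U" for x g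
  proof -
    have "x \<inter> T = x \<inter> V \<inter> T" "g \<inter> Pow V = g \<inter> pairs V \<inter> Pow V" using assms that by (auto simp: pairs_def)
    then show ?thesis by (simp add: obs_def)
  qed
  have restr: "wexp F = ev \<phi> V (pairs V) F"
    if F: "\<And>x g. x \<subseteq> U \<Longrightarrow> g \<subseteq> pairs U \<Longrightarrow> F (x, g) = F (x \<inter> V, g \<inter> pairs V)" for F
    unfolding wexp_ev
    by (rule ev_marginal[OF finite_U finite_pairs[OF finite_U] pairs_mono[OF assms(1)] assms(1) Union_pairs_subset F])
  have spin_restrict: "spin w (x, g) = spin w (x \<inter> V, g \<inter> pairs V)" for x g using assms by (simp add: spin_def)
  have 1: "wexp (\<lambda>\<omega>. of_bool (obs V T \<omega> = z) * spin w \<omega>) = ev \<phi> V (pairs V) (\<lambda>\<omega>. of_bool (obs V T \<omega> = z) * spin w \<omega>)" for z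
  proof (rule restr)
    fix x g assume g: "g \<subseteq> pairs U"
    show "of_bool (obs V T (x, g) = z) * spin w (x, g) = of_bool (obs V T (x \<inter> V, g \<inter> pairs V) = z) * spin w (x \<inter> V, g \<inter> pairs V)"
      unfolding obs_restrict[OF g, symmetric] spin_restrict[symmetric] ..
  qed
  have 2: "wexp (\<lambda>\<omega>. of_bool (obs V T \<omega> = z)) = ev \<phi> V (pairs V) (\<lambda>\<omega>. of_bool (obs V T \<omega> = z))" for z
  proof (rule restr)
    fix x g assume g: "g \<subseteq> pairs U"
    show "of_bool (obs V T (x, g) = z) = (of_bool (obs V T (x \<inter> V, g \<inter> pairs V) = z) :: real)"
      unfolding obs_restrict[OF g, symmetric] ..
  qed
  show ?thesis
    unfolding vinfo_def info_fibres[OF finite_cartesian_product[OF finite_Pow_iff[THEN iffD2, OF fin(2)]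
      finite_Pow_iff[THEN iffD2, OF finite_pairs[OF fin(1)]]] K] 1 2 ..
qed

section \<open>Independent random weights\<close>

context two_block
begin

lemma vinfo_two_block_graph:
  "finite V \<Longrightarrow> (\<And>i. i \<in> V \<Longrightarrow> 0 \<le> \<phi> i) \<Longrightarrow> two_block_graph a b n \<phi> V"
  by unfold_locales

lemma vinfo_range:
  assumes "finite V" "\<And>i. i \<in> V \<Longrightarrow> 0 \<le> \<phi> i" "T \<subseteq> V" "w \<in> V"
  shows "0 \<le> vinfo \<phi> V T w" "vinfo \<phi> V T w \<le> 1"
proof -
  interpret two_block_graph a b n \<phi> V by (rule vinfo_two_block_graph) fact+
  have "0 \<le> info (obs V T) (spin w)" by (rule info_nonneg)
  moreover have "info (obs V T) (spin w) \<le> wexp (\<lambda>_. 1)" by (rule info_le_total) (rule spin_bound)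
  ultimately show "0 \<le> vinfo \<phi> V T w" "vinfo \<phi> V T w \<le> 1"
    using info_eq_vinfo[OF order_refl assms(3,4)] wexp_one by auto
qed

lemma vinfo_mono:
  assumes "finite V'" "\<And>i. i \<in> V' \<Longrightarrow> 0 \<le> \<phi> i" "V \<subseteq> V'" "T \<subseteq> T'" "T \<subseteq> V" "T' \<subseteq> V'" "w \<in> V"
  shows "vinfo \<phi> V T w \<le> vinfo \<phi> V' T' w"
proof -
  interpret two_block_graph a b n \<phi> V' by (rule vinfo_two_block_graph) fact+
  have "info (obs V T) (spin w) \<le> info (obs V' T') (spin w)"
    by (rule info_mono[OF obs_mono]) fact+
  then show ?thesis using assms by (simp add: info_eq_vinfo subset_iff)
qed

lemma vinfo_pinned:
  assumes "finite V" "\<And>i. i \<in> V \<Longrightarrow> 0 \<le> \<phi> i" "T \<subseteq> V" "w \<in> T"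
  shows "vinfo \<phi> V T w = 1"
proof -
  interpret two_block_graph a b n \<phi> V by (rule vinfo_two_block_graph) fact+
  have "info (obs V T) (spin w) = wexp (\<lambda>\<omega>. (spin w \<omega>)\<^sup>2)"
    by (rule info_determined[OF obs_determines_spin]) fact
  then have "info (obs V T) (spin w) = 1" by (simp add: spin_bound wexp_one)
  then show ?thesis using assms info_eq_vinfo[of V T w] by auto
qed

text \<open>The cavity inequality for explicit weights. Vertices in \<open>T\<close> do not contribute to the last sum, since
  their signs are known anyway.\<close>

lemma vinfo_cavity:
  assumes V: "finite V" "u \<notin> V" "\<And>i. i \<in> insert u V \<Longrightarrow> 0 \<le> \<phi> i" and T: "T \<subseteq> V" and y0: "0 \<le> y0"
  shows "damping a b * vinfo \<phi> (insert u V) T u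
    \<le> sat y0 + (damping a b * signal a b * (\<Sum>w\<in>V. \<phi> u * \<phi> w / real n * vinfo \<phi> V T w) - y0) / (1 + y0 / 2)\<^sup>2
       + err_const a b * ((\<Sum>w\<in>V. (\<phi> u * \<phi> w / real n)\<^sup>2) +
           (\<Sum>w\<in>V - T. \<phi> u * \<phi> w / real n * sqrt (vinfo \<phi> (insert u V) (insert u T) w - vinfo \<phi> V T w)))"
proof -
  interpret two_block_graph a b n \<phi> "insert u V" by (rule vinfo_two_block_graph) (use V in auto)
  have i1: "info (obs V T) (spin w) = vinfo \<phi> V T w" if "w \<in> V" for w
    using that T by (intro info_eq_vinfo) auto
  have i2: "info (obs (insert u V) (insert u T)) (spin w) = vinfo \<phi> (insert u V) (insert u T) w" if "w \<in> V" for w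
    using that T by (intro info_eq_vinfo) auto
  have i3: "info (obs (insert u V) T) (spin u) = vinfo \<phi> (insert u V) T u"
    using T by (intro info_eq_vinfo) auto
  have "(\<Sum>w\<in>V. pair_scale u w * sqrt (info (obs (insert u V) (insert u T)) (spin w) - info (obs V T) (spin w))) =
     (\<Sum>w\<in>V - T. \<phi> u * \<phi> w / real n * sqrt (vinfo \<phi> (insert u V) (insert u T) w - vinfo \<phi> V T w))"
  proof (rule sum.mono_neutral_cong_right)
    show "\<forall>i\<in>V - (V - T). pair_scale u i * sqrt (info (obs (insert u V) (insert u T)) (spin i) - info (obs V T) (spin i)) = 0"
    proof
      fix i assume "i \<in> V - (V - T)"
      then have i: "i \<in> T" "i \<in> V" by auto
      have "vinfo \<phi> (insert u V) (insert u T) i = 1" "vinfo \<phi> V T i = 1"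
        using V T i by (auto intro!: vinfo_pinned)
      then show "pair_scale u i * sqrt (info (obs (insert u V) (insert u T)) (spin i) - info (obs V T) (spin i)) = 0"
        using i1[OF i(2)] i2[OF i(2)] by simp
    qed
  qed (use V i1 i2 in \<open>auto simp: pair_scale_def\<close>)
  then have 1: "(\<Sum>w\<in>V. (pair_scale u w)\<^sup>2 + pair_scale u w * sqrt (info (obs (insert u V) (insert u T)) (spin w) - info (obs V T) (spin w)))
    = (\<Sum>w\<in>V. (\<phi> u * \<phi> w / real n)\<^sup>2) +
           (\<Sum>w\<in>V - T. \<phi> u * \<phi> w / real n * sqrt (vinfo \<phi> (insert u V) (insert u T) w - vinfo \<phi> V T w))"
    by (simp add: sum.distrib pair_scale_def)
  have 2: "(\<Sum>w\<in>V. pair_scale u w * info (obs V T) (spin w)) = (\<Sum>w\<in>V. \<phi> u * \<phi> w / real n * vinfo \<phi> V T w)"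
    by (intro sum.cong refl) (simp add: i1 pair_scale_def)
  show ?thesis
    using cavity_inequality[of u V T y0] V T y0 unfolding 1 2 i3 by auto
qed

end

text \<open>The law of a single weight; four moments suffice for all error terms.\<close>

locale weight_law =
  fixes \<mu> :: "real measure"
  assumes prob_\<mu>: "prob_space \<mu>" and sets_\<mu>: "sets \<mu> = sets borel"
    and AE_nonneg: "AE x in \<mu>. 0 \<le> x"
    and moments: "\<And>k. k \<le> 4 \<Longrightarrow> integrable \<mu> (\<lambda>x. x ^ k)"
begin

text \<open>Moments, and the law of independent weights on the vertex set \<open>U\<close>.\<close>

definition mom :: "nat \<Rightarrow> real" where "mom k = (\<integral>x. x ^ k \<partial>\<mu>)"

definition iid :: "nat set \<Rightarrow> (nat \<Rightarrow> real) measure" where "iid U = (\<Pi>\<^sub>M i\<in>U. \<mu>)"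

lemma prob_iid: "prob_space (iid U)"
  unfolding iid_def by (intro prob_space_PiM prob_\<mu>)

lemma sets_iid: "sets (iid U) = sets (\<Pi>\<^sub>M i\<in>U. (borel :: real measure))"
  unfolding iid_def by (intro sets_PiM_cong) (auto simp: sets_\<mu>)

lemma measurable_iid: "f \<in> borel_measurable (\<Pi>\<^sub>M i\<in>U. (borel :: real measure)) \<Longrightarrow> f \<in> borel_measurable (iid U)"
  using measurable_cong_sets[OF sets_iid refl] by blast

lemma measurable_\<mu>: "f \<in> borel_measurable borel \<Longrightarrow> f \<in> borel_measurable \<mu>"
  using measurable_cong_sets[OF sets_\<mu> refl] by blast

lemma component_measurable: "i \<in> U \<Longrightarrow> (\<lambda>\<phi>. \<phi> i) \<in> measurable (iid U) \<mu>"
  unfolding iid_def by (rule measurable_component_singleton)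

lemma distr_component: "i \<in> U \<Longrightarrow> distr (iid U) \<mu> (\<lambda>\<phi>. \<phi> i) = \<mu>"
  unfolding iid_def by (intro distr_PiM_component prob_\<mu>)

lemma component_integral:
  fixes g :: "real \<Rightarrow> real"
  assumes "i \<in> U" "g \<in> borel_measurable borel"
  shows "(\<integral>\<phi>. g (\<phi> i) \<partial>iid U) = (\<integral>x. g x \<partial>\<mu>)" "integrable (iid U) (\<lambda>\<phi>. g (\<phi> i)) \<longleftrightarrow> integrable \<mu> g"
proof -
  note g = measurable_\<mu>[OF assms(2)]
  show "(\<integral>\<phi>. g (\<phi> i) \<partial>iid U) = (\<integral>x. g x \<partial>\<mu>)"
    using integral_distr[OF component_measurable[OF assms(1)] g] distr_component[OF assms(1)] by simp
  show "integrable (iid U) (\<lambda>\<phi>. g (\<phi> i)) \<longleftrightarrow> integrable \<mu> g"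
    using integrable_distr_eq[OF component_measurable[OF assms(1)] g] distr_component[OF assms(1)] by simp
qed

lemma component_power:
  assumes "i \<in> U" "k \<le> 4"
  shows "integrable (iid U) (\<lambda>\<phi>. \<phi> i ^ k)" "(\<integral>\<phi>. \<phi> i ^ k \<partial>iid U) = mom k"
  using component_integral[OF assms(1), of "\<lambda>x. x ^ k"] moments[OF assms(2)] by (simp_all add: mom_def)

lemma AE_iid_nonneg: "finite U \<Longrightarrow> AE \<phi> in iid U. \<forall>i\<in>U. 0 \<le> \<phi> i"
  unfolding iid_def by (intro AE_finite_allI AE_PiM_component[OF prob_\<mu> _ AE_nonneg])

lemma indep_components: "U \<noteq> {} \<Longrightarrow> prob_space.indep_vars (iid U) (\<lambda>_. \<mu>) (\<lambda>i \<phi>. \<phi> i) U"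
proof -
  assume U: "U \<noteq> {}"
  interpret P: prob_space "iid U" by (rule prob_iid)
  have "distr (iid U) (\<Pi>\<^sub>M i\<in>U. \<mu>) (\<lambda>x. \<lambda>i\<in>U. x i) = distr (iid U) (iid U) (\<lambda>x. x)"
    by (rule distr_cong) (auto simp: iid_def space_PiM)
  also have "\<dots> = iid U" by (rule distr_id)
  also have "\<dots> = (\<Pi>\<^sub>M i\<in>U. distr (iid U) \<mu> (\<lambda>\<phi>. \<phi> i))"
    unfolding iid_def[of U] by (rule PiM_cong) (simp_all add: distr_component[unfolded iid_def])
  finally show ?thesis
    by (subst P.indep_vars_iff_distr_eq_PiM'[OF U]) (auto intro: component_measurable)
qed

text \<open>A function of one weight is independent of a function of the others.\<close>

lemma product_rule:
  fixes g :: "real \<Rightarrow> real" and H :: "(nat \<Rightarrow> real) \<Rightarrow> real"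
  assumes "i \<in> U" and g: "g \<in> borel_measurable borel" "integrable \<mu> g"
    and H: "H \<in> borel_measurable (\<Pi>\<^sub>M i\<in>U - {i}. (borel :: real measure))" "\<And>\<phi>. H (restrict \<phi> (U - {i})) = H \<phi>"
    and intH: "integrable (iid U) H"
  shows "integrable (iid U) (\<lambda>\<phi>. g (\<phi> i) * H \<phi>)"
    "(\<integral>\<phi>. g (\<phi> i) * H \<phi> \<partial>iid U) = (\<integral>x. g x \<partial>\<mu>) * (\<integral>\<phi>. H \<phi> \<partial>iid U)"
proof -
  interpret P: prob_space "iid U" by (rule prob_iid)
  have "P.indep_var (PiM {i} (\<lambda>_. \<mu>)) (\<lambda>\<omega>. restrict (\<lambda>j. \<omega> j) {i}) (PiM (U - {i}) (\<lambda>_. \<mu>)) (\<lambda>\<omega>. restrict (\<lambda>j. \<omega> j) (U - {i}))"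
    using assms(1) by (intro P.indep_var_restrict[OF indep_components]) auto
  then have "P.indep_var borel ((\<lambda>r. g (r i)) \<circ> (\<lambda>\<omega>. restrict (\<lambda>j. \<omega> j) {i})) borel (H \<circ> (\<lambda>\<omega>. restrict (\<lambda>j. \<omega> j) (U - {i})))"
  proof (rule P.indep_var_compose)
    show "(\<lambda>r. g (r i)) \<in> borel_measurable (PiM {i} (\<lambda>_. \<mu>))"
      by (rule measurable_compose[where f="\<lambda>r. r i" and g=g, OF measurable_component_singleton measurable_\<mu>[OF g(1)]]) simp
    show "H \<in> borel_measurable (PiM (U - {i}) (\<lambda>_. \<mu>))" using measurable_iid[OF H(1)] by (simp add: iid_def)
  qed
  then have ind: "P.indep_var borel (\<lambda>\<phi>. g (\<phi> i)) borel H" by (simp add: comp_def H(2))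
  have ig: "integrable (iid U) (\<lambda>\<phi>. g (\<phi> i))" using component_integral(2)[OF assms(1) g(1)] g(2) by simp
  show "integrable (iid U) (\<lambda>\<phi>. g (\<phi> i) * H \<phi>)" by (rule P.indep_var_integrable[OF ind ig intH])
  show "(\<integral>\<phi>. g (\<phi> i) * H \<phi> \<partial>iid U) = (\<integral>x. g x \<partial>\<mu>) * (\<integral>\<phi>. H \<phi> \<partial>iid U)"
    using P.indep_var_lebesgue_integral[OF ind ig intH] component_integral(1)[OF assms(1) g(1)] by simp
qed

lemma power_product:
  assumes "i \<in> U" "j \<in> U" "i \<noteq> j" "k \<le> 4" "l \<le> 4"
  shows "integrable (iid U) (\<lambda>\<phi>. \<phi> i ^ k * \<phi> j ^ l)" "(\<integral>\<phi>. \<phi> i ^ k * \<phi> j ^ l \<partial>iid U) = mom k * mom l"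
proof -
  have H: "(\<lambda>\<phi>. \<phi> j ^ l) \<in> borel_measurable (\<Pi>\<^sub>M i\<in>U - {i}. (borel :: real measure))"
    using assms by (intro borel_measurable_power measurable_component_singleton) auto
  note pr = product_rule[of i U "\<lambda>x. x ^ k" "\<lambda>\<phi>. \<phi> j ^ l", OF assms(1) _ moments[OF assms(4)] H _ component_power(1)[OF assms(2,5)]]
  show "integrable (iid U) (\<lambda>\<phi>. \<phi> i ^ k * \<phi> j ^ l)" using pr(1) assms by simp
  show "(\<integral>\<phi>. \<phi> i ^ k * \<phi> j ^ l \<partial>iid U) = mom k * mom l"
    using pr(2) assms component_power(2)[OF assms(2,5)] by (simp add: mom_def)
qed

lemma mom_nonneg: "0 \<le> mom k"
  unfolding mom_def by (rule integral_nonneg_AE) (use AE_nonneg in \<open>auto elim: eventually_mono\<close>)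

text \<open>The joint law of the weights is invariant under permutations.\<close>

lemma iid_permute:
  fixes F :: "(nat \<Rightarrow> real) \<Rightarrow> real"
  assumes "bij_betw \<pi> U U" "F \<in> borel_measurable (\<Pi>\<^sub>M i\<in>U. (borel :: real measure))" "\<And>\<phi>. F (restrict \<phi> U) = F \<phi>"
  shows "(\<integral>\<phi>. F (\<phi> \<circ> \<pi>) \<partial>iid U) = (\<integral>\<phi>. F \<phi> \<partial>iid U)"
proof -
  have pi: "inj_on \<pi> U" "\<pi> \<in> U \<rightarrow> U" using assms(1) by (auto simp: bij_betw_def)
  have d: "distr (iid U) (iid U) (\<lambda>\<omega>. \<lambda>i\<in>U. \<omega> (\<pi> i)) = iid U"
    unfolding iid_def by (rule distr_PiM_reindex[OF prob_\<mu> pi, simplified])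
  have m: "(\<lambda>\<omega>. \<lambda>i\<in>U. \<omega> (\<pi> i)) \<in> measurable (iid U) (iid U)"
    unfolding iid_def using pi by (intro measurable_restrict measurable_component_singleton) auto
  have "(\<integral>\<phi>. F \<phi> \<partial>iid U) = (\<integral>\<phi>. F \<phi> \<partial>distr (iid U) (iid U) (\<lambda>\<omega>. \<lambda>i\<in>U. \<omega> (\<pi> i)))" unfolding d ..
  also have "\<dots> = (\<integral>\<phi>. F (\<lambda>i\<in>U. \<phi> (\<pi> i)) \<partial>iid U)"
    by (rule integral_distr[OF m measurable_iid[OF assms(2)]])
  also have "\<dots> = (\<integral>\<phi>. F (\<phi> \<circ> \<pi>) \<partial>iid U)"
  proof (intro Bochner_Integration.integral_cong refl)
    fix \<phi> show "F (\<lambda>i\<in>U. \<phi> (\<pi> i)) = F (\<phi> \<circ> \<pi>)"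
      using assms(3)[of "\<phi> \<circ> \<pi>"] by (simp only: comp_def)
  qed
  finally show ?thesis ..
qed

end

section \<open>The cavity inequality on average over the weights\<close>

locale weighted_two_block = two_block + weight_law
begin

lemma vinfo_measurable_iid [measurable]: "V \<subseteq> U \<Longrightarrow> (\<lambda>\<phi>. vinfo \<phi> V T w) \<in> borel_measurable (iid U)"
  by (intro measurable_iid vinfo_measurable)

lemma component_borel: "i \<in> U \<Longrightarrow> (\<lambda>\<phi>. \<phi> i) \<in> borel_measurable (iid U)"
  by (intro measurable_iid measurable_component_singleton)

lemma integrable_weight_vinfo:
  assumes "finite U" "V \<subseteq> U" "T \<subseteq> V" "w \<in> V" "u \<in> U"
  shows "integrable (iid U) (\<lambda>\<phi>. \<phi> u * vinfo \<phi> V T w)"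
proof (rule Bochner_Integration.integrable_bound)
  show "integrable (iid U) (\<lambda>\<phi>. \<phi> u ^ 1)" by (rule component_power) (use assms in auto)
  show "(\<lambda>\<phi>. \<phi> u * vinfo \<phi> V T w) \<in> borel_measurable (iid U)"
    using assms by (intro borel_measurable_times component_borel vinfo_measurable_iid)
  show "AE \<phi> in iid U. norm (\<phi> u * vinfo \<phi> V T w) \<le> norm (\<phi> u ^ 1)"
    using AE_iid_nonneg[OF assms(1)]
  proof eventually_elim
    case (elim \<phi>)
    have "0 \<le> vinfo \<phi> V T w" "vinfo \<phi> V T w \<le> 1"
      using assms elim finite_subset[OF assms(2,1)] by (auto intro!: vinfo_range)
    then show ?case using elim assms by (auto simp: abs_mult intro: mult_left_le)
  qed
qed

lemma integrable_vinfo: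
  assumes "finite U" "V \<subseteq> U" "T \<subseteq> V" "w \<in> V"
  shows "integrable (iid U) (\<lambda>\<phi>. vinfo \<phi> V T w)"
proof -
  interpret P: prob_space "iid U" by (rule prob_iid)
  show ?thesis
  proof (rule P.integrable_const_bound[where B=1])
    show "AE \<phi> in iid U. norm (vinfo \<phi> V T w) \<le> 1"
      using AE_iid_nonneg[OF assms(1)]
    proof eventually_elim
      case (elim \<phi>)
      have "0 \<le> vinfo \<phi> V T w" "vinfo \<phi> V T w \<le> 1"
        using assms elim finite_subset[OF assms(2,1)] by (auto intro!: vinfo_range)
      then show ?case by simp
    qed
  qed (use assms in \<open>auto intro: vinfo_measurable_iid\<close>)
qed

text \<open>The information about \<open>w\<close> on average over the weights, biased by the weight of \<open>w\<close>; a
  vertex enters the cavity inequality in proportion to its weight, so this is what the recursion propagates.\<close>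

definition rho :: "nat set \<Rightarrow> nat set \<Rightarrow> nat set \<Rightarrow> nat \<Rightarrow> real" where
  "rho U V T w = (\<integral>\<phi>. \<phi> w * vinfo \<phi> V T w \<partial>iid U)"

lemma rho_mono:
  assumes "finite U" "V' \<subseteq> U" "V \<subseteq> V'" "T \<subseteq> T'" "T \<subseteq> V" "T' \<subseteq> V'" "w \<in> V"
  shows "rho U V T w \<le> rho U V' T' w"
  unfolding rho_def
proof (rule integral_mono_AE)
  show "AE \<phi> in iid U. \<phi> w * vinfo \<phi> V T w \<le> \<phi> w * vinfo \<phi> V' T' w"
    using AE_iid_nonneg[OF assms(1)]
  proof eventually_elim
    case (elim \<phi>)
    have "vinfo \<phi> V T w \<le> vinfo \<phi> V' T' w"
      using assms elim finite_subset[OF assms(2,1)] by (intro vinfo_mono) auto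
    then show ?case using elim assms by (intro mult_left_mono) auto
  qed
qed (use assms in \<open>auto intro!: integrable_weight_vinfo\<close>)

lemma rho_permute:
  assumes "inj \<pi>" "\<pi> ` U = U" "V \<subseteq> U" "w \<in> V"
  shows "rho U (\<pi> ` V) (\<pi> ` T) (\<pi> w) = rho U V T w"
proof -
  have bij: "bij_betw \<pi> U U" using assms inj_on_subset[OF assms(1)] by (auto simp: bij_betw_def)
  have "rho U (\<pi> ` V) (\<pi> ` T) (\<pi> w) = (\<integral>\<phi>. (\<phi> \<circ> \<pi>) w * vinfo (\<phi> \<circ> \<pi>) V T w \<partial>iid U)"
    unfolding rho_def vinfo_permute[OF assms(1)] by simp
  also have "\<dots> = rho U V T w" unfolding rho_def
  proof (rule iid_permute[OF bij, of "\<lambda>\<phi>. \<phi> w * vinfo \<phi> V T w"])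
    show "(\<lambda>\<phi>. \<phi> w * vinfo \<phi> V T w) \<in> borel_measurable (\<Pi>\<^sub>M i\<in>U. (borel :: real measure))"
      using assms by (intro borel_measurable_times measurable_component_singleton vinfo_measurable) auto
    fix \<phi>
    have "vinfo (restrict \<phi> U) V T w = vinfo \<phi> V T w" using assms by (intro vinfo_weight_cong) auto
    then show "restrict \<phi> U w * vinfo (restrict \<phi> U) V T w = \<phi> w * vinfo \<phi> V T w" using assms by auto
  qed
  finally show ?thesis .
qed

text \<open>Exchangeability of two vertices whose signs are not revealed.\<close>

lemma rho_swap:
  assumes "u \<in> V" "w \<in> V" "V \<subseteq> U" "u \<notin> T" "w \<notin> T"
  shows "rho U V T w = rho U V T u"
proof -
  let ?\<pi> = "Transposition.transpose u w"
  have V: "?\<pi> ` V = V" "?\<pi> ` U = U" using assms by (auto simp: transpose_image_eq subsetD[OF assms(3)])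
  have T: "?\<pi> ` T = T" using assms by (intro transpose_image_eq) auto
  have "rho U V T w = rho U (?\<pi> ` V) (?\<pi> ` T) (?\<pi> u)" by (simp only: V T transpose_apply_first)
  also have "\<dots> = rho U V T u" by (rule rho_permute[OF _ V(2)]) (use assms in auto)
  finally show ?thesis .
qed

text \<open>The cavity inequality is linearised at the mean \<open>c\<close> of the average information \<open>L\<close>. The linear term
  integrates to zero, because \<open>L\<close> does not depend on the weight of \<open>u\<close>. The parameter \<open>s\<close> comes from
  splitting \<open>\<phi>\<^sub>u\<^sup>2 \<phi>\<^sub>w \<surd>\<Delta>\<close> by the inequality of the means, and \<open>D\<close> is the average growth of the information.\<close>

lemma averaged_cavity:
  fixes U V T :: "nat set" and u :: nat and s :: real
  assumes U: "finite U" "u \<in> U" "V \<subseteq> U" "u \<notin> V" "T \<subseteq> V"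
    and card: "card V \<le> 2 * n" "card (V - T) \<le> n" and s: "s > 0"
  defines "K \<equiv> damping a b * signal a b"
  defines "L \<equiv> (\<lambda>\<phi>. (\<Sum>w\<in>V. \<phi> w * vinfo \<phi> V T w) / real n)"
  defines "c \<equiv> (\<integral>\<phi>. L \<phi> \<partial>iid U)"
  defines "D \<equiv> (\<Sum>w\<in>V - T. \<integral>\<phi>. vinfo \<phi> (insert u V) (insert u T) w - vinfo \<phi> V T w \<partial>iid U) / real n"
  shows "damping a b * rho U (insert u V) T u \<le> (\<integral>x. x * sat (K * x * c) \<partial>\<mu>)
    + err_const a b * (2 * mom 3 * mom 2 / real n + (s * mom 4 * mom 2 + D / s) / 2)"
proof -
  have finV: "finite V" using finite_subset[OF U(3,1)] .
  have n0: "real n > 0" using n_pos by simp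
  have k0: "0 < damping a b" using damping_pos[OF a_pos b_pos] by simp
  have K0: "0 \<le> K" unfolding K_def using k0 signal_nonneg[OF a_pos b_pos] by simp
  define G where "G x = K * x\<^sup>2 / (1 + K * x * c / 2)\<^sup>2" for x
  define R1 where "R1 \<phi> = (\<Sum>w\<in>V. (1 / (real n)\<^sup>2) * (\<phi> u ^ 3 * \<phi> w ^ 2))" for \<phi> :: "nat \<Rightarrow> real"
  define R2 where "R2 \<phi> = (\<Sum>w\<in>V - T. (1 / (2 * real n)) * (s * (\<phi> u ^ 4 * \<phi> w ^ 2) +
      (1 / s) * (vinfo \<phi> (insert u V) (insert u T) w - vinfo \<phi> V T w)))" for \<phi> :: "nat \<Rightarrow> real"
  have intL: "integrable (iid U) L"
    unfolding L_def using U by (intro integrable_divide Bochner_Integration.integrable_sum integrable_weight_vinfo) auto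
  have c0: "0 \<le> c" unfolding c_def
  proof (rule integral_nonneg_AE, use AE_iid_nonneg[OF U(1)] in eventually_elim)
    case (elim \<phi>)
    then show ?case unfolding L_def using U finV
      by (intro divide_nonneg_nonneg sum_nonneg mult_nonneg_nonneg vinfo_range) auto
  qed
  have m2: "integrable \<mu> (\<lambda>x. x\<^sup>2)" using moments[of 2] by simp
  have Gm: "G \<in> borel_measurable borel" unfolding G_def by measurable
  have Gi: "integrable \<mu> G"
  proof (rule Bochner_Integration.integrable_bound)
    show "integrable \<mu> (\<lambda>x. K * x\<^sup>2)" using m2 by simp
    show "AE x in \<mu>. norm (G x) \<le> norm (K * x\<^sup>2)" using AE_nonneg
    proof eventually_elim
      case (elim x)
      then have "1 \<le> 1 + K * x * c / 2" using K0 c0 by simp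
      then have "1 \<le> (1 + K * x * c / 2)\<^sup>2" by (simp add: one_le_power)
      then have "G x \<le> K * x\<^sup>2 / 1" unfolding G_def using K0 by (intro divide_left_mono) auto
      moreover have "0 \<le> G x" unfolding G_def using K0 by simp
      ultimately show ?case by simp
    qed
  qed (rule measurable_\<mu>[OF Gm])
  have Sm: "(\<lambda>x. x * sat (K * x * c)) \<in> borel_measurable borel" unfolding sat_def by measurable
  have Si: "integrable \<mu> (\<lambda>x. x * sat (K * x * c))"
  proof (rule Bochner_Integration.integrable_bound)
    show "integrable \<mu> (\<lambda>x. (K * c) * x\<^sup>2)" using m2 by simp
    show "AE x in \<mu>. norm (x * sat (K * x * c)) \<le> norm ((K * c) * x\<^sup>2)" using AE_nonneg
    proof eventually_elim
      case (elim x)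
      then have y: "0 \<le> K * x * c" using K0 c0 by simp
      then have "sat (K * x * c) \<le> K * x * c" "0 \<le> sat (K * x * c)"
        by (auto simp: sat_nonneg) (auto simp: sat_def divide_le_eq mult_le_cancel_left1)
      then have "x * sat (K * x * c) \<le> x * (K * x * c)" "0 \<le> x * sat (K * x * c)" using elim by (auto intro: mult_left_mono)
      then show ?case using y elim K0 c0 by (simp add: power2_eq_square algebra_simps)
    qed
  qed (rule measurable_\<mu>[OF Sm])
  have Lr: "L \<in> borel_measurable (\<Pi>\<^sub>M i\<in>U - {u}. (borel :: real measure))"
    unfolding L_def using U
    by (intro borel_measurable_divide borel_measurable_sum borel_measurable_times borel_measurable_const
        measurable_component_singleton vinfo_measurable) auto
  have Lr': "L (restrict \<phi> (U - {u})) = L \<phi>" for \<phi>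
  proof -
    have "vinfo (restrict \<phi> (U - {u})) V T w = vinfo \<phi> V T w" for w
      using U by (intro vinfo_weight_cong) auto
    then show ?thesis unfolding L_def using U by (intro arg_cong[where f="\<lambda>x. x / real n"] sum.cong) auto
  qed
  note GL = product_rule[OF U(2) Gm Gi Lr Lr' intL]
  have int_u: "integrable (iid U) (\<lambda>\<phi>. G (\<phi> u))" "(\<integral>\<phi>. G (\<phi> u) \<partial>iid U) = (\<integral>x. G x \<partial>\<mu>)"
    "integrable (iid U) (\<lambda>\<phi>. \<phi> u * sat (K * \<phi> u * c))"
    "(\<integral>\<phi>. \<phi> u * sat (K * \<phi> u * c) \<partial>iid U) = (\<integral>x. x * sat (K * x * c) \<partial>\<mu>)"
    using component_integral[OF U(2) Gm] component_integral[OF U(2) Sm] Gi Si by auto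
  have pp: "integrable (iid U) (\<lambda>\<phi>. \<phi> u ^ k * \<phi> w ^ 2)" "(\<integral>\<phi>. \<phi> u ^ k * \<phi> w ^ 2 \<partial>iid U) = mom k * mom 2"
    if "w \<in> V" "k \<le> 4" for w k using that U by (auto intro!: power_product)
  have vi: "integrable (iid U) (\<lambda>\<phi>. vinfo \<phi> (insert u V) (insert u T) w - vinfo \<phi> V T w)" if "w \<in> V" for w
    using that U by (intro Bochner_Integration.integrable_diff integrable_vinfo) auto
  have iR1: "integrable (iid U) R1" unfolding R1_def
    by (intro Bochner_Integration.integrable_sum integrable_mult_right pp) auto
  have R1: "(\<integral>\<phi>. R1 \<phi> \<partial>iid U) \<le> 2 * mom 3 * mom 2 / real n"
  proof -
    have "(\<integral>\<phi>. R1 \<phi> \<partial>iid U) = (\<Sum>w\<in>V. (1 / (real n)\<^sup>2) * (mom 3 * mom 2))"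
      unfolding R1_def by (subst Bochner_Integration.integral_sum) (auto simp: pp)
    also have "\<dots> = real (card V) * (mom 3 * mom 2) / (real n)\<^sup>2" by simp
    also have "\<dots> \<le> (2 * real n) * (mom 3 * mom 2) / (real n)\<^sup>2"
      using card(1) mom_nonneg by (intro divide_right_mono mult_right_mono) auto
    also have "\<dots> = 2 * mom 3 * mom 2 / real n" using n0 by (simp add: power2_eq_square)
    finally show ?thesis .
  qed
  have iR2: "integrable (iid U) R2" unfolding R2_def
    by (intro Bochner_Integration.integrable_sum integrable_mult_right Bochner_Integration.integrable_add pp vi) auto
  have R2: "(\<integral>\<phi>. R2 \<phi> \<partial>iid U) \<le> (s * mom 4 * mom 2 + D / s) / 2"
  proof -
    have "(\<integral>\<phi>. R2 \<phi> \<partial>iid U) = (\<Sum>w\<in>V - T. (1 / (2 * real n)) * (s * (mom 4 * mom 2) +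
      (1 / s) * (\<integral>\<phi>. vinfo \<phi> (insert u V) (insert u T) w - vinfo \<phi> V T w \<partial>iid U)))"
      unfolding R2_def
      by (subst Bochner_Integration.integral_sum) (auto simp: pp vi simp del: Bochner_Integration.integral_diff intro!: integrable_mult_right Bochner_Integration.integrable_add)
    also have "\<dots> = (real (card (V - T)) / real n * (s * (mom 4 * mom 2)) + (1/s) * D) / 2"
    proof -
      have e1: "(\<Sum>w\<in>W. 1 / (2 * real n) * (A + 1/s * d w)) = 1 / (2 * real n) * (real (card W) * A + 1/s * sum d W)"
        for W :: "nat set" and d A unfolding sum_distrib_left[symmetric] sum.distrib by simp
      have e2: "1 / (2 * real n) * (x * A + 1/s * y) = (x / real n * A + (1/s) * (y / real n)) / 2" for x y A
        using n0 s by (simp add: field_simps)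
      show ?thesis unfolding D_def e1 unfolding e2 ..
    qed
    also have "\<dots> \<le> (1 * (s * (mom 4 * mom 2)) + (1/s) * D) / 2"
      using card(2) n0 s mom_nonneg by (intro divide_right_mono add_right_mono mult_right_mono) auto
    finally show ?thesis by (simp add: mult.assoc)
  qed
  have "damping a b * rho U (insert u V) T u = (\<integral>\<phi>. damping a b * (\<phi> u * vinfo \<phi> (insert u V) T u) \<partial>iid U)"
    unfolding rho_def by simp
  also have "\<dots> \<le> (\<integral>\<phi>. \<phi> u * sat (K * \<phi> u * c) + (G (\<phi> u) * L \<phi> - c * G (\<phi> u)) + err_const a b * (R1 \<phi> + R2 \<phi>) \<partial>iid U)"
  proof (rule integral_mono_AE)
    show "integrable (iid U) (\<lambda>\<phi>. damping a b * (\<phi> u * vinfo \<phi> (insert u V) T u))"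
      using U by (intro integrable_mult_right integrable_weight_vinfo) auto
    show "integrable (iid U) (\<lambda>\<phi>. \<phi> u * sat (K * \<phi> u * c) + (G (\<phi> u) * L \<phi> - c * G (\<phi> u)) + err_const a b * (R1 \<phi> + R2 \<phi>))"
      by (intro Bochner_Integration.integrable_add Bochner_Integration.integrable_diff integrable_mult_right int_u GL iR1 iR2)
    show "AE \<phi> in iid U. damping a b * (\<phi> u * vinfo \<phi> (insert u V) T u)
       \<le> \<phi> u * sat (K * \<phi> u * c) + (G (\<phi> u) * L \<phi> - c * G (\<phi> u)) + err_const a b * (R1 \<phi> + R2 \<phi>)"
      using AE_iid_nonneg[OF U(1)]
    proof eventually_elim
      case (elim \<phi>)
      define y0 where "y0 = K * \<phi> u * c"
      have pu: "0 \<le> \<phi> u" using elim U by auto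
      have pw: "0 \<le> \<phi> w" if "w \<in> V" for w using elim U that by auto
      have y0: "0 \<le> y0" unfolding y0_def using K0 pu c0 by simp
      let ?\<Delta> = "\<lambda>w. vinfo \<phi> (insert u V) (insert u T) w - vinfo \<phi> V T w"
      have \<Delta>0: "0 \<le> ?\<Delta> w" if "w \<in> V" for w
      proof -
        have "vinfo \<phi> V T w \<le> vinfo \<phi> (insert u V) (insert u T) w"
          by (rule vinfo_mono) (use U elim that finV in auto)
        then show ?thesis by simp
      qed
      have A1: "K * (\<Sum>w\<in>V. \<phi> u * \<phi> w / real n * vinfo \<phi> V T w) = K * \<phi> u * L \<phi>"
        unfolding L_def by (simp add: sum_distrib_left sum_divide_distrib mult.assoc)
      have A2: "\<phi> u * ((K * \<phi> u * L \<phi> - y0) / (1 + y0/2)\<^sup>2) = G (\<phi> u) * L \<phi> - c * G (\<phi> u)"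
        unfolding G_def y0_def by (simp add: power2_eq_square diff_divide_distrib algebra_simps)
      have A3: "\<phi> u * (\<Sum>w\<in>V. (\<phi> u * \<phi> w / real n)\<^sup>2) = R1 \<phi>"
        unfolding R1_def sum_distrib_left
        by (intro sum.cong refl) (simp add: power2_eq_square power3_eq_cube)
      have A4: "\<phi> u * (\<Sum>w\<in>V - T. \<phi> u * \<phi> w / real n * sqrt (?\<Delta> w)) \<le> R2 \<phi>"
        unfolding R2_def sum_distrib_left
      proof (rule sum_mono)
        fix w assume w: "w \<in> V - T"
        have am: "x * y \<le> (s * x\<^sup>2 + (1/s) * y\<^sup>2) / 2" for x y :: real
        proof -
          have "0 \<le> (sqrt s * x - y / sqrt s)\<^sup>2" by simp
          also have "\<dots> = s * x\<^sup>2 + (1/s) * y\<^sup>2 - 2 * (x * y)"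
            using s by (simp add: power2_diff power_mult_distrib power_divide)
          finally show ?thesis by simp
        qed
        have "\<phi> u * (\<phi> u * \<phi> w / real n * sqrt (?\<Delta> w)) = (1 / real n) * ((\<phi> u ^ 2 * \<phi> w) * sqrt (?\<Delta> w))"
          by (simp add: power2_eq_square)
        also have "\<dots> \<le> (1 / real n) * ((s * (\<phi> u ^ 2 * \<phi> w)\<^sup>2 + (1/s) * (sqrt (?\<Delta> w))\<^sup>2) / 2)"
          using n0 by (intro mult_left_mono am) auto
        also have "(sqrt (?\<Delta> w))\<^sup>2 = ?\<Delta> w" using \<Delta>0 w by simp
        also have "(\<phi> u ^ 2 * \<phi> w)\<^sup>2 = \<phi> u ^ 4 * \<phi> w ^ 2" by (simp add: power_mult_distrib flip: power_mult)
        finally show "\<phi> u * (\<phi> u * \<phi> w / real n * sqrt (?\<Delta> w)) \<le> 1 / (2 * real n) * (s * (\<phi> u ^ 4 * \<phi> w ^ 2) + 1 / s * ?\<Delta> w)"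
          by (simp add: mult.commute)
      qed
      have cav: "damping a b * vinfo \<phi> (insert u V) T u
          \<le> sat y0 + (K * \<phi> u * L \<phi> - y0) / (1 + y0 / 2)\<^sup>2 + err_const a b * ((\<Sum>w\<in>V. (\<phi> u * \<phi> w / real n)\<^sup>2) +
           (\<Sum>w\<in>V - T. \<phi> u * \<phi> w / real n * sqrt (?\<Delta> w)))"
        using vinfo_cavity[of V u \<phi> T y0] U elim finV y0 unfolding K_def[symmetric] A1 by auto
      have "damping a b * (\<phi> u * vinfo \<phi> (insert u V) T u) = \<phi> u * (damping a b * vinfo \<phi> (insert u V) T u)" by simp
      also have "\<dots> \<le> \<phi> u * (sat y0 + (K * \<phi> u * L \<phi> - y0) / (1 + y0 / 2)\<^sup>2 + err_const a b * ((\<Sum>w\<in>V. (\<phi> u * \<phi> w / real n)\<^sup>2) +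
           (\<Sum>w\<in>V - T. \<phi> u * \<phi> w / real n * sqrt (?\<Delta> w))))"
        using cav pu by (rule mult_left_mono)
      also have "\<dots> = \<phi> u * sat y0 + \<phi> u * ((K * \<phi> u * L \<phi> - y0) / (1 + y0 / 2)\<^sup>2) + err_const a b * (\<phi> u * (\<Sum>w\<in>V. (\<phi> u * \<phi> w / real n)\<^sup>2) +
           \<phi> u * (\<Sum>w\<in>V - T. \<phi> u * \<phi> w / real n * sqrt (?\<Delta> w)))"
        by (simp only: distrib_left mult.left_commute[of "\<phi> u"])
      also have "\<dots> \<le> \<phi> u * sat y0 + (G (\<phi> u) * L \<phi> - c * G (\<phi> u)) + err_const a b * (R1 \<phi> + R2 \<phi>)"
        unfolding A2 A3 using A4 err_const_nonneg[OF a_pos b_pos] by (intro add_left_mono mult_left_mono) auto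
      finally show ?case unfolding y0_def by (simp only: mult.assoc)
    qed
  qed
  also have "\<dots> = (\<integral>x. x * sat (K * x * c) \<partial>\<mu>) + ((\<integral>x. G x \<partial>\<mu>) * c - c * (\<integral>x. G x \<partial>\<mu>))
      + err_const a b * ((\<integral>\<phi>. R1 \<phi> \<partial>iid U) + (\<integral>\<phi>. R2 \<phi> \<partial>iid U))"
    using int_u GL iR1 iR2 by (simp add: c_def)
  also have "\<dots> \<le> (\<integral>x. x * sat (K * x * c) \<partial>\<mu>) + 0
      + err_const a b * (2 * mom 3 * mom 2 / real n + (s * mom 4 * mom 2 + D / s) / 2)"
    using R1 R2 err_const_nonneg[OF a_pos b_pos] by (intro add_mono mult_left_mono) auto
  finally show ?thesis by simp
qed

end

section \<open>Vanishing information at and below the threshold\<close>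

context weight_law
begin

text \<open>The coefficient of the quadratic term that the saturation subtracts. In the denominator, \<open>2 mom 1\<close> bounds the
  possible values of \<open>c\<close> in \<open>sat_integral_le\<close>.\<close>

definition strict_gain :: "real \<Rightarrow> real" where
  "strict_gain K = (\<integral>x. x ^ 3 / (1 + K * x * mom 1) \<partial>\<mu>)"

lemma strict_gain_integrable:
  assumes K: "0 \<le> K" shows "integrable \<mu> (\<lambda>x. x ^ 3 / (1 + K * x * mom 1))"
proof (rule Bochner_Integration.integrable_bound)
  show "integrable \<mu> (\<lambda>x. x ^ 3)" using moments[of 3] by simp
  show "(\<lambda>x. x ^ 3 / (1 + K * x * mom 1)) \<in> borel_measurable \<mu>" by (intro measurable_\<mu>) measurable
  show "AE x in \<mu>. norm (x ^ 3 / (1 + K * x * mom 1)) \<le> norm (x ^ 3)" using AE_nonneg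
  proof eventually_elim
    case (elim x)
    then have p: "1 \<le> 1 + K * x * mom 1" using K mom_nonneg[of 1] by simp
    then have "x ^ 3 / (1 + K * x * mom 1) \<le> x ^ 3 / 1" using elim by (intro divide_left_mono) auto
    then show ?case using elim p by simp
  qed
qed

lemma strict_gain_pos:
  assumes K: "0 \<le> K" and ne: "\<not> (AE x in \<mu>. x = 0)"
  shows "0 < strict_gain K"
proof -
  have nn: "AE x in \<mu>. 0 \<le> x ^ 3 / (1 + K * x * mom 1)"
    using AE_nonneg by eventually_elim (use K mom_nonneg[of 1] in auto)
  have "0 \<le> strict_gain K" unfolding strict_gain_def by (rule integral_nonneg_AE[OF nn])
  moreover have "strict_gain K \<noteq> 0"
  proof
    assume "strict_gain K = 0"
    then have "AE x in \<mu>. x ^ 3 / (1 + K * x * mom 1) = 0"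
      unfolding strict_gain_def using integral_nonneg_eq_0_iff_AE[OF strict_gain_integrable[OF K] nn] by simp
    then have "AE x in \<mu>. x = 0" using AE_nonneg
    proof eventually_elim
      case (elim x)
      have "0 \<le> K * x * mom 1" using elim K mom_nonneg[of 1] by simp
      then have "1 + K * x * mom 1 \<noteq> 0" by linarith
      then show ?case using elim by simp
    qed
    then show False using ne by simp
  qed
  ultimately show ?thesis by simp
qed

lemma sat_integral_le:
  assumes K: "0 \<le> K" and c: "0 \<le> c" "c \<le> 2 * mom 1"
  shows "(\<integral>x. x * sat (K * x * c) \<partial>\<mu>) \<le> K * c * mom 2 - K\<^sup>2 / 2 * strict_gain K * c\<^sup>2"
proof -
  have m2: "integrable \<mu> (\<lambda>x. x\<^sup>2)" using moments[of 2] by simp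
  have "(\<integral>x. x * sat (K * x * c) \<partial>\<mu>) \<le> (\<integral>x. K * c * x\<^sup>2 - K\<^sup>2 / 2 * c\<^sup>2 * (x ^ 3 / (1 + K * x * mom 1)) \<partial>\<mu>)"
  proof (rule integral_mono_AE')
    show "integrable \<mu> (\<lambda>x. K * c * x\<^sup>2 - K\<^sup>2 / 2 * c\<^sup>2 * (x ^ 3 / (1 + K * x * mom 1)))"
      using m2 strict_gain_integrable[OF K] by (intro Bochner_Integration.integrable_diff integrable_mult_right)
    have *: "AE x in \<mu>. x * sat (K * x * c) \<le> K * c * x\<^sup>2 - K\<^sup>2 / 2 * c\<^sup>2 * (x ^ 3 / (1 + K * x * mom 1)) \<and> 0 \<le> x * sat (K * x * c)"
      using AE_nonneg
    proof eventually_elim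
      case (elim x)
      let ?z = "K * x * c"
      have z: "0 \<le> ?z" using K c elim by simp
      have "x * sat ?z = K * c * x\<^sup>2 - K\<^sup>2 / 2 * c\<^sup>2 * (x ^ 3 / (1 + ?z/2))"
      proof -
        have "sat ?z = ?z - ?z\<^sup>2 / 2 / (1 + ?z / 2)"
        proof -
          have "1 + ?z / 2 \<noteq> 0" using z by linarith
          moreover have "y / D = y - y\<^sup>2 / 2 / D" if "D \<noteq> 0" "D = 1 + y / 2" for y D :: real
          proof -
            have "y - y\<^sup>2 / 2 / D = (y * D - y\<^sup>2/2) / D" using that by (simp add: diff_divide_distrib)
            also have "y * D - y\<^sup>2/2 = y" unfolding that(2) by (simp add: algebra_simps power2_eq_square)
            finally show ?thesis ..
          qed
          ultimately show ?thesis unfolding sat_def by blast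
        qed
        then have "x * sat ?z = x * ?z - x * (?z\<^sup>2 / 2 / (1 + ?z / 2))" by (simp only: right_diff_distrib)
        moreover have "x * ?z = K * c * x\<^sup>2" by (simp add: power2_eq_square)
        moreover have "x * (?z\<^sup>2 / 2 / D) = K\<^sup>2 / 2 * c\<^sup>2 * (x ^ 3 / D)" for D
          by (simp add: power2_eq_square power3_eq_cube)
        ultimately show ?thesis by simp
      qed
      moreover have "x ^ 3 / (1 + K * x * mom 1) \<le> x ^ 3 / (1 + ?z / 2)"
      proof (rule divide_left_mono)
        have "K * x * c \<le> K * x * (2 * mom 1)" using K c elim by (intro mult_left_mono) auto
        then show "1 + ?z / 2 \<le> 1 + K * x * mom 1" by simp
        show "0 < (1 + K * x * mom 1) * (1 + ?z / 2)"
          using z K elim mom_nonneg[of 1] by (intro mult_pos_pos add_pos_nonneg) auto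
      qed (use elim in auto)
      then have "K\<^sup>2 / 2 * c\<^sup>2 * (x ^ 3 / (1 + K * x * mom 1)) \<le> K\<^sup>2 / 2 * c\<^sup>2 * (x ^ 3 / (1 + ?z / 2))"
        by (rule mult_left_mono) simp
      ultimately have "x * sat ?z \<le> K * c * x\<^sup>2 - K\<^sup>2 / 2 * c\<^sup>2 * (x ^ 3 / (1 + K * x * mom 1))" by linarith
      moreover have "0 \<le> x * sat ?z" using elim sat_nonneg[OF z] by (rule mult_nonneg_nonneg)
      ultimately show ?case ..
    qed
    show "AE x in \<mu>. x * sat (K * x * c) \<le> K * c * x\<^sup>2 - K\<^sup>2 / 2 * c\<^sup>2 * (x ^ 3 / (1 + K * x * mom 1))"
      "AE x in \<mu>. 0 \<le> K * c * x\<^sup>2 - K\<^sup>2 / 2 * c\<^sup>2 * (x ^ 3 / (1 + K * x * mom 1))"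
      using * by (eventually_elim, blast, eventually_elim, blast intro: order_trans)
  qed
  also have "\<dots> = K * c * mom 2 - K\<^sup>2 / 2 * c\<^sup>2 * strict_gain K"
  proof -
    have i: "integrable \<mu> (\<lambda>x. K * c * x\<^sup>2)" "integrable \<mu> (\<lambda>x. K\<^sup>2 / 2 * c\<^sup>2 * (x ^ 3 / (1 + K * x * mom 1)))"
      using m2 strict_gain_integrable[OF K] by (auto intro: integrable_mult_right simp del: times_divide_eq_right)
    show ?thesis unfolding Bochner_Integration.integral_diff[OF i] integral_mult_right_zero strict_gain_def
      by (simp only: mom_def)
  qed
  finally show ?thesis by (simp add: mult_ac)
qed

end

context weighted_two_block
begin

lemma rho_nonneg:
  assumes "finite U" "V \<subseteq> U" "T \<subseteq> V" "w \<in> V" shows "0 \<le> rho U V T w"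
  unfolding rho_def
proof (rule integral_nonneg_AE, use AE_iid_nonneg[OF assms(1)] in eventually_elim)
  case (elim \<phi>)
  then show ?case using assms finite_subset[OF assms(2,1)] by (intro mult_nonneg_nonneg vinfo_range) auto
qed

lemma rho_le_mom:
  assumes "finite U" "V \<subseteq> U" "T \<subseteq> V" "w \<in> V" shows "rho U V T w \<le> mom 1"
proof -
  have "rho U V T w \<le> (\<integral>\<phi>. \<phi> w ^ 1 \<partial>iid U)" unfolding rho_def
  proof (rule integral_mono_AE)
    show "AE \<phi> in iid U. \<phi> w * vinfo \<phi> V T w \<le> \<phi> w ^ 1" using AE_iid_nonneg[OF assms(1)]
    proof eventually_elim
      case (elim \<phi>)
      then show ?case using assms finite_subset[OF assms(2,1)] by (auto intro!: mult_left_le vinfo_range)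
    qed
  qed (use assms in \<open>auto intro!: integrable_weight_vinfo simp: component_power(1)[of w U 1, simplified]\<close>)
  also have "\<dots> = mom 1" using assms by (intro component_power(2)) auto
  finally show ?thesis .
qed

lemma rho_universe:
  assumes "finite U" "V \<subseteq> U" "w \<in> V"
  shows "rho V V T w = rho U V T w"
proof -
  have d: "distr (iid U) (iid V) (\<lambda>\<phi>. \<lambda>i\<in>V. \<phi> i) = iid V"
    unfolding iid_def using distr_PiM_reindex[of U "\<lambda>_. \<mu>" "\<lambda>x. x" V] prob_\<mu> assms by auto
  have m: "(\<lambda>\<phi>. \<lambda>i\<in>V. \<phi> i) \<in> measurable (iid U) (iid V)"
    unfolding iid_def using assms by (intro measurable_restrict measurable_component_singleton) auto
  have "rho V V T w = (\<integral>\<phi>. \<phi> w * vinfo \<phi> V T w \<partial>distr (iid U) (iid V) (\<lambda>\<phi>. \<lambda>i\<in>V. \<phi> i))"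
    unfolding rho_def d ..
  also have "\<dots> = (\<integral>\<phi>. (\<lambda>i\<in>V. \<phi> i) w * vinfo (\<lambda>i\<in>V. \<phi> i) V T w \<partial>iid U)"
    by (rule integral_distr[OF m]) (use assms in \<open>intro borel_measurable_times component_borel vinfo_measurable_iid; auto\<close>)
  also have "\<dots> = rho U V T w" unfolding rho_def
  proof (intro Bochner_Integration.integral_cong refl)
    fix \<phi> have "vinfo (\<lambda>i\<in>V. \<phi> i) V T w = vinfo \<phi> V T w" by (rule vinfo_weight_cong) simp
    then show "(\<lambda>i\<in>V. \<phi> i) w * vinfo (\<lambda>i\<in>V. \<phi> i) V T w = \<phi> w * vinfo \<phi> V T w" using assms by simp
  qed
  finally show ?thesis .
qed

text \<open>The vertices \<open>n, n + 1, \<dots>\<close> are added one after the other with their signs revealed, while the vertices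
  below \<open>n\<close> stay hidden. The information about a hidden vertex grows by at most one in total, so that on average it
  grows by at most \<open>1 / J\<close> in one of the \<open>J\<close> steps. For the vertex \<open>u\<close> added there, \<open>\<rho>\<close> is the information about \<open>u\<close>
  before its sign is revealed, and \<open>c\<close> is the average information about the vertices present before. Exchangeability bounds \<open>c\<close> by
  \<open>\<rho>\<close> up to the revealed vertices, of which there are at most \<open>\<epsilon> n\<close>.\<close>

lemma chain_step:
  fixes J :: nat and \<epsilon> s :: real
  assumes n: "2 \<le> n" and J: "1 \<le> J" "real J \<le> \<epsilon> * real n" "J \<le> n" and s: "s > 0"
  shows "\<exists>c \<rho>. 0 \<le> c \<and> c \<le> 2 * mom 1 \<and> c \<le> \<rho> + \<epsilon> * mom 1 \<and>
    (\<forall>x\<in>{1..<n}. rho {1..n} {1..n} {n} x \<le> \<rho>) \<and>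
    damping a b * \<rho> \<le> (\<integral>x. x * sat (damping a b * signal a b * x * c) \<partial>\<mu>)
      + err_const a b * (2 * mom 3 * mom 2 / real n + (s * mom 4 * mom 2 + 1 / (real J * s)) / 2)"
proof -
  define U where "U = {1..n + J}"
  define V where "V j = {1..n - 1 + j}" for j
  define T where "T j = {n..n - 1 + j}" for j
  define u where "u j = n + j" for j
  define A where "A j = (\<Sum>w\<in>{1..<n}. \<integral>\<phi>. vinfo \<phi> (V j) (T j) w \<partial>iid U)" for j
  have VS: "V (Suc j) = insert (u j) (V j)" "T (Suc j) = insert (u j) (T j)" for j
    using n by (auto simp: V_def T_def u_def)
  have finU: "finite U" by (simp add: U_def)
  have VU: "V j \<subseteq> U" if "j \<le> Suc J" for j using that n by (auto simp: V_def U_def)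
  have TV: "T j \<subseteq> V j" for j using n by (auto simp: V_def T_def)
  have VT: "V j - T j = {1..<n}" for j using n by (auto simp: V_def T_def)
  have wV: "w \<in> V j" if "w \<in> {1..<n}" for w j using that by (auto simp: V_def)
  interpret P: prob_space "iid U" by (rule prob_iid)
  have iv: "integrable (iid U) (\<lambda>\<phi>. vinfo \<phi> (V j) (T j) w)" if "j \<le> Suc J" "w \<in> {1..<n}" for j w
    using that finU VU TV wV by (intro integrable_vinfo) auto
  have A0: "0 \<le> A j" if j: "j \<le> Suc J" for j
    unfolding A_def
  proof (intro sum_nonneg integral_nonneg_AE, use AE_iid_nonneg[OF finU] in eventually_elim)
    case (elim w \<phi>)
    then show ?case using VU[OF j] TV wV finite_subset[OF VU[OF j] finU] by (intro vinfo_range) auto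
  qed
  have An: "A j \<le> real n" if j: "j \<le> Suc J" for j
  proof -
    have "A j \<le> (\<Sum>w\<in>{1..<n}. 1)" unfolding A_def
    proof (rule sum_mono)
      fix w assume w: "w \<in> {1..<n}"
      have "(\<integral>\<phi>. vinfo \<phi> (V j) (T j) w \<partial>iid U) \<le> (\<integral>\<phi>. 1 \<partial>iid U)"
      proof (rule integral_mono_AE)
        show "AE \<phi> in iid U. vinfo \<phi> (V j) (T j) w \<le> 1" using AE_iid_nonneg[OF finU]
        proof eventually_elim
          case (elim \<phi>)
          then show ?case using VU[OF j] TV w wV finite_subset[OF VU[OF j] finU] by (intro vinfo_range) auto
        qed
      qed (use iv[OF j w] in auto)
      then show "(\<integral>\<phi>. vinfo \<phi> (V j) (T j) w \<partial>iid U) \<le> 1" by (simp add: P.prob_space)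
    qed
    then show ?thesis using n by simp
  qed
  have "\<exists>j\<in>{1..J}. (A (Suc j) - A j) / real n \<le> 1 / real J"
  proof (rule ccontr)
    assume "\<not> ?thesis"
    then have gt: "1 / real J < (A (Suc j) - A j) / real n" if "j \<in> {1..J}" for j using that by force
    have "1 = (\<Sum>j\<in>{1..J}. 1 / real J)" using J by simp
    also have "\<dots> < (\<Sum>j\<in>{1..J}. (A (Suc j) - A j) / real n)" by (rule sum_strict_mono) (use J gt in auto)
    also have "\<dots> = (\<Sum>j = 1..J. A (Suc j) - A j) / real n" by (rule sum_divide_distrib[symmetric])
    also have "(\<Sum>j = 1..J. A (Suc j) - A j) = A (Suc J) - A 1" by (rule sum_Suc_diff) (use J in simp)
    also have "(A (Suc J) - A 1) / real n \<le> real n / real n" using A0[of 1] An[of "Suc J"] J by (intro divide_right_mono) auto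
    also have "\<dots> = 1" using n by simp
    finally show False by simp
  qed
  then obtain j where j: "1 \<le> j" "j \<le> J" "(A (Suc j) - A j) / real n \<le> 1 / real J" by auto
  define c where "c = (\<integral>\<phi>. (\<Sum>w\<in>V j. \<phi> w * vinfo \<phi> (V j) (T j) w) / real n \<partial>iid U)"
  define D where "D = (\<Sum>w\<in>V j - T j. \<integral>\<phi>. vinfo \<phi> (insert (u j) (V j)) (insert (u j) (T j)) w - vinfo \<phi> (V j) (T j) w \<partial>iid U) / real n"
  define \<rho> where "\<rho> = rho U (insert (u j) (V j)) (T j) (u j)"
  have uU: "u j \<in> U" "u j \<notin> V j" using j n by (auto simp: u_def U_def V_def)
  have VjU: "V j \<subseteq> U" "V (Suc j) \<subseteq> U" using VU j by auto
  have cardV: "card (V j) \<le> 2 * n" "card (V j - T j) \<le> n" using j J by (auto simp: VT) (simp add: V_def)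
  have D_le: "D \<le> 1 / real J"
  proof -
    have "D = (A (Suc j) - A j) / real n"
      unfolding D_def A_def VT VS[symmetric] sum_subtractf[symmetric]
      using j by (intro arg_cong[where f="\<lambda>x. x / real n"] sum.cong refl Bochner_Integration.integral_diff iv) auto
    then show ?thesis using j by simp
  qed
  have cont0: "0 \<le> damping a b" using damping_pos[OF a_pos b_pos] by simp
  have cav: "damping a b * \<rho> \<le> (\<integral>x. x * sat (damping a b * signal a b * x * c) \<partial>\<mu>)
    + err_const a b * (2 * mom 3 * mom 2 / real n + (s * mom 4 * mom 2 + D / s) / 2)"
    unfolding \<rho>_def c_def D_def by (rule averaged_cavity[OF finU uU(1) VjU(1) uU(2) TV cardV s])
  also have "\<dots> \<le> (\<integral>x. x * sat (damping a b * signal a b * x * c) \<partial>\<mu>)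
    + err_const a b * (2 * mom 3 * mom 2 / real n + (s * mom 4 * mom 2 + 1 / (real J * s)) / 2)"
  proof -
    have "D / s \<le> 1 / real J / s" using D_le s by (intro divide_right_mono) auto
    then have "D / s \<le> 1 / (real J * s)" by simp
    then show ?thesis using err_const_nonneg[OF a_pos b_pos]
      by (intro add_left_mono mult_left_mono divide_right_mono) auto
  qed
  finally have main: "damping a b * \<rho> \<le> \<dots>" .
  have c_rho: "c = (\<Sum>w\<in>V j. rho U (V j) (T j) w) / real n"
    unfolding c_def rho_def using finU VjU TV
    by (simp add: integrable_weight_vinfo subset_iff)
  have c0: "0 \<le> c" unfolding c_rho using finU VjU TV by (intro divide_nonneg_nonneg sum_nonneg rho_nonneg) auto
  have m1: "0 \<le> mom 1" by (rule mom_nonneg)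
  have c1: "c \<le> 2 * mom 1"
  proof -
    have "(\<Sum>w\<in>V j. rho U (V j) (T j) w) \<le> real (card (V j)) * mom 1"
      using finU VjU TV by (intro sum_bounded_above rho_le_mom) auto
    also have "\<dots> \<le> (2 * real n) * mom 1" using cardV m1 by (intro mult_right_mono) auto
    finally show ?thesis unfolding c_rho using n by (simp add: divide_le_eq mult_ac)
  qed
  have r_le: "rho U (V j) (T j) w \<le> \<rho>" if w: "w \<in> {1..<n}" for w
  proof -
    have "rho U (V j) (T j) w \<le> rho U (insert (u j) (V j)) (T j) w"
      using finU VjU TV wV[OF w] uU by (intro rho_mono) auto
    also have "\<dots> = \<rho>" unfolding \<rho>_def
      by (rule rho_swap) (use VjU uU wV[OF w] w j in \<open>auto simp: T_def u_def\<close>)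
    finally show ?thesis .
  qed
  have rho0: "0 \<le> \<rho>" unfolding \<rho>_def using finU VjU TV uU by (intro rho_nonneg) auto
  have c2: "c \<le> \<rho> + \<epsilon> * mom 1"
  proof -
    have split: "V j = {1..<n} \<union> T j" "{1..<n} \<inter> T j = {}" using VT[of j] TV[of j] by (auto simp: T_def)
    have "(\<Sum>w\<in>V j. rho U (V j) (T j) w) = (\<Sum>w\<in>{1..<n}. rho U (V j) (T j) w) + (\<Sum>w\<in>T j. rho U (V j) (T j) w)"
      by (subst split(1), rule sum.union_disjoint) (use split(2) in \<open>auto simp: T_def\<close>)
    also have "\<dots> \<le> real (card {1..<n}) * \<rho> + real (card (T j)) * mom 1"
      using finU VjU TV r_le by (intro add_mono sum_bounded_above rho_le_mom) auto
    also have "\<dots> \<le> real n * \<rho> + (\<epsilon> * real n) * mom 1"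
    proof (intro add_mono mult_right_mono rho0 m1)
      have "card (T j) = j" using n j by (simp add: T_def)
      then show "real (card (T j)) \<le> \<epsilon> * real n" using j J by simp
    qed auto
    finally have "c \<le> (real n * \<rho> + (\<epsilon> * real n) * mom 1) / real n"
      unfolding c_rho by (rule divide_right_mono) simp
    also have "\<dots> = \<rho> + \<epsilon> * mom 1" using n by (simp add: add_divide_distrib)
    finally show ?thesis .
  qed
  have tgt: "rho {1..n} {1..n} {n} x \<le> \<rho>" if x: "x \<in> {1..<n}" for x
  proof -
    have sub: "{1..n} \<subseteq> U" "{1..n} \<subseteq> V j" "{n} \<subseteq> T j" using j n by (auto simp: U_def V_def T_def)
    have "rho {1..n} {1..n} {n} x = rho U {1..n} {n} x" by (rule rho_universe[OF finU sub(1)]) (use x in auto)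
    also have "\<dots> \<le> rho U (V j) (T j) x"
      by (rule rho_mono) (use finU VjU sub TV x n in auto)
    also have "\<dots> \<le> \<rho>" by (rule r_le[OF x])
    finally show ?thesis .
  qed
  show ?thesis using c0 c1 c2 main tgt by blast
qed

text \<open>The two inequalities between \<open>c\<close> and \<open>\<rho>\<close> give \<open>\<tau> c\<^sup>2 \<le> k\<^sub>0 \<epsilon> mom 1 + E\<close>. If \<open>a = b\<close>, then \<open>\<tau> = 0\<close>, and \<open>\<rho>\<close>
  is bounded by the error \<open>E\<close> alone.\<close>

lemma pair_information_le:
  fixes J :: nat and \<epsilon> s :: real
  assumes n: "2 \<le> n" and J: "1 \<le> J" "real J \<le> \<epsilon> * real n" "J \<le> n" and s: "s > 0"
    and KS: "signal a b * mom 2 \<le> 1" and \<epsilon>: "0 \<le> \<epsilon>"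
  defines "k0 \<equiv> damping a b"
  defines "\<tau> \<equiv> (k0 * signal a b)\<^sup>2 / 2 * strict_gain (k0 * signal a b)"
  defines "E \<equiv> err_const a b * (2 * mom 3 * mom 2 / real n + (s * mom 4 * mom 2 + 1 / (real J * s)) / 2)"
  assumes pos: "signal a b = 0 \<or> 0 < \<tau>"
    and xy: "x \<in> {1..n}" "y \<in> {1..n}" "x \<noteq> y"
  shows "rho {1..n} {1..n} {y} x \<le> sqrt ((k0 * \<epsilon> * mom 1 + E) / \<tau>) + E / k0"
proof -
  have k0: "0 < k0" unfolding k0_def using damping_pos[OF a_pos b_pos] by simp
  have kap0: "0 \<le> signal a b" by (rule signal_nonneg[OF a_pos b_pos])
  obtain c \<rho> where c: "0 \<le> c" "c \<le> 2 * mom 1" "c \<le> \<rho> + \<epsilon> * mom 1"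
    and r: "\<And>x. x \<in> {1..<n} \<Longrightarrow> rho {1..n} {1..n} {n} x \<le> \<rho>"
    and cav: "k0 * \<rho> \<le> (\<integral>x. x * sat (k0 * signal a b * x * c) \<partial>\<mu>) + E"
    using chain_step[OF n J s] unfolding k0_def E_def by blast
  have E0: "0 \<le> E" unfolding E_def using err_const_nonneg[OF a_pos b_pos] mom_nonneg s by simp
  have "(\<integral>x. x * sat (k0 * signal a b * x * c) \<partial>\<mu>) \<le> k0 * signal a b * c * mom 2 - \<tau> * c\<^sup>2"
    unfolding \<tau>_def using k0 kap0 c by (intro sat_integral_le) auto
  then have 1: "k0 * \<rho> \<le> k0 * (signal a b * mom 2) * c - \<tau> * c\<^sup>2 + E" using cav by (simp add: mult_ac)
  have \<tau>0: "0 \<le> \<tau>" using pos by (auto simp: \<tau>_def)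
  have "\<rho> \<le> sqrt ((k0 * \<epsilon> * mom 1 + E) / \<tau>) + E / k0"
  proof (cases "signal a b = 0")
    case True
    then have "k0 * \<rho> \<le> E" using 1 by (simp add: \<tau>_def)
    then have "\<rho> \<le> E / k0" using k0 by (simp add: pos_le_divide_eq mult.commute)
    moreover have "0 \<le> sqrt ((k0 * \<epsilon> * mom 1 + E) / \<tau>)"
      using \<tau>0 E0 k0 \<epsilon> mom_nonneg[of 1] by simp
    ultimately show ?thesis by linarith
  next
    case False
    then have \<tau>: "0 < \<tau>" using pos by simp
    have "k0 * (signal a b * mom 2) * c \<le> k0 * 1 * c" using KS k0 c by (intro mult_right_mono mult_left_mono) auto
    then have 2: "k0 * \<rho> \<le> k0 * c - \<tau> * c\<^sup>2 + E" using 1 by simp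
    have "k0 * c \<le> k0 * (\<rho> + \<epsilon> * mom 1)" using c k0 by (intro mult_left_mono) auto
    then have "\<tau> * c\<^sup>2 \<le> k0 * \<epsilon> * mom 1 + E" using 2 by (simp add: algebra_simps)
    then have "c\<^sup>2 \<le> (k0 * \<epsilon> * mom 1 + E) / \<tau>" using \<tau> by (simp add: pos_le_divide_eq mult.commute)
    then have 3: "c \<le> sqrt ((k0 * \<epsilon> * mom 1 + E) / \<tau>)" by (rule real_le_rsqrt)
    have "k0 * \<rho> \<le> k0 * c + E" using 2 \<tau> by (smt (verit) mult_nonneg_nonneg zero_le_power2)
    then have "\<rho> \<le> c + E / k0" using k0 by (simp add: field_simps)
    with 3 show ?thesis by simp
  qed
  moreover have "rho {1..n} {1..n} {y} x \<le> \<rho>"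
  proof -
    let ?\<pi> = "Transposition.transpose y n"
    have n1: "n \<in> {1..n}" using n by auto
    have im: "?\<pi> ` {1..n} = {1..n}" using xy n1 by (intro transpose_image_eq) auto
    have "rho {1..n} {1..n} {y} x = rho {1..n} (?\<pi> ` {1..n}) (?\<pi> ` {y}) (?\<pi> x)"
      by (rule rho_permute[symmetric]) (use im xy in auto)
    also have "\<dots> = rho {1..n} {1..n} {n} (?\<pi> x)" unfolding im by simp
    also have "\<dots> \<le> \<rho>"
    proof (rule r)
      have "?\<pi> x \<in> {1..n}" using im xy by blast
      moreover have "?\<pi> x \<noteq> n" using xy(3) by (metis transpose_apply_first transpose_involutory)
      ultimately show "?\<pi> x \<in> {1..<n}" by auto
    qed
    finally show ?thesis .
  qed
  ultimately show ?thesis by linarith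
qed

end

text \<open>At or below the threshold, the graph and the spin of one vertex reveal nothing about the spin
  of another one, on average over the weights.\<close>

lemma (in weight_law) pair_information_tendsto_0:
  assumes ab: "a > 0" "b > 0" and KS: "signal a b * mom 2 \<le> 1" and ne: "\<not> (AE x in \<mu>. x = 0)" and \<delta>: "\<delta> > 0"
  shows "eventually (\<lambda>n. \<forall>x\<in>{1..n}. \<forall>y\<in>{1..n}. x \<noteq> y \<longrightarrow>
     weighted_two_block.rho a b n \<mu> {1..n} {1..n} {y} x \<le> \<delta>) sequentially"
proof -
  define k0 where "k0 = damping a b"
  define \<tau> where "\<tau> = (k0 * signal a b)\<^sup>2 / 2 * strict_gain (k0 * signal a b)"
  define C where "C = err_const a b"
  have k0: "0 < k0" unfolding k0_def using damping_pos[OF ab] by simp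
  have kap0: "0 \<le> signal a b" by (rule signal_nonneg[OF ab])
  have C0: "0 \<le> C" unfolding C_def by (rule err_const_nonneg[OF ab])
  have pos: "signal a b = 0 \<or> 0 < \<tau>"
  proof (cases "signal a b = 0")
    case False
    have "0 < strict_gain (k0 * signal a b)" using k0 kap0 by (intro strict_gain_pos ne) auto
    moreover have "0 < (k0 * signal a b)\<^sup>2 / 2" using k0 False by simp
    ultimately show ?thesis unfolding \<tau>_def by (intro disjI2 mult_pos_pos)
  qed simp
  have \<tau>0: "0 \<le> \<tau>" using pos by (auto simp: \<tau>_def)
  \<comment> \<open>the total error allowed\<close>
  have "((\<lambda>e. sqrt (2 * e / \<tau>) + e / k0) \<longlongrightarrow> sqrt (2 * 0 / \<tau>) + 0 / k0) (at_right 0)"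
    using k0 by (cases "\<tau> = 0") (auto intro!: tendsto_eq_intros)
  then have "eventually (\<lambda>e. sqrt (2 * e / \<tau>) + e / k0 < \<delta>) (at_right 0)"
    using \<delta> by (intro order_tendstoD(2)[where y="sqrt (2 * 0 / \<tau>) + 0 / k0"]) auto
  then obtain e where e: "e > 0" "sqrt (2 * e / \<tau>) + e / k0 < \<delta>"
    by (metis (mono_tags, lifting) eventually_at_right_field dense)
  define \<epsilon> where "\<epsilon> = min 1 (e / (k0 * mom 1 + 1))"
  define s where "s = e / (C * mom 4 * mom 2 + 1)"
  have m: "0 \<le> mom k" for k by (rule mom_nonneg)
  have den: "0 < k0 * mom 1 + 1" "0 < C * mom 4 * mom 2 + 1" using k0 C0 m by (auto intro!: add_nonneg_pos)
  have \<epsilon>: "0 < \<epsilon>" "\<epsilon> \<le> 1" "k0 * \<epsilon> * mom 1 \<le> e"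
  proof -
    show "0 < \<epsilon>" "\<epsilon> \<le> 1" using e den by (auto simp: \<epsilon>_def)
    have "k0 * \<epsilon> * mom 1 \<le> \<epsilon> * (k0 * mom 1 + 1)" using \<open>0 < \<epsilon>\<close> by (simp add: algebra_simps)
    also have "\<dots> \<le> e / (k0 * mom 1 + 1) * (k0 * mom 1 + 1)" using den by (intro mult_right_mono) (auto simp: \<epsilon>_def)
    finally show "k0 * \<epsilon> * mom 1 \<le> e" using den by simp
  qed
  have s: "0 < s" "C * (s * mom 4 * mom 2) \<le> e"
  proof -
    show "0 < s" using e den by (simp add: s_def)
    have "C * (s * mom 4 * mom 2) \<le> s * (C * mom 4 * mom 2 + 1)" using \<open>0 < s\<close> by (simp add: algebra_simps)
    also have "\<dots> = e" using den by (simp add: s_def)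
    finally show "C * (s * mom 4 * mom 2) \<le> e" .
  qed
  define J where "J n = nat \<lfloor>\<epsilon> * real n\<rfloor>" for n
  have lin: "filterlim (\<lambda>n. \<epsilon> * real n) at_top sequentially"
    using \<epsilon> by (intro filterlim_tendsto_pos_mult_at_top[OF tendsto_const] filterlim_real_sequentially) auto
  have "filterlim (\<lambda>n. real (J n)) at_top sequentially"
  proof (rule filterlim_at_top_mono)
    show "filterlim (\<lambda>n. - 1 + \<epsilon> * real n) at_top sequentially"
      by (rule filterlim_tendsto_add_at_top[OF tendsto_const lin])
    show "\<forall>\<^sub>F n in sequentially. - 1 + \<epsilon> * real n \<le> real (J n)"
      unfolding J_def by (intro always_eventually allI) linarith
  qed
  note Jtop = this
  have lim1: "(\<lambda>n. C * (2 * mom 3 * mom 2) / real n) \<longlonglongrightarrow> 0"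
    by (rule real_tendsto_divide_at_top[OF tendsto_const filterlim_real_sequentially])
  have lim2: "(\<lambda>n. (C / (2 * s)) / real (J n)) \<longlonglongrightarrow> 0"
    by (rule real_tendsto_divide_at_top[OF tendsto_const Jtop])
  have "eventually (\<lambda>n. C * (2 * mom 3 * mom 2) / real n < e / 4) sequentially"
    "eventually (\<lambda>n. (C / (2 * s)) / real (J n) < e / 4) sequentially"
    "eventually (\<lambda>n. 1 \<le> real (J n)) sequentially"
    using order_tendstoD(2)[OF lim1, of "e/4"] order_tendstoD(2)[OF lim2, of "e/4"] e
      Jtop[unfolded filterlim_at_top, rule_format, of 1] by simp_all
  moreover have "eventually (\<lambda>n. 2 \<le> n) sequentially" by (rule eventually_ge_at_top)
  ultimately show ?thesis
  proof eventually_elim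
    case (elim n)
    interpret weighted_two_block a b n \<mu> by unfold_locales (use ab elim in auto)
    define E where "E = C * (2 * mom 3 * mom 2 / real n + (s * mom 4 * mom 2 + 1 / (real (J n) * s)) / 2)"
    have "E = C * (2 * mom 3 * mom 2) / real n + C * (s * mom 4 * mom 2) / 2 + (C / (2 * s)) / real (J n)"
      by (simp add: E_def algebra_simps add_divide_distrib)
    then have Ee: "E \<le> e" using elim s e by simp
    have JJ: "real (J n) \<le> \<epsilon> * real n" "J n \<le> n"
    proof -
      show "real (J n) \<le> \<epsilon> * real n" unfolding J_def using \<epsilon> by simp
      also have "\<dots> \<le> 1 * real n" using \<epsilon> by (intro mult_right_mono) auto
      finally show "J n \<le> n" by simp
    qed
    show ?case
    proof (intro ballI impI)
      fix x y assume xy: "x \<in> {1..n}" "y \<in> {1..n}" "x \<noteq> y"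
      have "rho {1..n} {1..n} {y} x \<le> sqrt ((k0 * \<epsilon> * mom 1 + E) / \<tau>) + E / k0"
        unfolding k0_def \<tau>_def E_def C_def
        by (rule pair_information_le[OF _ _ JJ s(1) KS _ _ xy])
          (use elim \<epsilon> pos in \<open>auto simp: k0_def \<tau>_def\<close>)
      also have "\<dots> \<le> sqrt (2 * e / \<tau>) + e / k0"
        using Ee \<epsilon> \<tau>0 k0 by (intro add_mono real_sqrt_le_mono divide_right_mono) auto
      finally show "rho {1..n} {1..n} {y} x \<le> \<delta>" using e by linarith
    qed
  qed
qed

section \<open>From many communities to two\<close>

lemma (in finite_weights) sum_abs_fibres_le:
  assumes "wexp (\<lambda>_. 1) = 1" "finite K" "Z ` \<Omega> \<subseteq> K"
  shows "(\<Sum>z\<in>K. \<bar>wexp (\<lambda>\<omega>. of_bool (Z \<omega> = z) * F \<omega>)\<bar>) \<le> sqrt (info Z F)"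
proof -
  have d: "determines Z (\<lambda>\<omega>. of_bool (Z \<omega> = z) :: real)" for z
    by (rule determinesI) simp
  have "(\<Sum>z\<in>K. \<bar>wexp (\<lambda>\<omega>. of_bool (Z \<omega> = z) * F \<omega>)\<bar>) = (\<Sum>z\<in>K. \<bar>wexp (\<lambda>\<omega>. of_bool (Z \<omega> = z) * cexp Z F \<omega>)\<bar>)"
    by (simp only: tower[OF d])
  also have "\<dots> \<le> (\<Sum>z\<in>K. wexp (\<lambda>\<omega>. \<bar>of_bool (Z \<omega> = z) * cexp Z F \<omega>\<bar>))"
    by (intro sum_mono wexp_abs)
  also have "\<dots> = wexp (\<lambda>\<omega>. \<Sum>z\<in>K. \<bar>of_bool (Z \<omega> = z) * cexp Z F \<omega>\<bar>)" by (rule wexp_sum[symmetric])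
  also have "\<dots> = wexp (\<lambda>\<omega>. \<bar>cexp Z F \<omega>\<bar>)"
  proof (rule wexp_cong)
    fix \<omega> assume "\<omega> \<in> \<Omega>"
    then have "Z \<omega> \<in> K" using assms by auto
    then show "(\<Sum>z\<in>K. \<bar>of_bool (Z \<omega> = z) * cexp Z F \<omega>\<bar>) = \<bar>cexp Z F \<omega>\<bar>"
      using assms(2) by (subst sum.remove[of K "Z \<omega>"]) (auto intro!: sum.neutral)
  qed
  also have "\<dots> \<le> sqrt (info Z F)" unfolding info_def by (rule wexp_cauchy_schwarz[OF assms(1)])
  finally show ?thesis .
qed

text \<open>The sum over all observations of the absolute covariances with the sign of \<open>i\<close>, bounded by the
  information about this sign.\<close>

lemma (in two_block_graph) sum_abs_spin_le:
  assumes ij: "i \<in> U" "j \<in> U"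
  shows "(\<Sum>z\<in>Pow {j}. \<Sum>g\<in>Pow (pairs U). \<bar>\<Sum>x\<in>Pow U. world_weight a b n \<phi> U (pairs U) (x, g) *
      (of_bool (x \<inter> {j} = z) * spin i (x, g))\<bar>) \<le> sqrt (vinfo \<phi> U {j} i)"
proof -
  let ?ww = "world_weight a b n \<phi> U (pairs U)"
  have K: "obs U {j} ` worlds U (pairs U) \<subseteq> Pow {j} \<times> Pow (pairs U)"
  proof
    fix z assume "z \<in> obs U {j} ` worlds U (pairs U)"
    then obtain x g where z: "z = obs U {j} (x, g)" "g \<subseteq> pairs U" by (auto simp: worlds_def)
    then show "z \<in> Pow {j} \<times> Pow (pairs U)" by (auto simp: obs_def)
  qed
  have 1: "wexp (\<lambda>\<omega>. of_bool (obs U {j} \<omega> = (z, g)) * spin i \<omega>) =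
      (\<Sum>x\<in>Pow U. ?ww (x, g) * (of_bool (x \<inter> {j} = z) * spin i (x, g)))" if g: "g \<in> Pow (pairs U)" for z g
  proof -
    have o: "obs U {j} (x, g') = (z, g) \<longleftrightarrow> x \<inter> {j} = z \<and> g' = g" if "g' \<in> Pow (pairs U)" for x g'
    proof -
      have "g' \<inter> Pow U = g'" using that by (auto simp: pairs_def)
      then show ?thesis by (simp add: obs_def)
    qed
    have "wexp (\<lambda>\<omega>. of_bool (obs U {j} \<omega> = (z, g)) * spin i \<omega>) =
       (\<Sum>x\<in>Pow U. \<Sum>g'\<in>Pow (pairs U). ?ww (x, g') * (of_bool (x \<inter> {j} = z \<and> g' = g) * spin i (x, g')))"
      unfolding wexp_ev ev_def by (intro sum.cong refl) (simp only: o)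
    also have "\<dots> = (\<Sum>x\<in>Pow U. ?ww (x, g) * (of_bool (x \<inter> {j} = z) * spin i (x, g)))"
    proof (rule sum.cong[OF refl])
      fix x
      show "(\<Sum>g'\<in>Pow (pairs U). ?ww (x, g') * (of_bool (x \<inter> {j} = z \<and> g' = g) * spin i (x, g'))) =
         ?ww (x, g) * (of_bool (x \<inter> {j} = z) * spin i (x, g))"
        using g finite_pairs[OF finite_U]
        by (subst sum.remove[of _ g]) (auto intro!: sum.neutral)
    qed
    finally show ?thesis .
  qed
  have "(\<Sum>z\<in>Pow {j}. \<Sum>g\<in>Pow (pairs U). \<bar>\<Sum>x\<in>Pow U. ?ww (x, g) * (of_bool (x \<inter> {j} = z) * spin i (x, g))\<bar>)
     = (\<Sum>z\<in>Pow {j}. \<Sum>g\<in>Pow (pairs U). \<bar>wexp (\<lambda>\<omega>. of_bool (obs U {j} \<omega> = (z, g)) * spin i \<omega>)\<bar>)"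
    by (intro sum.cong refl) (simp only: 1)
  also have "\<dots> = (\<Sum>zg\<in>Pow {j} \<times> Pow (pairs U). \<bar>wexp (\<lambda>\<omega>. of_bool (obs U {j} \<omega> = zg) * spin i \<omega>)\<bar>)"
    by (simp add: sum.cartesian_product)
  also have "\<dots> \<le> sqrt (info (obs U {j}) (spin i))"
    by (rule sum_abs_fibres_le[OF wexp_one _ K]) (use finite_pairs[OF finite_U] in auto)
  also have "info (obs U {j}) (spin i) = vinfo \<phi> U {j} i" by (rule info_eq_vinfo) (use ij in auto)
  finally show ?thesis .
qed

lemma graphs_eq: "graphs n = Pow (pairs {1..n})"
proof -
  have "{{i, j} | i j. i \<in> {1..n} \<and> j \<in> {1..n} \<and> i \<noteq> j} = pairs {1..n}"
    by (fastforce simp: pairs_def card_2_iff)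
  then show ?thesis by (simp add: graphs_def)
qed

text \<open>The edge probability of the model with \<open>q\<close> communities as a function of the unordered pair \<open>e\<close>; the
  spins \<open>\<tau>\<close> agree on \<open>e\<close> if their image is a singleton.\<close>

definition spin_edge_prob :: "real \<Rightarrow> real \<Rightarrow> nat \<Rightarrow> (nat \<Rightarrow> nat) \<Rightarrow> (nat \<Rightarrow> real) \<Rightarrow> nat set \<Rightarrow> real" where
  "spin_edge_prob a b n \<tau> \<phi> e = min 1 ((if card (\<tau> ` e) = 1 then a else b) * (\<Prod>i\<in>e. \<phi> i) / real n)"

lemma graph_prob_pairs:
  "graph_prob a b n \<tau> \<phi> E = (\<Prod>e\<in>pairs {1..n}. if e \<in> E then spin_edge_prob a b n \<tau> \<phi> e else 1 - spin_edge_prob a b n \<tau> \<phi> e)"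
proof -
  have inj: "inj_on (\<lambda>(i, j). {i, j}) (vert_pairs n)"
    by (auto simp: inj_on_def vert_pairs_def doubleton_eq_iff)
  have im: "(\<lambda>(i, j). {i, j}) ` vert_pairs n = pairs {1..n}"
  proof (intro equalityI subsetI)
    fix e assume "e \<in> pairs {1..n}"
    then obtain i j where ij: "e = {i, j}" "i \<noteq> j" "i \<in> {1..n}" "j \<in> {1..n}" by (auto simp: pairs_def card_2_iff)
    show "e \<in> (\<lambda>(i, j). {i, j}) ` vert_pairs n"
    proof (cases "i < j")
      case True then show ?thesis using ij by (intro image_eqI[of _ _ "(i, j)"]) (auto simp: vert_pairs_def)
    next
      case False then show ?thesis using ij by (intro image_eqI[of _ _ "(j, i)"]) (auto simp: vert_pairs_def)
    qed
  qed (auto simp: vert_pairs_def pairs_def)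
  have ep: "edge_prob a b n \<tau> \<phi> i j = spin_edge_prob a b n \<tau> \<phi> {i, j}" if "i \<noteq> j" for i j
    using that by (simp add: edge_prob_def spin_edge_prob_def mult_ac)
  have "graph_prob a b n \<tau> \<phi> E = (\<Prod>p\<in>vert_pairs n. (\<lambda>e. if e \<in> E then spin_edge_prob a b n \<tau> \<phi> e else 1 - spin_edge_prob a b n \<tau> \<phi> e) ((\<lambda>(i, j). {i, j}) p))"
    unfolding graph_prob_def
  proof (intro prod.cong refl)
    fix p assume "p \<in> vert_pairs n"
    then obtain i j where p: "p = (i, j)" "i \<noteq> j" by (auto simp: vert_pairs_def)
    show "(case p of (i, j) \<Rightarrow> if {i, j} \<in> E then edge_prob a b n \<tau> \<phi> i j else 1 - edge_prob a b n \<tau> \<phi> i j) =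
      (if (case p of (i, j) \<Rightarrow> {i, j}) \<in> E then spin_edge_prob a b n \<tau> \<phi> (case p of (i, j) \<Rightarrow> {i, j})
       else 1 - spin_edge_prob a b n \<tau> \<phi> (case p of (i, j) \<Rightarrow> {i, j}))"
      unfolding p prod.case ep[OF p(2)] ..
  qed
  also have "\<dots> = (\<Prod>e\<in>pairs {1..n}. if e \<in> E then spin_edge_prob a b n \<tau> \<phi> e else 1 - spin_edge_prob a b n \<tau> \<phi> e)"
    unfolding im[symmetric] by (rule prod.reindex_cong[OF inj, symmetric]) auto
  finally show ?thesis .
qed

lemma graph_prob_measurable:
  "(\<lambda>\<psi>. graph_prob a b n \<tau> \<psi> E) \<in> borel_measurable (\<Pi>\<^sub>M w\<in>{1..n}. (borel :: real measure))"
  unfolding graph_prob_pairs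
proof (rule borel_measurable_prod)
  fix e assume e: "e \<in> pairs {1..n}"
  have "(\<lambda>\<phi>. \<Prod>i\<in>e. \<phi> i) \<in> borel_measurable (\<Pi>\<^sub>M w\<in>{1..n}. (borel :: real measure))"
    using e by (intro borel_measurable_prod) (auto intro!: measurable_component_singleton simp: pairs_def)
  then have "(\<lambda>\<phi>. spin_edge_prob a b n \<tau> \<phi> e) \<in> borel_measurable (\<Pi>\<^sub>M w\<in>{1..n}. (borel :: real measure))"
    unfolding spin_edge_prob_def
    by (intro borel_measurable_min borel_measurable_divide borel_measurable_times borel_measurable_const)
  then show "(\<lambda>\<phi>. if e \<in> E then spin_edge_prob a b n \<tau> \<phi> e else 1 - spin_edge_prob a b n \<tau> \<phi> e) \<in> borel_measurable (\<Pi>\<^sub>M w\<in>{1..n}. (borel :: real measure))"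
    by (cases "e \<in> E") auto
qed

text \<open>Two communities \<open>s\<close>, \<open>s'\<close> are singled out. The coarse spins \<open>c\<close> say who belongs to one of the two,
  and there the set \<open>x\<close> says to which.\<close>

definition refine :: "nat \<Rightarrow> nat \<Rightarrow> nat set \<Rightarrow> (nat \<Rightarrow> nat) \<Rightarrow> nat set \<Rightarrow> nat \<Rightarrow> nat" where
  "refine s s' V c x = (\<lambda>w\<in>V. if c w \<in> {s, s'} then (if w \<in> x then s else s') else c w)"

text \<open>A uniform spin configuration can be generated by coarse spins and independent signs. Swapping \<open>s\<close>
  and \<open>s'\<close> outside of an arbitrary set \<open>x\<close> is a bijection of the configurations, hence the sum is
  unchanged on average over \<open>x\<close>; it remains to shift \<open>x\<close> by the set of the vertices with spin \<open>s'\<close>.\<close>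

lemma sum_refine:
  fixes F :: "(nat \<Rightarrow> nat) \<Rightarrow> real"
  assumes V: "finite V" and s: "s \<in> Q" "s' \<in> Q" "s \<noteq> s'" and Q: "finite Q"
  shows "(\<Sum>\<tau>\<in>V \<rightarrow>\<^sub>E Q. F \<tau>) = (\<Sum>c\<in>V \<rightarrow>\<^sub>E Q. (1/2) ^ card V * (\<Sum>x\<in>Pow V. F (refine s s' V c x)))"
proof -
  let ?sw = "Transposition.transpose s s'"
  define sw where "sw x c = (\<lambda>w\<in>V. if w \<in> x then c w else ?sw (c w))" for x c
  have swE: "sw x c \<in> V \<rightarrow>\<^sub>E Q" if "c \<in> V \<rightarrow>\<^sub>E Q" for x c
    using that s by (auto simp: sw_def PiE_iff Transposition.transpose_def)
  have sw_sw: "sw x (sw x c) = c" if "c \<in> V \<rightarrow>\<^sub>E Q" for x c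
    using that by (auto simp: sw_def PiE_iff extensional_def restrict_def fun_eq_iff)
  have 1: "(\<Sum>\<tau>\<in>V \<rightarrow>\<^sub>E Q. F \<tau>) = (\<Sum>c\<in>V \<rightarrow>\<^sub>E Q. F (sw x c))" for x
    by (rule sum.reindex_bij_witness[of _ "sw x" "sw x"]) (auto simp: swE sw_sw)
  define D where "D c = {w \<in> V. c w = s'}" for c :: "nat \<Rightarrow> nat"
  have ref: "refine s s' V c (sym_diff x (D c)) = sw x c" if "c \<in> V \<rightarrow>\<^sub>E Q" for c x
    using s(3) by (auto simp: refine_def sw_def D_def fun_eq_iff Transposition.transpose_def restrict_def)
  have 2: "(\<Sum>x\<in>Pow V. F (refine s s' V c x)) = (\<Sum>x\<in>Pow V. F (sw x c))" if c: "c \<in> V \<rightarrow>\<^sub>E Q" for c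
  proof (rule sum.reindex_bij_witness[of _ "\<lambda>x. sym_diff x (D c)" "\<lambda>x. sym_diff x (D c)"])
    fix x
    have inv: "sym_diff (sym_diff x (D c)) (D c) = x" by auto
    then show "sym_diff (sym_diff x (D c)) (D c) = x" "sym_diff (sym_diff x (D c)) (D c) = x" by auto
    show "F (sw (sym_diff x (D c)) c) = F (refine s s' V c x)" unfolding ref[OF c, symmetric] inv ..
  qed (auto simp: D_def)
  have "(\<Sum>c\<in>V \<rightarrow>\<^sub>E Q. (1/2) ^ card V * (\<Sum>x\<in>Pow V. F (refine s s' V c x))) =
     (1/2) ^ card V * (\<Sum>c\<in>V \<rightarrow>\<^sub>E Q. \<Sum>x\<in>Pow V. F (sw x c))"
  proof -
    have "(\<Sum>c\<in>V \<rightarrow>\<^sub>E Q. (1/2) ^ card V * (\<Sum>x\<in>Pow V. F (refine s s' V c x))) =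
        (\<Sum>c\<in>V \<rightarrow>\<^sub>E Q. (1/2) ^ card V * (\<Sum>x\<in>Pow V. F (sw x c)))"
      by (rule sum.cong[OF refl]) (simp only: 2)
    then show ?thesis by (simp only: sum_distrib_left[symmetric])
  qed
  also have "\<dots> = (1/2) ^ card V * (\<Sum>x\<in>Pow V. \<Sum>c\<in>V \<rightarrow>\<^sub>E Q. F (sw x c))" by (subst sum.swap) (rule refl)
  also have "\<dots> = (1/2) ^ card V * (\<Sum>x\<in>Pow V. \<Sum>\<tau>\<in>V \<rightarrow>\<^sub>E Q. F \<tau>)" by (simp only: 1[symmetric])
  also have "\<dots> = (\<Sum>\<tau>\<in>V \<rightarrow>\<^sub>E Q. F \<tau>)" using V by (simp add: card_Pow power_one_over)
  finally show ?thesis ..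
qed

text \<open>The weights after dropping all vertices outside the communities \<open>s\<close> and \<open>s'\<close>.\<close>

definition thin :: "nat \<Rightarrow> nat \<Rightarrow> nat set \<Rightarrow> (nat \<Rightarrow> real) \<Rightarrow> (nat \<Rightarrow> nat) \<Rightarrow> nat \<Rightarrow> real" where
  "thin s s' V \<phi> c = (\<lambda>w\<in>V. if c w \<in> {s, s'} then \<phi> w else 0)"

lemma sum_Pow_irrelevant:
  fixes f :: "'c set \<Rightarrow> real" and r :: "'c \<Rightarrow> real"
  assumes "finite A" "finite B" "A \<inter> B = {}"
  shows "(\<Sum>E\<in>Pow (A \<union> B). f (E \<inter> A) * (\<Prod>e\<in>B. if e \<in> E then r e else 1 - r e)) = (\<Sum>g\<in>Pow A. f g)"
  using assms(2,3)
proof (induction B)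
  case empty
  show ?case by (simp, intro sum.cong refl) (auto simp: Int_absorb2)
next
  case (insert e B)
  have fin: "finite (A \<union> B)" "e \<notin> A \<union> B" using assms insert by auto
  have "(\<Sum>E\<in>Pow (A \<union> insert e B). f (E \<inter> A) * (\<Prod>c\<in>insert e B. if c \<in> E then r c else 1 - r c)) =
    (\<Sum>E\<in>Pow (insert e (A \<union> B)). f (E \<inter> A) * (\<Prod>c\<in>insert e B. if c \<in> E then r c else 1 - r c))" by simp
  also have "\<dots> = (\<Sum>E\<in>Pow (A \<union> B). f (insert e E \<inter> A) * (\<Prod>c\<in>insert e B. if c \<in> insert e E then r c else 1 - r c) +
      f (E \<inter> A) * (\<Prod>c\<in>insert e B. if c \<in> E then r c else 1 - r c))"
    by (rule sum_Pow_insert[OF fin])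
  also have "\<dots> = (\<Sum>E\<in>Pow (A \<union> B). f (E \<inter> A) * (\<Prod>c\<in>B. if c \<in> E then r c else 1 - r c))"
  proof (rule sum.cong[OF refl])
    fix E assume E: "E \<in> Pow (A \<union> B)"
    have 1: "insert e E \<inter> A = E \<inter> A" "e \<notin> E" using fin E by auto
    have 2: "(\<Prod>c\<in>B. if c \<in> insert e E then r c else 1 - r c) = (\<Prod>c\<in>B. if c \<in> E then r c else 1 - r c)"
      using insert.hyps by (intro prod.cong) auto
    have p1: "(\<Prod>c\<in>insert e B. if c \<in> insert e E then r c else 1 - r c) = r e * (\<Prod>c\<in>B. if c \<in> E then r c else 1 - r c)"
      unfolding prod.insert[OF insert.hyps] 2 by simp
    have p2: "(\<Prod>c\<in>insert e B. if c \<in> E then r c else 1 - r c) = (1 - r e) * (\<Prod>c\<in>B. if c \<in> E then r c else 1 - r c)"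
      unfolding prod.insert[OF insert.hyps] using 1 by simp
    show "f (insert e E \<inter> A) * (\<Prod>c\<in>insert e B. if c \<in> insert e E then r c else 1 - r c) +
      f (E \<inter> A) * (\<Prod>c\<in>insert e B. if c \<in> E then r c else 1 - r c) = f (E \<inter> A) * (\<Prod>c\<in>B. if c \<in> E then r c else 1 - r c)"
      unfolding 1(1) p1 p2 by (simp add: algebra_simps)
  qed
  also have "\<dots> = (\<Sum>g\<in>Pow A. f g)" using insert by auto
  finally show ?case .
qed

context two_block
begin

lemma spin_edge_prob_range:
  assumes "\<And>i. i \<in> e \<Longrightarrow> 0 \<le> \<phi> i"
  shows "0 \<le> spin_edge_prob a b n \<tau> \<phi> e" "spin_edge_prob a b n \<tau> \<phi> e \<le> 1"
  using assms a_pos b_pos by (auto simp: spin_edge_prob_def intro!: mult_nonneg_nonneg divide_nonneg_nonneg prod_nonneg)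

lemma graph_prob_range:
  assumes "\<forall>w\<in>{1..n}. 0 \<le> \<phi> w"
  shows "0 \<le> graph_prob a b n \<tau> \<phi> E" "graph_prob a b n \<tau> \<phi> E \<le> 1"
proof -
  have "0 \<le> spin_edge_prob a b n \<tau> \<phi> e \<and> spin_edge_prob a b n \<tau> \<phi> e \<le> 1" if "e \<in> pairs {1..n}" for e
    using assms that by (intro conjI spin_edge_prob_range) (auto simp: pairs_def)
  then show "0 \<le> graph_prob a b n \<tau> \<phi> E" "graph_prob a b n \<tau> \<phi> E \<le> 1"
    unfolding graph_prob_pairs by (auto intro!: prod_nonneg prod_le_1)
qed

text \<open>For fixed coarse spins \<open>c\<close>, the edges that leave the class \<open>S\<close> of \<open>s\<close> and \<open>s'\<close> do not depend on the signs
  and sum out. Inside \<open>S\<close> the model is the one with two communities and thinned weights. Instead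
  of the spin of \<open>j\<close>, whether \<open>j\<close> belongs to \<open>x\<close> is observed, which determines it.\<close>

lemma refined_difference:
  fixes c :: "nat \<Rightarrow> nat" and i j :: nat
  assumes c: "c \<in> {1..n} \<rightarrow>\<^sub>E Q" and Q: "finite Q" and s: "s \<noteq> s'" and ij: "i \<in> {1..n}" "j \<in> {1..n}"
    and \<phi>: "\<And>i. i \<in> {1..n} \<Longrightarrow> 0 \<le> \<phi> i"
  defines "V \<equiv> {1..n}"
  defines "\<rho> \<equiv> refine s s' V c"
  shows "(\<Sum>t\<in>Q. \<Sum>E\<in>Pow (pairs V). \<bar>(1/2) ^ card V * (\<Sum>x\<in>Pow V.
      (of_bool (\<rho> x i = s) - of_bool (\<rho> x i = s')) * of_bool (\<rho> x j = t) * graph_prob a b n (\<rho> x) \<phi> E)\<bar>)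
    \<le> of_bool (c i \<in> {s, s'}) * sqrt (vinfo (thin s s' V \<phi> c) V {j} i)"
proof (cases "c i \<in> {s, s'}")
  case False
  then have "\<rho> x i = c i" "c i \<noteq> s" "c i \<noteq> s'" for x using ij by (auto simp: \<rho>_def refine_def V_def)
  then show ?thesis using False by simp
next
  case True
  let ?\<phi> = "thin s s' V \<phi> c"
  interpret G: two_block_graph a b n ?\<phi> V
    by unfold_locales (use \<phi> in \<open>auto simp: V_def thin_def\<close>)
  let ?ww = "world_weight a b n ?\<phi> V (pairs V)"
  define S where "S = {w \<in> V. c w \<in> {s, s'}}"
  define A where "A = pairs S"
  define B where "B = pairs V - pairs S"
  have SV: "S \<subseteq> V" "finite V" by (auto simp: S_def V_def)
  have AB: "finite A" "finite B" "A \<inter> B = {}" "A \<union> B = pairs V"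
    using pairs_mono[OF SV(1)] finite_pairs[OF SV(2)] finite_subset[OF pairs_mono[OF SV(1)]] by (auto simp: A_def B_def)
  define r where "r e = spin_edge_prob a b n c \<phi> e" for e
  have inS: "\<rho> x w = (if w \<in> x then s else s')" if "w \<in> S" for x w using that by (auto simp: \<rho>_def refine_def S_def)
  have notS: "\<rho> x w = c w" "c w \<noteq> s" "c w \<noteq> s'" if "w \<in> V" "w \<notin> S" for x w using that by (auto simp: \<rho>_def refine_def S_def)
  have edgeA: "spin_edge_prob a b n (\<rho> x) \<phi> e = eprob a b n ?\<phi> x e" if e: "e \<in> A" for e x
  proof -
    obtain k l where kl: "e = {k, l}" "k \<noteq> l" "k \<in> S" "l \<in> S" using e by (auto simp: A_def pairs_def card_2_iff)
    have "card (\<rho> x ` e) = 1 \<longleftrightarrow> e \<subseteq> x \<or> e \<inter> x = {}"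
      using kl s by (auto simp: inS card_insert_if)
    moreover have "(\<Prod>i\<in>e. \<phi> i) = (\<Prod>i\<in>e. ?\<phi> i)"
      using kl by (intro prod.cong) (auto simp: thin_def S_def)
    ultimately show ?thesis by (simp add: spin_edge_prob_def eprob_def)
  qed
  have edgeB: "spin_edge_prob a b n (\<rho> x) \<phi> e = r e" if e: "e \<in> B" for e x
  proof -
    obtain k l where kl: "e = {k, l}" "k \<noteq> l" "k \<in> V" "l \<in> V" "k \<notin> S"
    proof -
      obtain k l where kl: "e = {k, l}" "k \<noteq> l" "k \<in> V" "l \<in> V" using e by (auto simp: B_def pairs_def card_2_iff)
      then have "k \<notin> S \<or> l \<notin> S" using e by (auto simp: B_def pairs_def)
      then show thesis using that[of k l] that[of l k] kl by (auto simp: insert_commute)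
    qed
    have "\<rho> x k = \<rho> x l \<longleftrightarrow> c k = c l"
    proof (cases "l \<in> S")
      case True
      then have "c l \<in> {s, s'}" "\<rho> x l \<in> {s, s'}" using inS by (auto simp: S_def)
      then show ?thesis using notS[of k] kl by auto
    next
      case False then show ?thesis using notS kl by auto
    qed
    then have "card (\<rho> x ` e) = card (c ` e)" using kl by (auto simp: card_insert_if)
    then show ?thesis by (simp add: r_def spin_edge_prob_def)
  qed
  have r01: "0 \<le> r e" "r e \<le> 1" if "e \<in> B" for e
    unfolding r_def using that \<phi> by (auto intro!: spin_edge_prob_range simp: B_def pairs_def V_def)
  define bA where "bA x g = (\<Prod>e\<in>A. if e \<in> g then eprob a b n ?\<phi> x e else 1 - eprob a b n ?\<phi> x e)" for x g
  define bB where "bB E = (\<Prod>e\<in>B. if e \<in> E then r e else 1 - r e)" for E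
  have bB0: "0 \<le> bB E" for E unfolding bB_def using r01 by (intro prod_nonneg) auto
  have gp: "graph_prob a b n (\<rho> x) \<phi> E = bA x (E \<inter> A) * bB E" for x E
  proof -
    have "graph_prob a b n (\<rho> x) \<phi> E = (\<Prod>e\<in>A \<union> B. if e \<in> E then spin_edge_prob a b n (\<rho> x) \<phi> e else 1 - spin_edge_prob a b n (\<rho> x) \<phi> e)"
      unfolding graph_prob_pairs AB(4) V_def ..
    also have "\<dots> = (\<Prod>e\<in>A. if e \<in> E then spin_edge_prob a b n (\<rho> x) \<phi> e else 1 - spin_edge_prob a b n (\<rho> x) \<phi> e) *
       (\<Prod>e\<in>B. if e \<in> E then spin_edge_prob a b n (\<rho> x) \<phi> e else 1 - spin_edge_prob a b n (\<rho> x) \<phi> e)"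
      by (rule prod.union_disjoint[OF AB(1-3)])
    also have "\<dots> = bA x (E \<inter> A) * bB E"
      unfolding bA_def bB_def by (intro arg_cong2[where f="(*)"] prod.cong refl) (auto simp: edgeA edgeB)
    finally show ?thesis .
  qed
  have ww: "?ww (x, g) = (1/2) ^ card V * bA x g" if g: "g \<in> Pow A" for x g
  proof -
    have "(\<Prod>e\<in>B. if e \<in> g then eprob a b n ?\<phi> x e else 1 - eprob a b n ?\<phi> x e) = 1"
    proof (rule prod.neutral, rule ballI)
      fix e assume e: "e \<in> B"
      then have "e \<notin> g" using g AB(3) by auto
      moreover have "(\<Prod>i\<in>e. ?\<phi> i) = 0"
      proof -
        obtain k where "k \<in> e" "k \<in> V" "k \<notin> S" using e by (auto simp: B_def pairs_def)
        moreover have "finite e" using e by (auto simp: B_def pairs_def intro: card_ge_0_finite)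
        ultimately show ?thesis by (intro prod_zero) (auto simp: thin_def S_def intro!: bexI[of _ k])
      qed
      ultimately show "(if e \<in> g then eprob a b n ?\<phi> x e else 1 - eprob a b n ?\<phi> x e) = 1"
        by (simp add: eprob_def)
    qed
    then show ?thesis unfolding world_weight_pair AB(4)[symmetric] prod.union_disjoint[OF AB(1-3)] bA_def by simp
  qed
  have sp: "of_bool (\<rho> x i = s) - of_bool (\<rho> x i = s') = spin i (x, g)" for x and g :: "nat set set"
    using True ij s inS[of i x] by (auto simp: spin_def S_def V_def)
  define a0 where "a0 t g x = spin i (x, g) * of_bool (\<rho> x j = t) * bA x g" for t x and g :: "nat set set"
  have spg: "spin i (x, g) = spin i (x, {})" for x and g :: "nat set set" by (simp add: spin_def)
  have "(\<Sum>t\<in>Q. \<Sum>E\<in>Pow (pairs V). \<bar>(1/2) ^ card V * (\<Sum>x\<in>Pow V.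
      (of_bool (\<rho> x i = s) - of_bool (\<rho> x i = s')) * of_bool (\<rho> x j = t) * graph_prob a b n (\<rho> x) \<phi> E)\<bar>)
    = (\<Sum>t\<in>Q. \<Sum>E\<in>Pow (A \<union> B). \<bar>(1/2) ^ card V * (\<Sum>x\<in>Pow V. a0 t (E \<inter> A) x)\<bar> * (\<Prod>e\<in>B. if e \<in> E then r e else 1 - r e))"
  proof (intro sum.cong refl, simp only: AB(4))
    fix t E
    have "(\<Sum>x\<in>Pow V. (of_bool (\<rho> x i = s) - of_bool (\<rho> x i = s')) * of_bool (\<rho> x j = t) * graph_prob a b n (\<rho> x) \<phi> E)
       = (\<Sum>x\<in>Pow V. a0 t (E \<inter> A) x) * bB E"
      unfolding gp sum_distrib_right sp[of _ "E \<inter> A"] a0_def by (intro sum.cong refl) (simp add: mult_ac)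
    then show "\<bar>(1/2) ^ card V * (\<Sum>x\<in>Pow V. (of_bool (\<rho> x i = s) - of_bool (\<rho> x i = s')) * of_bool (\<rho> x j = t) * graph_prob a b n (\<rho> x) \<phi> E)\<bar>
       = \<bar>(1/2) ^ card V * (\<Sum>x\<in>Pow V. a0 t (E \<inter> A) x)\<bar> * (\<Prod>e\<in>B. if e \<in> E then r e else 1 - r e)"
      using bB0[of E] unfolding bB_def by (simp add: abs_mult)
  qed
  also have "\<dots> = (\<Sum>t\<in>Q. \<Sum>g\<in>Pow A. \<bar>(1/2) ^ card V * (\<Sum>x\<in>Pow V. a0 t g x)\<bar>)"
    by (intro sum.cong refl sum_Pow_irrelevant[OF AB(1-3), of "\<lambda>g. \<bar>(1/2) ^ card V * (\<Sum>x\<in>Pow V. a0 _ g x)\<bar>"])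
  also have "\<dots> \<le> (\<Sum>t\<in>Q. \<Sum>g\<in>Pow A. \<Sum>z\<in>Pow {j}. of_bool (\<rho> z j = t) *
       \<bar>\<Sum>x\<in>Pow V. ?ww (x, g) * (of_bool (x \<inter> {j} = z) * spin i (x, g))\<bar>)"
  proof (intro sum_mono)
    fix t g assume g: "g \<in> Pow A"
    have "(1/2) ^ card V * (\<Sum>x\<in>Pow V. a0 t g x) = (\<Sum>x\<in>Pow V. \<Sum>z\<in>Pow {j}. of_bool (\<rho> z j = t) *
        (?ww (x, g) * (of_bool (x \<inter> {j} = z) * spin i (x, g))))"
      unfolding sum_distrib_left
    proof (rule sum.cong[OF refl])
      fix x assume "x \<in> Pow V"
      have rj: "\<rho> (x \<inter> {j}) j = \<rho> x j" by (simp add: \<rho>_def refine_def)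
      have "(\<Sum>z\<in>Pow {j}. of_bool (\<rho> z j = t) * (?ww (x, g) * (of_bool (x \<inter> {j} = z) * spin i (x, g)))) =
         of_bool (\<rho> (x \<inter> {j}) j = t) * (?ww (x, g) * (1 * spin i (x, g)))"
        by (subst sum.remove[of _ "x \<inter> {j}"]) (auto intro!: sum.neutral)
      then show "(1/2) ^ card V * a0 t g x = (\<Sum>z\<in>Pow {j}. of_bool (\<rho> z j = t) * (?ww (x, g) * (of_bool (x \<inter> {j} = z) * spin i (x, g))))"
        unfolding rj ww[OF g] a0_def by (simp add: mult_ac)
    qed
    also have "\<dots> = (\<Sum>z\<in>Pow {j}. of_bool (\<rho> z j = t) * (\<Sum>x\<in>Pow V. ?ww (x, g) * (of_bool (x \<inter> {j} = z) * spin i (x, g))))"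
      by (subst sum.swap) (simp only: sum_distrib_left)
    finally have e: "(1/2) ^ card V * (\<Sum>x\<in>Pow V. a0 t g x) = \<dots>" .
    show "\<bar>(1/2) ^ card V * (\<Sum>x\<in>Pow V. a0 t g x)\<bar> \<le> (\<Sum>z\<in>Pow {j}. of_bool (\<rho> z j = t) *
       \<bar>\<Sum>x\<in>Pow V. ?ww (x, g) * (of_bool (x \<inter> {j} = z) * spin i (x, g))\<bar>)"
      unfolding e by (rule order_trans[OF sum_abs]) (simp add: abs_mult)
  qed
  also have "\<dots> = (\<Sum>z\<in>Pow {j}. \<Sum>g\<in>Pow A. (\<Sum>t\<in>Q. of_bool (\<rho> z j = t)) *
       \<bar>\<Sum>x\<in>Pow V. ?ww (x, g) * (of_bool (x \<inter> {j} = z) * spin i (x, g))\<bar>)"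
    unfolding sum_distrib_right by (subst sum.swap, subst (2) sum.swap, subst sum.swap) (rule refl)
  also have "\<dots> \<le> (\<Sum>z\<in>Pow {j}. \<Sum>g\<in>Pow (pairs V).
       \<bar>\<Sum>x\<in>Pow V. ?ww (x, g) * (of_bool (x \<inter> {j} = z) * spin i (x, g))\<bar>)"
  proof (rule sum_mono)
    fix z
    have "(\<Sum>t\<in>Q. of_bool (\<rho> z j = t)) \<le> (1 :: real)" using Q by (simp add: of_bool_def)
    then have "(\<Sum>g\<in>Pow A. (\<Sum>t\<in>Q. of_bool (\<rho> z j = t)) * \<bar>\<Sum>x\<in>Pow V. ?ww (x, g) * (of_bool (x \<inter> {j} = z) * spin i (x, g))\<bar>)
       \<le> (\<Sum>g\<in>Pow A. \<bar>\<Sum>x\<in>Pow V. ?ww (x, g) * (of_bool (x \<inter> {j} = z) * spin i (x, g))\<bar>)"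
      by (intro sum_mono mult_left_le_one_le) (auto intro: sum_nonneg)
    also have "\<dots> \<le> (\<Sum>g\<in>Pow (pairs V). \<bar>\<Sum>x\<in>Pow V. ?ww (x, g) * (of_bool (x \<inter> {j} = z) * spin i (x, g))\<bar>)"
      using AB finite_pairs[OF SV(2)] by (intro sum_mono2) auto
    finally show "(\<Sum>g\<in>Pow A. (\<Sum>t\<in>Q. of_bool (\<rho> z j = t)) * \<bar>\<Sum>x\<in>Pow V. ?ww (x, g) * (of_bool (x \<inter> {j} = z) * spin i (x, g))\<bar>) \<le> \<dots>" .
  qed
  also have "\<dots> \<le> sqrt (vinfo ?\<phi> V {j} i)"
    by (rule G.sum_abs_spin_le) (use ij in \<open>auto simp: V_def\<close>)
  finally show ?thesis using True by simp
qed

text \<open>The spin of \<open>i\<close> is \<open>s\<close> or \<open>s'\<close> with nearly the same probability, given the graph and the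
  spin of \<open>j\<close>.\<close>

lemma spin_difference:
  fixes i j :: nat
  assumes Q: "finite Q" "s \<in> Q" "s' \<in> Q" "s \<noteq> s'" and ij: "i \<in> {1..n}" "j \<in> {1..n}"
    and \<phi>: "\<And>i. i \<in> {1..n} \<Longrightarrow> 0 \<le> \<phi> i"
  shows "(\<Sum>t\<in>Q. \<Sum>E\<in>graphs n. \<bar>\<Sum>\<tau>\<in>{1..n} \<rightarrow>\<^sub>E Q.
      (of_bool (\<tau> i = s) - of_bool (\<tau> i = s')) * of_bool (\<tau> j = t) * graph_prob a b n \<tau> \<phi> E\<bar>)
    \<le> (\<Sum>c\<in>{1..n} \<rightarrow>\<^sub>E Q. of_bool (c i \<in> {s, s'}) * sqrt (vinfo (thin s s' {1..n} \<phi> c) {1..n} {j} i))"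
proof -
  let ?V = "{1..n}"
  let ?D = "\<lambda>c t E. (1/2) ^ card ?V * (\<Sum>x\<in>Pow ?V. (of_bool (refine s s' ?V c x i = s) - of_bool (refine s s' ?V c x i = s'))
      * of_bool (refine s s' ?V c x j = t) * graph_prob a b n (refine s s' ?V c x) \<phi> E)"
  have "(\<Sum>t\<in>Q. \<Sum>E\<in>graphs n. \<bar>\<Sum>\<tau>\<in>?V \<rightarrow>\<^sub>E Q.
      (of_bool (\<tau> i = s) - of_bool (\<tau> i = s')) * of_bool (\<tau> j = t) * graph_prob a b n \<tau> \<phi> E\<bar>)
    = (\<Sum>t\<in>Q. \<Sum>E\<in>Pow (pairs ?V). \<bar>\<Sum>c\<in>?V \<rightarrow>\<^sub>E Q. ?D c t E\<bar>)"
    unfolding graphs_eq by (subst sum_refine[OF _ Q(2,3,4,1)]) auto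
  also have "\<dots> \<le> (\<Sum>t\<in>Q. \<Sum>E\<in>Pow (pairs ?V). \<Sum>c\<in>?V \<rightarrow>\<^sub>E Q. \<bar>?D c t E\<bar>)"
    by (intro sum_mono sum_abs)
  also have "\<dots> = (\<Sum>t\<in>Q. \<Sum>c\<in>?V \<rightarrow>\<^sub>E Q. \<Sum>E\<in>Pow (pairs ?V). \<bar>?D c t E\<bar>)"
    by (rule sum.cong[OF refl], rule sum.swap)
  also have "\<dots> = (\<Sum>c\<in>?V \<rightarrow>\<^sub>E Q. \<Sum>t\<in>Q. \<Sum>E\<in>Pow (pairs ?V). \<bar>?D c t E\<bar>)"
    by (rule sum.swap)
  also have "\<dots> \<le> (\<Sum>c\<in>?V \<rightarrow>\<^sub>E Q. of_bool (c i \<in> {s, s'}) * sqrt (vinfo (thin s s' ?V \<phi> c) ?V {j} i))"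
    by (intro sum_mono refined_difference Q ij \<phi>)
  finally show ?thesis .
qed

end

section \<open>Moments and thinning of the weight law\<close>

lemma tail_imp_integrable_power4:
  fixes \<nu> :: "real measure" and \<beta> :: real
  assumes "prob_space \<nu>" and sets: "sets \<nu> = sets borel" and nn: "AE x in \<nu>. 0 \<le> x"
    and \<beta>: "\<beta> > 8" and tail: "eventually (\<lambda>k. measure \<nu> {k..} \<le> k powr (-\<beta>)) at_top"
  shows "integrable \<nu> (\<lambda>x. x ^ 4)"
proof -
  interpret prob_space \<nu> by fact
  obtain k0 where k0: "\<And>k. k \<ge> k0 \<Longrightarrow> measure \<nu> {k..} \<le> k powr (-\<beta>)"
    using tail by (auto simp: eventually_at_top_linorder)
  define K where "K = max 1 (nat \<lceil>k0\<rceil>)"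
  have K: "1 \<le> K" "k0 \<le> real K" by (auto simp: K_def) linarith
  define f where "f m = (\<lambda>x. ennreal ((real (m + K) + 1) ^ 4) * indicator {real (m + K)..} x)" for m
  have fm: "f m \<in> borel_measurable \<nu>" for m
    unfolding f_def measurable_cong_sets[OF sets refl] by measurable
  have bound: "ennreal (x ^ 4) \<le> ennreal (real K ^ 4) + (\<Sum>m. f m x)" if x: "0 \<le> x" for x
  proof (cases "x < real K")
    case True
    then have "x ^ 4 \<le> real K ^ 4" using x by (intro power_mono) auto
    then show ?thesis by (intro add_increasing2 ennreal_leI) auto
  next
    case False
    define N where "N = nat \<lfloor>x\<rfloor>"
    have N: "real N \<le> x" "x \<le> real N + 1" "K \<le> N" using False x by (auto simp: N_def le_nat_floor)
    have "ennreal (x ^ 4) \<le> f (N - K) x"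
    proof -
      have "x ^ 4 \<le> (real N + 1) ^ 4" using N x by (intro power_mono) auto
      then show ?thesis using N by (simp add: f_def ennreal_leI)
    qed
    also have "\<dots> \<le> (\<Sum>m. f m x)"
      using sum_le_suminf[OF summableI, of "{N - K}" "\<lambda>m. f m x"] by simp
    finally show ?thesis by (simp add: add_increasing)
  qed
  have fi: "(\<integral>\<^sup>+x. f m x \<partial>\<nu>) \<le> ennreal (16 * (1 / real (Suc m) ^ 2))" for m
  proof -
    let ?N = "real (m + K)"
    have N1: "1 \<le> ?N" "real (Suc m) \<le> ?N" using K by auto
    have "measure \<nu> {?N..} \<le> ?N powr (-\<beta>)" by (rule k0) (use K in auto)
    also have "\<dots> \<le> ?N powr (-6)" using N1 \<beta> by (intro powr_mono) auto
    also have "\<dots> = 1 / ?N ^ 6" using N1 by (simp add: powr_minus_divide powr_numeral)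
    finally have m6: "measure \<nu> {?N..} \<le> 1 / ?N ^ 6" .
    have "(\<integral>\<^sup>+x. f m x \<partial>\<nu>) = ennreal ((?N + 1) ^ 4) * emeasure \<nu> {?N..}"
      unfolding f_def by (rule nn_integral_cmult_indicator) (simp add: sets)
    also have "\<dots> = ennreal ((?N + 1) ^ 4 * measure \<nu> {?N..})"
      by (simp add: emeasure_eq_measure ennreal_mult)
    also have "\<dots> \<le> ennreal (16 * (1 / real (Suc m) ^ 2))"
    proof (rule ennreal_leI)
      have gen: "(2 * X) ^ 4 * (1 / X ^ 6) = 16 * (1 / X ^ 2)" if "1 \<le> X" for X :: real
        using that by (simp add: field_simps eval_nat_numeral)
      have "(?N + 1) ^ 4 * measure \<nu> {?N..} \<le> (2 * ?N) ^ 4 * (1 / ?N ^ 6)"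
        using N1 m6 by (intro mult_mono power_mono) auto
      also have "\<dots> = 16 * (1 / ?N ^ 2)" by (rule gen[OF N1(1)])
      also have "\<dots> \<le> 16 * (1 / real (Suc m) ^ 2)"
        using N1 by (intro mult_left_mono divide_left_mono power_mono) auto
      finally show "(?N + 1) ^ 4 * measure \<nu> {?N..} \<le> 16 * (1 / real (Suc m) ^ 2)" .
    qed
    finally show ?thesis .
  qed
  have summ: "summable (\<lambda>m. 16 * (1 / real (Suc m) ^ 2))"
  proof -
    have "summable (\<lambda>m. 1 / real m ^ 2)" using inverse_power_summable[of 2, where 'a=real] by (simp add: inverse_eq_divide)
    then have "summable (\<lambda>m. 1 / real (Suc m) ^ 2)" by (subst summable_Suc_iff)
    then show ?thesis by (rule summable_mult)
  qed
  have "(\<integral>\<^sup>+x. ennreal (x ^ 4) \<partial>\<nu>) \<le> (\<integral>\<^sup>+x. ennreal (real K ^ 4) + (\<Sum>m. f m x) \<partial>\<nu>)"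
    using nn by (intro nn_integral_mono_AE) (auto elim!: eventually_mono intro: bound)
  also have "\<dots> = ennreal (real K ^ 4) + (\<Sum>m. \<integral>\<^sup>+x. f m x \<partial>\<nu>)"
    using fm by (subst nn_integral_add) (auto simp: nn_integral_suminf emeasure_space_1)
  also have "\<dots> \<le> ennreal (real K ^ 4) + (\<Sum>m. ennreal (16 * (1 / real (Suc m) ^ 2)))"
    by (intro add_left_mono suminf_le fi summableI)
  also have "\<dots> < \<infinity>" using summ by (subst suminf_ennreal2) auto
  finally have fin: "(\<integral>\<^sup>+x. ennreal (x ^ 4) \<partial>\<nu>) < \<infinity>" .
  show ?thesis
  proof (rule integrableI_nonneg)
    show "(\<lambda>x. x ^ 4) \<in> borel_measurable \<nu>" unfolding measurable_cong_sets[OF sets refl] by measurable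
  qed (use fin in auto)
qed

lemma integrable_lower_power:
  fixes \<nu> :: "real measure"
  assumes "prob_space \<nu>" and sets: "sets \<nu> = sets borel" and i: "integrable \<nu> (\<lambda>x. x ^ 4)" and k: "k \<le> 4"
  shows "integrable \<nu> (\<lambda>x. x ^ k)"
proof -
  interpret prob_space \<nu> by fact
  show ?thesis
  proof (rule Bochner_Integration.integrable_bound)
    show "integrable \<nu> (\<lambda>x. 1 + x ^ 4)" using i by simp
    show "(\<lambda>x. x ^ k) \<in> borel_measurable \<nu>" unfolding measurable_cong_sets[OF sets refl] by measurable
    have "\<bar>x\<bar> ^ k \<le> 1 + x ^ 4" for x :: real
    proof (cases "\<bar>x\<bar> \<le> 1")
      case True
      then have "\<bar>x\<bar> ^ k \<le> 1" by (simp add: power_le_one)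
      moreover have "0 \<le> x ^ 4" by simp
      ultimately show ?thesis by linarith
    next
      case False
      then have "\<bar>x\<bar> ^ k \<le> \<bar>x\<bar> ^ 4" using k by (intro power_increasing) auto
      also have "\<dots> = x ^ 4" by simp
      finally show ?thesis by simp
    qed
    then show "AE x in \<nu>. norm (x ^ k) \<le> norm (1 + x ^ 4)" by (simp add: power_abs abs_of_nonneg add_nonneg_nonneg)
  qed
qed

text \<open>The law of the weight of a vertex with uniform spin, replaced by \<open>0\<close> if the spin is neither \<open>s\<close> nor \<open>s'\<close>.\<close>

definition thinned_law :: "real measure \<Rightarrow> nat \<Rightarrow> nat \<Rightarrow> nat \<Rightarrow> real measure" where
  "thinned_law \<nu> q s s' = distr (\<nu> \<Otimes>\<^sub>M uniform_count_measure {1..q}) borel (\<lambda>(y, k). if k \<in> {s, s'} then y else 0)"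

context
  fixes \<nu> :: "real measure" and q s s' :: nat
  assumes prob_\<nu>: "prob_space \<nu>" and sets_\<nu>: "sets \<nu> = sets borel" and q: "q \<ge> 1"
begin

lemma thin_map_measurable:
  "(\<lambda>(y, k). if k \<in> {s, s'} then y else 0) \<in> borel_measurable (\<nu> \<Otimes>\<^sub>M uniform_count_measure {1..q})"
proof -
  have "(\<lambda>(y, k). if k \<in> {s, s'} then y else 0) \<in> borel_measurable (borel \<Otimes>\<^sub>M count_space {1..q})"
  proof -
    have "Measurable.pred (borel \<Otimes>\<^sub>M count_space {1..q}) (\<lambda>p. snd p \<in> {s, s'})"
      by (rule measurable_compose[OF measurable_snd]) simp
    then show ?thesis unfolding case_prod_beta
      by (intro measurable_If measurable_fst measurable_const predE) auto
  qed
  moreover have "sets (\<nu> \<Otimes>\<^sub>M uniform_count_measure {1..q}) = sets (borel \<Otimes>\<^sub>M count_space {1..q})"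
    by (intro sets_pair_measure_cong sets_\<nu> sets_uniform_count_measure_count_space)
  ultimately show ?thesis using measurable_cong_sets[OF _ refl] by blast
qed

lemma prob_thinned_law: "prob_space (thinned_law \<nu> q s s')"
proof -
  interpret \<nu>: prob_space \<nu> by (rule prob_\<nu>)
  interpret \<kappa>: prob_space "uniform_count_measure {1..q}" by (rule prob_space_uniform_count_measure) (use q in auto)
  interpret pair_prob_space \<nu> "uniform_count_measure {1..q}" ..
  show ?thesis unfolding thinned_law_def by (rule prob_space_distr[OF thin_map_measurable])
qed

lemma nn_integral_thinned_law:
  assumes F: "F \<in> borel_measurable borel"
  shows "(\<integral>\<^sup>+x. F x \<partial>thinned_law \<nu> q s s') =
    ennreal (1 / real q) * (\<Sum>k\<in>{1..q}. \<integral>\<^sup>+y. F (if k \<in> {s, s'} then y else 0) \<partial>\<nu>)"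
proof -
  interpret \<nu>: prob_space \<nu> by (rule prob_\<nu>)
  interpret \<kappa>: prob_space "uniform_count_measure {1..q}" by (rule prob_space_uniform_count_measure) (use q in auto)
  interpret pair_sigma_finite \<nu> "uniform_count_measure {1..q}" ..
  have m: "(\<lambda>p. F (case p of (y, k) \<Rightarrow> if k \<in> {s, s'} then y else 0)) \<in> borel_measurable (\<nu> \<Otimes>\<^sub>M uniform_count_measure {1..q})"
    by (rule measurable_compose[OF thin_map_measurable F])
  have "(\<integral>\<^sup>+x. F x \<partial>thinned_law \<nu> q s s') =
      (\<integral>\<^sup>+p. F (case p of (y, k) \<Rightarrow> if k \<in> {s, s'} then y else 0) \<partial>(\<nu> \<Otimes>\<^sub>M uniform_count_measure {1..q}))"
    unfolding thinned_law_def by (rule nn_integral_distr[OF thin_map_measurable]) (simp add: F)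
  also have "\<dots> = (\<integral>\<^sup>+k. \<integral>\<^sup>+y. F (if k \<in> {s, s'} then y else 0) \<partial>\<nu> \<partial>uniform_count_measure {1..q})"
    using nn_integral_snd[OF m] by simp
  also have "\<dots> = (\<Sum>k\<in>{1..q}. ennreal (1 / real q) * (\<integral>\<^sup>+y. F (if k \<in> {s, s'} then y else 0) \<partial>\<nu>))"
    unfolding uniform_count_measure_def by (subst nn_integral_point_measure_finite) auto
  finally show ?thesis by (simp add: sum_distrib_left)
qed

lemma sets_thinned_law: "sets (thinned_law \<nu> q s s') = sets borel"
  by (simp add: thinned_law_def)

text \<open>Choosing a coarse spin for each vertex and dropping the weights outside the two communities
  gives independent weights with the thinned law.\<close>

lemma nn_integral_iid_thinned:
  assumes "finite I" and F: "F \<in> borel_measurable (\<Pi>\<^sub>M i\<in>I. (borel :: real measure))"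
  shows "(\<integral>\<^sup>+\<phi>. F \<phi> \<partial>(\<Pi>\<^sub>M i\<in>I. thinned_law \<nu> q s s')) =
    ennreal ((1 / real q) ^ card I) * (\<Sum>c\<in>I \<rightarrow>\<^sub>E {1..q}. \<integral>\<^sup>+\<phi>. F (thin s s' I \<phi> c) \<partial>(\<Pi>\<^sub>M i\<in>I. \<nu>))"
  using assms
proof (induction I arbitrary: F)
  case empty
  have "thin s s' {} (\<lambda>x. undefined) (\<lambda>x. undefined) = (\<lambda>x. undefined)" by (simp add: thin_def restrict_def)
  then show ?case by (simp add: PiM_empty nn_integral_count_space_finite)
next
  case (insert i I)
  let ?\<mu> = "thinned_law \<nu> q s s'"
  let ?f = "\<lambda>y k. if k \<in> {s, s'} then y else (0::real)"
  let ?B = "\<lambda>I. \<Pi>\<^sub>M i\<in>I. (borel :: real measure)"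
  let ?\<kappa> = "ennreal (1 / real q)"
  interpret \<mu>: product_sigma_finite "\<lambda>_::nat. ?\<mu>"
    by (simp add: product_sigma_finite_def prob_space_imp_sigma_finite prob_thinned_law)
  interpret \<nu>: product_sigma_finite "\<lambda>_::nat. \<nu>"
    by (simp add: product_sigma_finite_def prob_space_imp_sigma_finite prob_\<nu>)
  have sf: "sigma_finite_measure \<nu>" by (simp add: prob_space_imp_sigma_finite prob_\<nu>)
  have sets\<mu>: "sets (\<Pi>\<^sub>M i\<in>J. ?\<mu>) = sets (?B J)" for J :: "nat set" by (intro sets_PiM_cong) (auto simp: sets_thinned_law)
  have sets\<nu>: "sets (\<Pi>\<^sub>M i\<in>J. \<nu>) = sets (?B J)" for J :: "nat set" by (intro sets_PiM_cong) (auto simp: sets_\<nu>)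
  have F\<mu>: "F \<in> borel_measurable (\<Pi>\<^sub>M i\<in>insert i I. ?\<mu>)"
    using insert.prems measurable_cong_sets[OF sets\<mu> refl] by blast
  have F\<nu>: "(\<lambda>\<phi>. F (thin s s' (insert i I) \<phi> c)) \<in> borel_measurable (\<Pi>\<^sub>M i\<in>insert i I. \<nu>)" for c
  proof -
    have "(\<lambda>\<phi>. thin s s' (insert i I) \<phi> c) \<in> measurable (?B (insert i I)) (?B (insert i I))"
      unfolding thin_def by (intro measurable_restrict) measurable
    from measurable_compose[OF this insert.prems] show ?thesis
      using measurable_cong_sets[OF sets\<nu> refl] by blast
  qed
  have upd: "(\<lambda>(x, y). F (x(i := ?f y k))) \<in> borel_measurable (?B I \<Otimes>\<^sub>M \<nu>)" for k
  proof -
    have "(\<lambda>p. (fst p, ?f (snd p) k)) \<in> measurable (?B I \<Otimes>\<^sub>M borel) (?B I \<Otimes>\<^sub>M borel)" by measurable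
    from measurable_compose[OF this measurable_compose[OF measurable_add_dim insert.prems]]
    have "(\<lambda>(x, y). F (x(i := ?f y k))) \<in> borel_measurable (?B I \<Otimes>\<^sub>M borel)" by (simp add: case_prod_beta fun_upd_def cong: if_cong)
    then show ?thesis using measurable_cong_sets[OF sets_pair_measure_cong[OF refl sets_\<nu>] refl] by blast
  qed
  define H where "H k x = (\<integral>\<^sup>+y. F (x(i := ?f y k)) \<partial>\<nu>)" for k x
  have Hm: "H k \<in> borel_measurable (?B I)" for k
    unfolding H_def by (rule sigma_finite_measure.borel_measurable_nn_integral[OF sf upd])
  have Hm': "(\<lambda>\<phi>. H k (thin s s' I \<phi> c)) \<in> borel_measurable (\<Pi>\<^sub>M i\<in>I. \<nu>)" for k c
  proof -
    have "(\<lambda>\<phi>. thin s s' I \<phi> c) \<in> measurable (?B I) (?B I)"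
      unfolding thin_def by (intro measurable_restrict) measurable
    from measurable_compose[OF this Hm] show ?thesis using measurable_cong_sets[OF sets\<nu> refl] by blast
  qed
  have thin_upd: "thin s s' (insert i I) (\<phi>(i := y)) (c(i := k)) = (thin s s' I \<phi> c)(i := ?f y k)" for \<phi> y c k
    using insert.hyps by (auto simp: thin_def fun_eq_iff restrict_def)
  have "(\<integral>\<^sup>+\<phi>. F \<phi> \<partial>(\<Pi>\<^sub>M i\<in>insert i I. ?\<mu>)) = (\<integral>\<^sup>+x. \<integral>\<^sup>+y. F (x(i := y)) \<partial>?\<mu> \<partial>(\<Pi>\<^sub>M i\<in>I. ?\<mu>))"
    by (rule \<mu>.product_nn_integral_insert[OF insert.hyps F\<mu>])
  also have "\<dots> = (\<integral>\<^sup>+x. ?\<kappa> * (\<Sum>k\<in>{1..q}. H k x) \<partial>(\<Pi>\<^sub>M i\<in>I. ?\<mu>))"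
  proof (rule nn_integral_cong)
    fix x assume "x \<in> space (\<Pi>\<^sub>M i\<in>I. ?\<mu>)"
    then have x: "x \<in> space (?B I)" using sets_eq_imp_space_eq[OF sets\<mu>] by simp
    have "(\<lambda>y. F (x(i := y))) \<in> borel_measurable borel"
      using measurable_compose[OF measurable_compose[OF measurable_Pair1'[OF x] measurable_add_dim] insert.prems] by (simp add: fun_upd_def)
    from nn_integral_thinned_law[OF this]
    show "(\<integral>\<^sup>+y. F (x(i := y)) \<partial>?\<mu>) = ?\<kappa> * (\<Sum>k\<in>{1..q}. H k x)" by (simp only: H_def)
  qed
  also have "\<dots> = ennreal ((1 / real q) ^ card I) * (\<Sum>c\<in>I \<rightarrow>\<^sub>E {1..q}. \<integral>\<^sup>+\<phi>. ?\<kappa> * (\<Sum>k\<in>{1..q}. H k (thin s s' I \<phi> c)) \<partial>(\<Pi>\<^sub>M i\<in>I. \<nu>))"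
    by (rule insert.IH) (use Hm in measurable)
  also have "\<dots> = ennreal ((1 / real q) ^ card I) * (\<Sum>c\<in>I \<rightarrow>\<^sub>E {1..q}. ?\<kappa> * (\<Sum>k\<in>{1..q}. \<integral>\<^sup>+\<phi>. H k (thin s s' I \<phi> c) \<partial>(\<Pi>\<^sub>M i\<in>I. \<nu>)))"
    using Hm' by (simp add: nn_integral_cmult nn_integral_sum)
  also have "\<dots> = (ennreal ((1 / real q) ^ card I) * ?\<kappa>) * (\<Sum>c\<in>I \<rightarrow>\<^sub>E {1..q}. \<Sum>k\<in>{1..q}. \<integral>\<^sup>+\<phi>. H k (thin s s' I \<phi> c) \<partial>(\<Pi>\<^sub>M i\<in>I. \<nu>))"
    by (simp only: sum_distrib_left[symmetric] mult.assoc)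
  also have "ennreal ((1 / real q) ^ card I) * ?\<kappa> = ennreal ((1 / real q) ^ card (insert i I))"
    using insert.hyps by (simp add: ennreal_mult[symmetric] mult.commute)
  also have "(\<Sum>c\<in>I \<rightarrow>\<^sub>E {1..q}. \<Sum>k\<in>{1..q}. \<integral>\<^sup>+\<phi>. H k (thin s s' I \<phi> c) \<partial>(\<Pi>\<^sub>M i\<in>I. \<nu>)) =
     (\<Sum>c\<in>insert i I \<rightarrow>\<^sub>E {1..q}. \<integral>\<^sup>+\<phi>. F (thin s s' (insert i I) \<phi> c) \<partial>(\<Pi>\<^sub>M i\<in>insert i I. \<nu>))"
  proof -
    have "(\<integral>\<^sup>+\<phi>. F (thin s s' (insert i I) \<phi> (c(i := k))) \<partial>(\<Pi>\<^sub>M i\<in>insert i I. \<nu>)) = (\<integral>\<^sup>+\<phi>. H k (thin s s' I \<phi> c) \<partial>(\<Pi>\<^sub>M i\<in>I. \<nu>))" for c k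
      unfolding \<nu>.product_nn_integral_insert[OF insert.hyps F\<nu>] thin_upd H_def ..
    then have "(\<Sum>c\<in>I \<rightarrow>\<^sub>E {1..q}. \<Sum>k\<in>{1..q}. \<integral>\<^sup>+\<phi>. H k (thin s s' I \<phi> c) \<partial>(\<Pi>\<^sub>M i\<in>I. \<nu>)) =
      (\<Sum>k\<in>{1..q}. \<Sum>c\<in>I \<rightarrow>\<^sub>E {1..q}. \<integral>\<^sup>+\<phi>. F (thin s s' (insert i I) \<phi> (c(i := k))) \<partial>(\<Pi>\<^sub>M i\<in>insert i I. \<nu>))"
      by (subst sum.swap) simp
    also have "\<dots> = (\<Sum>p\<in>{1..q} \<times> (I \<rightarrow>\<^sub>E {1..q}). (\<lambda>c. \<integral>\<^sup>+\<phi>. F (thin s s' (insert i I) \<phi> c) \<partial>(\<Pi>\<^sub>M i\<in>insert i I. \<nu>)) (case p of (k, c) \<Rightarrow> c(i := k)))"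
      unfolding sum.cartesian_product by (simp add: case_prod_beta)
    also have "\<dots> = (\<Sum>c\<in>insert i I \<rightarrow>\<^sub>E {1..q}. \<integral>\<^sup>+\<phi>. F (thin s s' (insert i I) \<phi> c) \<partial>(\<Pi>\<^sub>M i\<in>insert i I. \<nu>))"
      unfolding PiE_insert_eq by (subst sum.reindex[OF inj_combinator[OF insert.hyps(2)]]) (simp add: comp_def)
    finally show ?thesis .
  qed
  finally show ?case .
qed

end

context
  fixes \<nu> :: "real measure" and q s s' :: nat and m :: real
  assumes prob_\<nu>: "prob_space \<nu>" and sets_\<nu>: "sets \<nu> = sets borel" and q: "q \<ge> 2"
    and s: "s \<in> {1..q}" "s' \<in> {1..q}" "s \<noteq> s'"
    and m: "m > 0" "AE x in \<nu>. m \<le> x" and i4: "integrable \<nu> (\<lambda>x. x ^ 4)"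
begin

lemma q_ge_1: "q \<ge> 1" using q by simp

lemma weight_law_thinned: "weight_law (thinned_law \<nu> q s s')"
proof (rule weight_law.intro)
  show "prob_space (thinned_law \<nu> q s s')" by (rule prob_thinned_law[OF prob_\<nu> sets_\<nu> q_ge_1])
  show "sets (thinned_law \<nu> q s s') = sets borel" by (rule sets_thinned_law[OF prob_\<nu> sets_\<nu> q_ge_1])
  have sets: "sets (thinned_law \<nu> q s s') = sets borel" by fact
  have sp: "space (thinned_law \<nu> q s s') = UNIV" by (simp add: thinned_law_def)
  show "AE x in thinned_law \<nu> q s s'. 0 \<le> x"
  proof (rule AE_I')
    have "emeasure (thinned_law \<nu> q s s') {..<0} = (\<integral>\<^sup>+x. indicator {..<0} x \<partial>thinned_law \<nu> q s s')"
      by (simp add: sets)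
    also have "\<dots> = ennreal (1 / real q) * (\<Sum>k\<in>{1..q}. \<integral>\<^sup>+y. indicator {..<0} (if k \<in> {s, s'} then y else 0) \<partial>\<nu>)"
      by (rule nn_integral_thinned_law[OF prob_\<nu> sets_\<nu> q_ge_1]) measurable
    also have "(\<Sum>k\<in>{1..q}. \<integral>\<^sup>+y. indicator {..<0} (if k \<in> {s, s'} then y else 0) \<partial>\<nu>) = (\<Sum>k\<in>{1..q}. \<integral>\<^sup>+y. 0 \<partial>\<nu>)"
      by (intro sum.cong refl nn_integral_cong_AE) (use m in \<open>auto elim!: eventually_mono\<close>)
    finally show "{..<0} \<in> null_sets (thinned_law \<nu> q s s')" by (intro null_setsI) (auto simp: sets)
    show "{x \<in> space (thinned_law \<nu> q s s'). \<not> 0 \<le> x} \<subseteq> {..<0}" by auto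
  qed
  fix k :: nat assume k: "k \<le> 4"
  show "integrable (thinned_law \<nu> q s s') (\<lambda>x. x ^ k)"
  proof (rule integrableI_bounded)
    show "(\<lambda>x. x ^ k) \<in> borel_measurable (thinned_law \<nu> q s s')"
      unfolding measurable_cong_sets[OF sets refl] by measurable
    have ik: "integrable \<nu> (\<lambda>x. x ^ k)" by (rule integrable_lower_power[OF prob_\<nu> sets_\<nu> i4 k])
    interpret prob_space \<nu> by (rule prob_\<nu>)
    have "(\<integral>\<^sup>+x. ennreal (norm (x ^ k)) \<partial>thinned_law \<nu> q s s') =
      ennreal (1 / real q) * (\<Sum>l\<in>{1..q}. \<integral>\<^sup>+y. ennreal (norm ((if l \<in> {s, s'} then y else 0) ^ k)) \<partial>\<nu>)"
      by (rule nn_integral_thinned_law[OF prob_\<nu> sets_\<nu> q_ge_1]) measurable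
    also have "\<dots> < \<infinity>"
    proof -
      have "(\<integral>\<^sup>+y. ennreal (norm ((if l \<in> {s, s'} then y else 0) ^ k)) \<partial>\<nu>) < \<infinity>" for l
        using ik by (cases "l \<in> {s, s'}") (auto simp: integrable_iff_bounded emeasure_space_1)
      then show ?thesis by (simp add: ennreal_mult_less_top)
    qed
    finally show "(\<integral>\<^sup>+x. ennreal (norm (x ^ k)) \<partial>thinned_law \<nu> q s s') < \<infinity>" .
  qed
qed

lemma second_moment_thinned: "weight_law.mom (thinned_law \<nu> q s s') 2 = 2 / real q * (\<integral>x. x\<^sup>2 \<partial>\<nu>)"
proof -
  interpret weight_law "thinned_law \<nu> q s s'" by (rule weight_law_thinned)
  have i2: "integrable \<nu> (\<lambda>x. x\<^sup>2)" by (rule integrable_lower_power[OF prob_\<nu> sets_\<nu> i4]) simp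
  have "ennreal (mom 2) = (\<integral>\<^sup>+x. ennreal (x\<^sup>2) \<partial>thinned_law \<nu> q s s')"
    unfolding mom_def using moments[of 2] by (intro nn_integral_eq_integral[symmetric]) auto
  also have "\<dots> = ennreal (1 / real q) * (\<Sum>l\<in>{1..q}. \<integral>\<^sup>+y. ennreal ((if l \<in> {s, s'} then y else 0)\<^sup>2) \<partial>\<nu>)"
    by (rule nn_integral_thinned_law[OF prob_\<nu> sets_\<nu> q_ge_1]) measurable
  also have "(\<Sum>l\<in>{1..q}. \<integral>\<^sup>+y. ennreal ((if l \<in> {s, s'} then y else 0)\<^sup>2) \<partial>\<nu>) = (\<Sum>l\<in>{s, s'}. \<integral>\<^sup>+y. ennreal (y\<^sup>2) \<partial>\<nu>)"
    by (intro sum.mono_neutral_cong_right) (use s in auto)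
  also have "(\<Sum>l\<in>{s, s'}. \<integral>\<^sup>+y. ennreal (y\<^sup>2) \<partial>\<nu>) = (\<Sum>l\<in>{s, s'}. ennreal (\<integral>y. y\<^sup>2 \<partial>\<nu>))"
    using i2 by (simp add: nn_integral_eq_integral)
  also have "\<dots> = ennreal (2 * (\<integral>y. y\<^sup>2 \<partial>\<nu>))"
    using s(3) by (simp add: ennreal_mult)
  also have "ennreal (1 / real q) * ennreal (2 * (\<integral>y. y\<^sup>2 \<partial>\<nu>)) = ennreal (2 / real q * (\<integral>x. x\<^sup>2 \<partial>\<nu>))"
    by (subst ennreal_mult[symmetric]) (auto intro!: integral_nonneg_AE)
  finally show ?thesis using mom_nonneg[of 2] by (subst (asm) ennreal_inj) (auto intro!: integral_nonneg_AE mult_nonneg_nonneg)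
qed

lemma thinned_law_not_null: "\<not> (AE x in thinned_law \<nu> q s s'. x = 0)"
proof
  interpret weight_law "thinned_law \<nu> q s s'" by (rule weight_law_thinned)
  interpret \<nu>: prob_space \<nu> by (rule prob_\<nu>)
  assume "AE x in thinned_law \<nu> q s s'. x = 0"
  then have "mom 2 = (\<integral>x. 0 \<partial>thinned_law \<nu> q s s')" unfolding mom_def
    by (intro integral_cong_AE) (auto intro!: measurable_\<mu> elim!: eventually_mono)
  then have "(\<integral>x. x\<^sup>2 \<partial>\<nu>) = 0" using second_moment_thinned q by simp
  moreover have "m\<^sup>2 \<le> (\<integral>x. x\<^sup>2 \<partial>\<nu>)"
  proof -
    have i2: "integrable \<nu> (\<lambda>x. x\<^sup>2)" by (rule integrable_lower_power[OF prob_\<nu> sets_\<nu> i4]) simp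
    have "(\<integral>x. m\<^sup>2 \<partial>\<nu>) \<le> (\<integral>x. x\<^sup>2 \<partial>\<nu>)"
      by (rule integral_mono_AE) (use i2 m in \<open>auto elim!: eventually_mono intro: power_mono\<close>)
    then show ?thesis by (simp add: \<nu>.prob_space)
  qed
  ultimately show False using m by simp
qed

text \<open>The \<open>L\<^sup>1\<close> distance of the events that \<open>i\<close> has the spin \<open>s\<close> or \<open>s'\<close>, jointly with the spin of \<open>j\<close> and the
  graph. The lower bound \<open>m\<close> on the weights compares the size-biased information \<open>rho\<close> with the
  unbiased one, and \<open>r\<close> comes from \<open>2 \<surd>Q \<le> r + Q / r\<close>.\<close>

lemma integrated_difference:
  fixes a b r :: real and n i j :: nat
  assumes ab: "a > 0" "b > 0" and n: "n > 0" and ij: "i \<in> {1..n}" "j \<in> {1..n}" and r: "r > 0"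
  shows "(\<Sum>t\<in>{1..q}. \<Sum>E\<in>graphs n. \<bar>\<Sum>\<tau>\<in>{1..n} \<rightarrow>\<^sub>E {1..q}. (of_bool (\<tau> i = s) - of_bool (\<tau> i = s')) * of_bool (\<tau> j = t) *
      ((1 / real q) ^ n * (\<integral>\<phi>. graph_prob a b n \<tau> \<phi> E \<partial>(\<Pi>\<^sub>M w\<in>{1..n}. \<nu>)))\<bar>)
    \<le> (r * weight_law.mom (thinned_law \<nu> q s s') 1 +
        weighted_two_block.rho a b n (thinned_law \<nu> q s s') {1..n} {1..n} {j} i / r) / (2 * m)"
proof -
  let ?V = "{1..n}" and ?\<mu> = "thinned_law \<nu> q s s'"
  let ?T = "?V \<rightarrow>\<^sub>E {1..q}"
  interpret W: weight_law ?\<mu> by (rule weight_law_thinned)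
  interpret weighted_two_block a b n ?\<mu> by unfold_locales (use ab n in auto)
  define N where "N = (\<Pi>\<^sub>M w\<in>?V. \<nu>)"
  interpret N: prob_space N unfolding N_def by (rule prob_space_PiM) (rule prob_\<nu>)
  have setsN: "sets N = sets (\<Pi>\<^sub>M w\<in>?V. (borel :: real measure))" unfolding N_def by (intro sets_PiM_cong) (auto simp: sets_\<nu>)
  have measN: "f \<in> borel_measurable (\<Pi>\<^sub>M w\<in>?V. (borel :: real measure)) \<Longrightarrow> f \<in> borel_measurable N" for f :: "_ \<Rightarrow> real"
    using measurable_cong_sets[OF setsN refl] by blast
  have AEm: "AE \<phi> in N. \<forall>w\<in>?V. m \<le> \<phi> w"
    unfolding N_def by (intro AE_finite_allI AE_PiM_component[OF prob_\<nu> _ m(2)]) auto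
  have sep_m: "(\<lambda>\<phi>. graph_prob a b n \<tau> \<phi> E) \<in> borel_measurable N" for \<tau> E
    by (rule measN[OF graph_prob_measurable])
  have gp01: "0 \<le> graph_prob a b n \<tau> \<phi> E \<and> graph_prob a b n \<tau> \<phi> E \<le> 1" if "\<forall>w\<in>?V. m \<le> \<phi> w" for \<tau> \<phi> E
  proof -
    have "\<forall>w\<in>?V. 0 \<le> \<phi> w" using that m(1) by fastforce
    then show ?thesis by (intro conjI graph_prob_range)
  qed
  have gpi: "integrable N (\<lambda>\<phi>. graph_prob a b n \<tau> \<phi> E)" for \<tau> E
    by (rule N.integrable_const_bound[where B=1, OF _ sep_m]) (use AEm in \<open>auto elim!: eventually_mono simp: gp01\<close>)
  define X where "X \<phi> = (1 / real q) ^ n * (\<Sum>c\<in>?T. of_bool (c i \<in> {s, s'}) * sqrt (vinfo (thin s s' ?V \<phi> c) ?V {j} i))" for \<phi>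
  define H where "H \<psi> = (r * \<psi> i + \<psi> i * vinfo \<psi> ?V {j} i / r) / (2 * m)" for \<psi> :: "nat \<Rightarrow> real"
  have Hm: "H \<in> borel_measurable (\<Pi>\<^sub>M w\<in>?V. (borel :: real measure))"
    unfolding H_def using ij
    by (intro borel_measurable_divide borel_measurable_add borel_measurable_times borel_measurable_const
        measurable_component_singleton vinfo_measurable) auto
  have thinm: "(\<lambda>\<phi>. thin s s' ?V \<phi> c) \<in> measurable (\<Pi>\<^sub>M w\<in>?V. (borel :: real measure)) (\<Pi>\<^sub>M w\<in>?V. (borel :: real measure))" for c
    unfolding thin_def by (intro measurable_restrict) measurable
  have Htm: "(\<lambda>\<phi>. H (thin s s' ?V \<phi> c)) \<in> borel_measurable N" for c
    by (intro measN measurable_compose[OF thinm Hm])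
  have vtm: "(\<lambda>\<phi>. vinfo (thin s s' ?V \<phi> c) ?V {j} i) \<in> borel_measurable N" for c
    by (intro measN measurable_compose[OF thinm vinfo_measurable]) auto
  have Xm: "X \<in> borel_measurable N" unfolding X_def using vtm by measurable
  have iH: "integrable (W.iid ?V) H" and intH: "(\<integral>\<psi>. H \<psi> \<partial>W.iid ?V) = (r * W.mom 1 + rho ?V ?V {j} i / r) / (2 * m)"
  proof -
    have 1: "integrable (W.iid ?V) (\<lambda>\<psi>. r * \<psi> i)" "(\<integral>\<psi>. \<psi> i \<partial>W.iid ?V) = W.mom 1"
      using W.component_power[OF ij(1), of 1] by auto
    have 2: "integrable (W.iid ?V) (\<lambda>\<psi>. \<psi> i * vinfo \<psi> ?V {j} i / r)"
      using ij by (intro integrable_divide integrable_weight_vinfo) auto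
    show "integrable (W.iid ?V) H" unfolding H_def by (intro integrable_divide Bochner_Integration.integrable_add 1 2)
    show "(\<integral>\<psi>. H \<psi> \<partial>W.iid ?V) = (r * W.mom 1 + rho ?V ?V {j} i / r) / (2 * m)"
      unfolding H_def rho_def using 1 2 by simp
  qed
  have v0: "0 \<le> vinfo \<psi> ?V {j} i" if "\<forall>w\<in>?V. 0 \<le> \<psi> w" for \<psi> using that ij by (intro vinfo_range) auto
  have thin0: "\<forall>w\<in>?V. 0 \<le> thin s s' ?V \<phi> c w" if "\<forall>w\<in>?V. m \<le> \<phi> w" for \<phi> c
  proof
    fix w assume "w \<in> ?V"
    then have "0 \<le> \<phi> w" using that m(1) by fastforce
    then show "0 \<le> thin s s' ?V \<phi> c w" using \<open>w \<in> ?V\<close> by (simp add: thin_def)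
  qed
  have H0: "0 \<le> H \<psi>" if "\<forall>w\<in>?V. 0 \<le> \<psi> w" for \<psi>
    unfolding H_def using that ij v0[OF that] r m by (intro divide_nonneg_nonneg add_nonneg_nonneg mult_nonneg_nonneg) auto
  have XH: "X \<phi> \<le> (1 / real q) ^ n * (\<Sum>c\<in>?T. H (thin s s' ?V \<phi> c))" if \<phi>: "\<forall>w\<in>?V. m \<le> \<phi> w" for \<phi>
    unfolding X_def
  proof (intro mult_left_mono sum_mono)
    fix c assume "c \<in> ?T"
    let ?\<psi> = "thin s s' ?V \<phi> c"
    let ?Q = "vinfo ?\<psi> ?V {j} i"
    have Q0: "0 \<le> ?Q" by (rule v0[OF thin0[OF \<phi>]])
    show "of_bool (c i \<in> {s, s'}) * sqrt ?Q \<le> H ?\<psi>"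
    proof (cases "c i \<in> {s, s'}")
      case True
      then have \<psi>i: "?\<psi> i = \<phi> i" "m \<le> \<phi> i" using ij \<phi> by (auto simp: thin_def)
      have "0 \<le> (sqrt r - sqrt (?Q / r))\<^sup>2" by simp
      also have "\<dots> = r + ?Q / r - 2 * sqrt ?Q"
      proof -
        have "(sqrt r)\<^sup>2 = r" "(sqrt (?Q / r))\<^sup>2 = ?Q / r" using r Q0 by (simp_all only: real_sqrt_pow2 divide_nonneg_pos less_imp_le)
        moreover have "sqrt r * sqrt (?Q / r) = sqrt ?Q" using r by (simp add: real_sqrt_mult[symmetric])
        ultimately show ?thesis unfolding power2_diff by (simp only: mult.assoc)
      qed
      finally have "sqrt ?Q \<le> (r + ?Q / r) / 2" by simp
      also have "\<dots> \<le> (\<phi> i / m) * ((r + ?Q / r) / 2)"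
      proof -
        have "1 * ((r + ?Q / r) / 2) \<le> (\<phi> i / m) * ((r + ?Q / r) / 2)"
          using \<psi>i m r Q0 by (intro mult_right_mono) auto
        then show ?thesis by simp
      qed
      also have "\<dots> = H ?\<psi>" unfolding H_def \<psi>i by (simp add: algebra_simps add_divide_distrib)
      finally show ?thesis using True by simp
    next
      case False then show ?thesis using H0[OF thin0[OF \<phi>]] by simp
    qed
  qed (use q in auto)
  have X0: "0 \<le> X \<phi>" if "\<forall>w\<in>?V. m \<le> \<phi> w" for \<phi>
    unfolding X_def using v0[OF thin0[OF that]] by (intro mult_nonneg_nonneg sum_nonneg) auto
  have nnX: "(\<integral>\<^sup>+\<phi>. ennreal (X \<phi>) \<partial>N) \<le> ennreal (\<integral>\<psi>. H \<psi> \<partial>W.iid ?V)"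
  proof -
    have "(\<integral>\<^sup>+\<phi>. ennreal (X \<phi>) \<partial>N) \<le> (\<integral>\<^sup>+\<phi>. ennreal ((1 / real q) ^ n) * (\<Sum>c\<in>?T. ennreal (H (thin s s' ?V \<phi> c))) \<partial>N)"
    proof (rule nn_integral_mono_AE, use AEm in eventually_elim)
      case (elim \<phi>)
      have "ennreal (X \<phi>) \<le> ennreal ((1 / real q) ^ n * (\<Sum>c\<in>?T. H (thin s s' ?V \<phi> c)))" by (rule ennreal_leI[OF XH[OF elim]])
      also have "\<dots> = ennreal ((1 / real q) ^ n) * (\<Sum>c\<in>?T. ennreal (H (thin s s' ?V \<phi> c)))"
        using H0[OF thin0[OF elim]] by (subst ennreal_mult) (auto intro: sum_nonneg)
      finally show ?case .
    qed
    also have "\<dots> = ennreal ((1 / real q) ^ n) * (\<Sum>c\<in>?T. \<integral>\<^sup>+\<phi>. ennreal (H (thin s s' ?V \<phi> c)) \<partial>N)"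
      using Htm by (simp add: nn_integral_cmult nn_integral_sum)
    also have "\<dots> = (\<integral>\<^sup>+\<psi>. ennreal (H \<psi>) \<partial>W.iid ?V)"
      unfolding W.iid_def N_def
      using nn_integral_iid_thinned[OF prob_\<nu> sets_\<nu> q_ge_1, of ?V "\<lambda>\<psi>. ennreal (H \<psi>)" s s'] Hm by simp
    also have "\<dots> = ennreal (\<integral>\<psi>. H \<psi> \<partial>W.iid ?V)"
      using W.AE_iid_nonneg[of ?V] by (intro nn_integral_eq_integral iH) (auto elim!: eventually_mono intro: H0)
    finally show ?thesis .
  qed
  have AEX: "AE \<phi> in N. 0 \<le> X \<phi>" using AEm by eventually_elim (rule X0)
  have iX: "integrable N X"
    by (rule integrableI_nonneg[OF Xm AEX]) (use nnX in \<open>auto simp: top.not_eq_extremum intro: order_le_less_trans\<close>)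
  have intX: "(\<integral>\<phi>. X \<phi> \<partial>N) \<le> (\<integral>\<psi>. H \<psi> \<partial>W.iid ?V)"
  proof -
    have "0 \<le> (\<integral>\<psi>. H \<psi> \<partial>W.iid ?V)"
      by (rule integral_nonneg_AE) (use W.AE_iid_nonneg[of ?V] in \<open>auto elim!: eventually_mono intro: H0\<close>)
    then show ?thesis using nnX unfolding nn_integral_eq_integral[OF iX AEX] by simp
  qed
  let ?d = "\<lambda>t E \<phi>. \<Sum>\<tau>\<in>?T. (of_bool (\<tau> i = s) - of_bool (\<tau> i = s')) * of_bool (\<tau> j = t) * ((1 / real q) ^ n * graph_prob a b n \<tau> \<phi> E)"
  have id: "integrable N (?d t E)" for t E by (intro Bochner_Integration.integrable_sum integrable_mult_right gpi)
  have finG: "finite (graphs n)" unfolding graphs_eq using finite_pairs by auto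
  have "(\<Sum>t\<in>{1..q}. \<Sum>E\<in>graphs n. \<bar>\<Sum>\<tau>\<in>?T. (of_bool (\<tau> i = s) - of_bool (\<tau> i = s')) * of_bool (\<tau> j = t) *
      ((1 / real q) ^ n * (\<integral>\<phi>. graph_prob a b n \<tau> \<phi> E \<partial>N))\<bar>) = (\<Sum>t\<in>{1..q}. \<Sum>E\<in>graphs n. \<bar>\<integral>\<phi>. ?d t E \<phi> \<partial>N\<bar>)"
    by (intro sum.cong refl arg_cong[where f=abs], subst Bochner_Integration.integral_sum) (auto intro!: gpi integrable_mult_right)
  also have "\<dots> \<le> (\<Sum>t\<in>{1..q}. \<Sum>E\<in>graphs n. \<integral>\<phi>. \<bar>?d t E \<phi>\<bar> \<partial>N)"
    by (intro sum_mono integral_abs_bound)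
  also have "\<dots> = (\<integral>\<phi>. (\<Sum>t\<in>{1..q}. \<Sum>E\<in>graphs n. \<bar>?d t E \<phi>\<bar>) \<partial>N)"
  proof -
    have iabs: "integrable N (\<lambda>\<phi>. \<bar>?d t E \<phi>\<bar>)" for t E by (rule Bochner_Integration.integrable_abs[OF id])
    have "(\<Sum>t\<in>{1..q}. \<Sum>E\<in>graphs n. \<integral>\<phi>. \<bar>?d t E \<phi>\<bar> \<partial>N) = (\<Sum>t\<in>{1..q}. \<integral>\<phi>. (\<Sum>E\<in>graphs n. \<bar>?d t E \<phi>\<bar>) \<partial>N)"
      by (rule sum.cong[OF refl], rule Bochner_Integration.integral_sum[symmetric], rule iabs)
    also have "\<dots> = (\<integral>\<phi>. (\<Sum>t\<in>{1..q}. \<Sum>E\<in>graphs n. \<bar>?d t E \<phi>\<bar>) \<partial>N)"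
      by (rule Bochner_Integration.integral_sum[symmetric], rule Bochner_Integration.integrable_sum, rule iabs)
    finally show ?thesis .
  qed
  also have "\<dots> \<le> (\<integral>\<phi>. X \<phi> \<partial>N)"
  proof (rule integral_mono_AE)
    show "integrable N (\<lambda>\<phi>. \<Sum>t\<in>{1..q}. \<Sum>E\<in>graphs n. \<bar>?d t E \<phi>\<bar>)"
      by (rule Bochner_Integration.integrable_sum, rule Bochner_Integration.integrable_sum,
          rule Bochner_Integration.integrable_abs, rule id)
    show "AE \<phi> in N. (\<Sum>t\<in>{1..q}. \<Sum>E\<in>graphs n. \<bar>?d t E \<phi>\<bar>) \<le> X \<phi>" using AEm
    proof eventually_elim
      case (elim \<phi>)
      have e: "\<bar>?d t E \<phi>\<bar> = (1 / real q) ^ n * \<bar>\<Sum>\<tau>\<in>?T. (of_bool (\<tau> i = s) - of_bool (\<tau> i = s')) * of_bool (\<tau> j = t) * graph_prob a b n \<tau> \<phi> E\<bar>" for t E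
      proof -
        have "?d t E \<phi> = (1 / real q) ^ n * (\<Sum>\<tau>\<in>?T. (of_bool (\<tau> i = s) - of_bool (\<tau> i = s')) * of_bool (\<tau> j = t) * graph_prob a b n \<tau> \<phi> E)"
          unfolding sum_distrib_left by (intro sum.cong refl) (simp only: mult_ac)
        then show ?thesis by (simp add: abs_mult)
      qed
      have "(\<Sum>t\<in>{1..q}. \<Sum>E\<in>graphs n. \<bar>?d t E \<phi>\<bar>) = (1 / real q) ^ n * (\<Sum>t\<in>{1..q}. \<Sum>E\<in>graphs n.
         \<bar>\<Sum>\<tau>\<in>?T. (of_bool (\<tau> i = s) - of_bool (\<tau> i = s')) * of_bool (\<tau> j = t) * graph_prob a b n \<tau> \<phi> E\<bar>)"
        unfolding e sum_distrib_left ..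
      also have "\<dots> \<le> X \<phi>" unfolding X_def
      proof (intro mult_left_mono spin_difference s ij)
        fix w assume "w \<in> ?V"
        then show "0 \<le> \<phi> w" using elim m(1) by fastforce
      qed auto
      finally show ?case .
    qed
  qed (rule iX)
  also have "\<dots> \<le> (r * W.mom 1 + rho ?V ?V {j} i / r) / (2 * m)" using intX unfolding intH .
  finally show ?thesis unfolding N_def .
qed

end

section \<open>The posterior in the block model\<close>

context prob_space
begin

lemma integrable_indicator_event: "A \<in> events \<Longrightarrow> integrable M (indicator A :: 'a \<Rightarrow> real)"
  by (intro integrable_real_indicator) (auto simp: emeasure_eq_measure)

lemma indep_rv_prob:
  assumes "indep_rv N X N' Y" "A \<in> sets N" "B \<in> sets N'"
  shows "prob ((X -` A \<inter> space M) \<inter> (Y -` B \<inter> space M)) = prob (X -` A \<inter> space M) * prob (Y -` B \<inter> space M)"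
  using assms unfolding indep_rv_def sigma_gen_def
  by (intro indep_setD[of "sets (vimage_algebra (space M) X N)" "sets (vimage_algebra (space M) Y N')"] in_vimage_algebra) auto

lemma indep_rv_compose:
  fixes f :: "'x \<Rightarrow> real" and g :: "'y \<Rightarrow> real"
  assumes ind: "indep_rv N X N' Y" and f: "f \<in> borel_measurable N" and g: "g \<in> borel_measurable N'"
  shows "indep_var borel (\<lambda>\<omega>. f (X \<omega>)) borel (\<lambda>\<omega>. g (Y \<omega>))"
proof -
  have X: "random_variable N X" and Y: "random_variable N' Y" using ind by (auto simp: indep_rv_def)
  have fX: "random_variable borel (\<lambda>\<omega>. f (X \<omega>))" by (rule measurable_compose[OF X f])
  have gY: "random_variable borel (\<lambda>\<omega>. g (Y \<omega>))" by (rule measurable_compose[OF Y g])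
  have sub: "sigma_sets (space M) {(\<lambda>\<omega>. h (Z \<omega>)) -` A \<inter> space M | A. A \<in> sets borel} \<subseteq> sets (sigma_gen M Z K)"
    if Z: "random_variable K Z" and h: "h \<in> borel_measurable K" for Z :: "'a \<Rightarrow> 'z" and K and h :: "'z \<Rightarrow> real"
  proof -
    have "{(\<lambda>\<omega>. h (Z \<omega>)) -` A \<inter> space M | A. A \<in> sets borel} \<subseteq> sets (sigma_gen M Z K)"
    proof safe
      fix A :: "real set" assume "A \<in> sets borel"
      then have "h -` A \<inter> space K \<in> sets K" by (rule measurable_sets[OF h])
      then have "Z -` (h -` A \<inter> space K) \<inter> space M \<in> sets (sigma_gen M Z K)"
        unfolding sigma_gen_def by (rule in_vimage_algebra)
      moreover have "Z -` (h -` A \<inter> space K) \<inter> space M = (\<lambda>\<omega>. h (Z \<omega>)) -` A \<inter> space M"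
        using measurable_space[OF Z] by auto
      ultimately show "(\<lambda>\<omega>. h (Z \<omega>)) -` A \<inter> space M \<in> sets (sigma_gen M Z K)" by simp
    qed
    from sets.sigma_sets_subset[OF this] show ?thesis by (simp add: sigma_gen_def)
  qed
  have "indep_set (sigma_sets (space M) {(\<lambda>\<omega>. f (X \<omega>)) -` A \<inter> space M | A. A \<in> sets borel})
      (sigma_sets (space M) {(\<lambda>\<omega>. g (Y \<omega>)) -` A \<inter> space M | A. A \<in> sets borel})"
    using ind sub[OF X f] sub[OF Y g] unfolding indep_rv_def indep_set_def
    by (elim conjE) (erule indep_sets_mono_sets, auto split: bool.split)
  then show ?thesis unfolding indep_var_eq using fX gY by simp
qed

lemma subalgebra_sigma_gen:
  assumes "random_variable N X" shows "subalgebra M (sigma_gen M X N)"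
  using assms unfolding subalgebra_def sigma_gen_def by (auto simp: measurable_iff_sets)

text \<open>A conditional probability given a discrete variable \<open>Z\<close> is close to \<open>c\<close> if the joint
  probabilities are close to those of the product.\<close>

lemma cond_prob_deviation:
  assumes Z: "random_variable (count_space K) Z" and K: "finite K" and A: "A \<in> events" and \<epsilon>: "\<epsilon> > 0"
  shows "\<P>(\<omega> in M. \<bar>cond_prob_given M A Z (count_space K) \<omega> - c\<bar> > \<epsilon>) \<le>
    2 / \<epsilon> * (\<Sum>z\<in>K. \<bar>prob {\<omega> \<in> A. Z \<omega> = z} - c * prob {\<omega> \<in> space M. Z \<omega> = z}\<bar>)"
proof -
  let ?F = "sigma_gen M Z (count_space K)"
  let ?D = "\<Sum>z\<in>K. \<bar>prob {\<omega> \<in> A. Z \<omega> = z} - c * prob {\<omega> \<in> space M. Z \<omega> = z}\<bar>"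
  interpret S: finite_measure_subalgebra M ?F
    by unfold_locales (rule subalgebra_sigma_gen[OF Z])
  define p where "p = cond_prob_given M A Z (count_space K)"
  have iA: "integrable M (indicator A :: _ \<Rightarrow> real)" by (rule integrable_indicator_event[OF A])
  have pm: "p \<in> borel_measurable ?F" unfolding p_def cond_prob_given_def by simp
  have pM: "p \<in> borel_measurable M" unfolding p_def cond_prob_given_def by simp
  have ip: "integrable M p" unfolding p_def cond_prob_given_def by (rule S.real_cond_exp_int(1)[OF iA])
  have ZK: "Z \<in> space M \<rightarrow> space (count_space K)" using measurable_space[OF Z] by auto
  have spF: "space ?F = space M" by (simp add: sigma_gen_def)
  have meas_z: "{\<omega> \<in> space M. Z \<omega> = z} \<in> events" if "z \<in> K" for z
  proof -
    have "Z -` {z} \<inter> space M \<in> events" using measurable_sets[OF Z, of "{z}"] that by simp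
    moreover have "Z -` {z} \<inter> space M = {\<omega> \<in> space M. Z \<omega> = z}" by auto
    ultimately show ?thesis by simp
  qed
  \<comment> \<open>every event in the \<open>\<sigma>\<close>-algebra of \<open>Z\<close> is a union of fibres\<close>
  have key: "\<bar>(\<integral>\<omega>\<in>C. p \<omega> \<partial>M) - c * prob C\<bar> \<le> ?D" if C: "C \<in> sets ?F" for C
  proof -
    obtain B where B: "B \<subseteq> K" "C = Z -` B \<inter> space M"
      using C unfolding sigma_gen_def sets_vimage_algebra2[OF ZK] by auto
    have CM: "C \<in> events" using C S.subalg by (auto simp: subalgebra_def)
    have finB: "finite B" using B K finite_subset by auto
    have "(\<integral>\<omega>\<in>C. p \<omega> \<partial>M) = (\<integral>\<omega>\<in>C. indicator A \<omega> \<partial>M)"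
      unfolding p_def cond_prob_given_def by (rule S.real_cond_exp_intA[OF iA C, symmetric])
    also have "\<dots> = prob (A \<inter> C)"
    proof -
      have "(\<integral>\<omega>\<in>C. (indicator A \<omega> :: real) \<partial>M) = (\<integral>\<omega>. indicator (A \<inter> C) \<omega> \<partial>M)"
        unfolding set_lebesgue_integral_def by (intro Bochner_Integration.integral_cong) (auto simp: indicator_def)
      then show ?thesis using A CM by simp
    qed
    also have "A \<inter> C = (\<Union>z\<in>B. {\<omega> \<in> A. Z \<omega> = z})" using B sets.sets_into_space[OF A] by auto
    also have "prob \<dots> = (\<Sum>z\<in>B. prob {\<omega> \<in> A. Z \<omega> = z})"
    proof (rule finite_measure_finite_Union[OF finB])
      have "{\<omega> \<in> A. Z \<omega> = z} = A \<inter> {\<omega> \<in> space M. Z \<omega> = z}" for z using sets.sets_into_space[OF A] by auto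
      then show "(\<lambda>z. {\<omega> \<in> A. Z \<omega> = z}) ` B \<subseteq> events" using meas_z B A by auto
    qed (auto simp: disjoint_family_on_def)
    finally have 1: "(\<integral>\<omega>\<in>C. p \<omega> \<partial>M) = (\<Sum>z\<in>B. prob {\<omega> \<in> A. Z \<omega> = z})" .
    have "C = (\<Union>z\<in>B. {\<omega> \<in> space M. Z \<omega> = z})" using B by auto
    also have "prob \<dots> = (\<Sum>z\<in>B. prob {\<omega> \<in> space M. Z \<omega> = z})"
      by (rule finite_measure_finite_Union[OF finB]) (use meas_z B in \<open>auto simp: disjoint_family_on_def\<close>)
    finally have "(\<integral>\<omega>\<in>C. p \<omega> \<partial>M) - c * prob C = (\<Sum>z\<in>B. prob {\<omega> \<in> A. Z \<omega> = z} - c * prob {\<omega> \<in> space M. Z \<omega> = z})"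
      unfolding 1 by (simp add: sum_subtractf sum_distrib_left)
    also have "\<bar>\<dots>\<bar> \<le> (\<Sum>z\<in>B. \<bar>prob {\<omega> \<in> A. Z \<omega> = z} - c * prob {\<omega> \<in> space M. Z \<omega> = z}\<bar>)" by (rule sum_abs)
    also have "\<dots> \<le> ?D" using B K by (intro sum_mono2) auto
    finally show ?thesis .
  qed
  have dev: "\<epsilon> * prob C \<le> ?D" if C: "C \<in> sets ?F" and low: "\<And>\<omega>. \<omega> \<in> C \<Longrightarrow> \<epsilon> \<le> \<sigma> * (p \<omega> - c)" and \<sigma>: "\<bar>\<sigma>\<bar> = 1" for C \<sigma>
  proof -
    have CM: "C \<in> events" using C S.subalg by (auto simp: subalgebra_def)
    have iC: "set_integrable M C p" unfolding set_integrable_def by (rule integrable_mult_indicator[OF CM ip])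
    have "\<epsilon> * prob C = (\<integral>\<omega>. indicator C \<omega> * \<epsilon> \<partial>M)" using CM by simp
    also have "\<dots> \<le> (\<integral>\<omega>. indicator C \<omega> * (\<sigma> * (p \<omega> - c)) \<partial>M)"
    proof (rule integral_mono)
      show "integrable M (\<lambda>\<omega>. indicator C \<omega> * \<epsilon>)"
        by (intro integrable_mult_left integrable_indicator_event CM)
      show "integrable M (\<lambda>\<omega>. indicator C \<omega> * (\<sigma> * (p \<omega> - c)))"
        using integrable_mult_indicator[OF CM, of "\<lambda>\<omega>. \<sigma> * (p \<omega> - c)"] ip by simp
    qed (auto simp: indicator_def low)
    also have "\<dots> = (\<integral>\<omega>. \<sigma> * (indicator C \<omega> * p \<omega>) - (\<sigma> * c) * indicator C \<omega> \<partial>M)"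
      by (intro Bochner_Integration.integral_cong) (auto simp: algebra_simps)
    also have "\<dots> = \<sigma> * ((\<integral>\<omega>\<in>C. p \<omega> \<partial>M) - c * prob C)"
      using iC CM integrable_indicator_event[OF CM] by (subst Bochner_Integration.integral_diff) (auto simp: set_integrable_def set_lebesgue_integral_def algebra_simps)
    also have "\<dots> \<le> \<bar>\<sigma> * ((\<integral>\<omega>\<in>C. p \<omega> \<partial>M) - c * prob C)\<bar>" by simp
    also have "\<dots> \<le> ?D" unfolding abs_mult \<sigma> using key[OF C] by simp
    finally show ?thesis .
  qed
  let ?U = "{\<omega> \<in> space M. \<epsilon> < p \<omega> - c}" and ?L = "{\<omega> \<in> space M. \<epsilon> < c - p \<omega>}"
  have UF: "?U \<in> sets ?F" "?L \<in> sets ?F"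
    unfolding spF[symmetric] using pm by measurable
  then have UM: "?U \<in> events" "?L \<in> events" using S.subalg by (auto simp: subalgebra_def)
  have "\<epsilon> * prob ?U \<le> ?D" by (rule dev[OF UF(1), of 1]) auto
  moreover have "\<epsilon> * prob ?L \<le> ?D" by (rule dev[OF UF(2), of "-1"]) auto
  moreover have "\<P>(\<omega> in M. \<bar>p \<omega> - c\<bar> > \<epsilon>) \<le> prob ?U + prob ?L"
  proof -
    have "{\<omega> \<in> space M. \<bar>p \<omega> - c\<bar> > \<epsilon>} = ?U \<union> ?L" by auto
    then show ?thesis using measure_Un_le[OF UM] by simp
  qed
  then have "\<epsilon> * \<P>(\<omega> in M. \<bar>p \<omega> - c\<bar> > \<epsilon>) \<le> \<epsilon> * prob ?U + \<epsilon> * prob ?L"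
    using \<epsilon> by (simp add: distrib_left[symmetric])
  ultimately have "\<epsilon> * \<P>(\<omega> in M. \<bar>p \<omega> - c\<bar> > \<epsilon>) \<le> 2 * ?D" by linarith
  then show ?thesis unfolding p_def[symmetric] using \<epsilon> by (simp add: pos_le_divide_eq mult.commute)
qed

end

context dcsbm
begin

definition spin_vector :: "'w \<Rightarrow> nat \<Rightarrow> nat" where "spin_vector \<omega> = (\<lambda>w\<in>{1..n}. \<sigma> w \<omega>)"
definition weight_vector :: "'w \<Rightarrow> nat \<Rightarrow> real" where "weight_vector \<omega> = (\<lambda>w\<in>{1..n}. \<phi> w \<omega>)"

lemma vectors_indep: "indep_rv (spin_space q n) spin_vector (weight_space n) weight_vector"
  using spins_weights_indep by (simp add: spin_vector_def[abs_def] weight_vector_def[abs_def])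

lemma vectors_measurable: "random_variable (spin_space q n) spin_vector" "random_variable (weight_space n) weight_vector"
  using vectors_indep by (auto simp: indep_rv_def)

lemma singleton_spin_space: "\<tau> \<in> {1..n} \<rightarrow>\<^sub>E {1..q} \<Longrightarrow> {\<tau>} \<in> sets (spin_space q n)"
proof -
  assume \<tau>: "\<tau> \<in> {1..n} \<rightarrow>\<^sub>E {1..q}"
  have "(\<Pi>\<^sub>E w\<in>{1..n}. {\<tau> w}) \<in> sets (spin_space q n)"
    unfolding spin_space_def by (rule sets_PiM_I_finite) (use \<tau> in auto)
  moreover have "(\<Pi>\<^sub>E w\<in>{1..n}. {\<tau> w}) = {\<tau>}" using \<tau> by (simp add: PiE_singleton PiE_iff)
  ultimately show ?thesis by simp
qed

lemma spin_vector_range: "\<omega> \<in> space M \<Longrightarrow> spin_vector \<omega> \<in> {1..n} \<rightarrow>\<^sub>E {1..q}"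
  using measurable_space[OF vectors_measurable(1)] by (simp add: spin_space_def space_PiM)

lemma spin_vector_event: "\<tau> \<in> {1..n} \<rightarrow>\<^sub>E {1..q} \<Longrightarrow> {\<omega> \<in> space M. spin_vector \<omega> = \<tau>} \<in> events"
  using measurable_sets[OF vectors_measurable(1) singleton_spin_space] by (simp add: vimage_def Int_def conj_commute)

lemma graph_event: "E \<in> graphs n \<Longrightarrow> {\<omega> \<in> space M. G \<omega> = E} \<in> events"
  using measurable_sets[OF graph_measurable, of "{E}"] by (simp add: vimage_def Int_def conj_commute)

lemma prob_spin_vector:
  assumes n: "n \<ge> 1" and q: "q \<ge> 1" and \<tau>: "\<tau> \<in> {1..n} \<rightarrow>\<^sub>E {1..q}"
  shows "prob {\<omega> \<in> space M. spin_vector \<omega> = \<tau>} = (1 / real q) ^ n"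
proof -
  have one: "prob (\<sigma> w -` {\<tau> w} \<inter> space M) = 1 / real q" if w: "w \<in> {1..n}" for w
  proof -
    have m: "random_variable (count_space {1..q}) (\<sigma> w)" using spins_indep w by (auto simp: indep_vars_def)
    have t: "\<tau> w \<in> {1..q}" using \<tau> w by (auto simp: PiE_iff)
    have "prob (\<sigma> w -` {\<tau> w} \<inter> space M) = measure (distr M (count_space {1..q}) (\<sigma> w)) {\<tau> w}"
      using t by (subst measure_distr[OF m]) auto
    also have "\<dots> = 1 / real q" unfolding spins_uniform[OF w] using t by (subst measure_uniform_count_measure) auto
    finally show ?thesis .
  qed
  have "{\<omega> \<in> space M. spin_vector \<omega> = \<tau>} = (\<Inter>w\<in>{1..n}. \<sigma> w -` {\<tau> w} \<inter> space M)"
  proof (intro equalityI subsetI)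
    fix \<omega> assume "\<omega> \<in> {\<omega> \<in> space M. spin_vector \<omega> = \<tau>}"
    then show "\<omega> \<in> (\<Inter>w\<in>{1..n}. \<sigma> w -` {\<tau> w} \<inter> space M)" by (auto simp: spin_vector_def)
  next
    fix \<omega> assume \<omega>: "\<omega> \<in> (\<Inter>w\<in>{1..n}. \<sigma> w -` {\<tau> w} \<inter> space M)"
    then have "\<omega> \<in> space M" using n by auto
    moreover have "spin_vector \<omega> = \<tau>"
      using \<omega> \<tau> by (intro extensionalityI[of _ "{1..n}"]) (auto simp: spin_vector_def PiE_iff)
    ultimately show "\<omega> \<in> {\<omega> \<in> space M. spin_vector \<omega> = \<tau>}" by simp
  qed
  also have "prob \<dots> = (\<Prod>w\<in>{1..n}. prob (\<sigma> w -` {\<tau> w} \<inter> space M))"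
    by (rule indep_varsD_finite[OF spins_indep]) (use n \<tau> in \<open>auto simp: PiE_iff\<close>)
  also have "\<dots> = (1 / real q) ^ n" by (simp add: one)
  finally show ?thesis .
qed

lemma distr_weight_vector:
  assumes n: "n \<ge> 1" and sets: "sets \<nu> = sets borel"
  shows "distr M (\<Pi>\<^sub>M w\<in>{1..n}. borel) weight_vector = (\<Pi>\<^sub>M w\<in>{1..n}. \<nu>)"
proof -
  have "distr M (\<Pi>\<^sub>M w\<in>{1..n}. borel) weight_vector = (\<Pi>\<^sub>M w\<in>{1..n}. distr M borel (\<phi> w))"
    using indep_vars_iff_distr_eq_PiM'[of "{1..n}" \<phi> "\<lambda>_. borel"] weights_indep n
    by (auto simp: weight_vector_def[abs_def] indep_vars_def)
  also have "\<dots> = (\<Pi>\<^sub>M w\<in>{1..n}. \<nu>)" by (rule PiM_cong) (auto simp: weights_law)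
  finally show ?thesis .
qed

text \<open>The joint law of the spins and the graph.\<close>

lemma spins_graph_law:
  assumes n: "n \<ge> 1" and q: "q \<ge> 1" and sets: "sets \<nu> = sets borel"
    and \<tau>: "\<tau> \<in> {1..n} \<rightarrow>\<^sub>E {1..q}" and E: "E \<in> graphs n"
    and bounded: "AE \<psi> in (\<Pi>\<^sub>M w\<in>{1..n}. \<nu>). \<bar>graph_prob a b n \<tau> \<psi> E\<bar> \<le> 1"
    and meas: "(\<lambda>\<psi>. graph_prob a b n \<tau> \<psi> E) \<in> borel_measurable (\<Pi>\<^sub>M w\<in>{1..n}. borel)"
  shows "prob {\<omega> \<in> space M. spin_vector \<omega> = \<tau> \<and> G \<omega> = E} =
    (1 / real q) ^ n * (\<integral>\<psi>. graph_prob a b n \<tau> \<psi> E \<partial>(\<Pi>\<^sub>M w\<in>{1..n}. \<nu>))"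
proof -
  let ?X = "\<lambda>\<omega>. (spin_vector \<omega>, weight_vector \<omega>)"
  let ?F = "sigma_gen M ?X (spin_space q n \<Otimes>\<^sub>M weight_space n)"
  let ?A = "{\<omega> \<in> space M. G \<omega> = E}" and ?C = "{\<omega> \<in> space M. spin_vector \<omega> = \<tau>}"
  let ?g = "\<lambda>\<psi>. graph_prob a b n \<tau> \<psi> E"
  have Xm: "random_variable (spin_space q n \<Otimes>\<^sub>M weight_space n) ?X"
    using vectors_measurable by (rule measurable_Pair)
  interpret S: finite_measure_subalgebra M ?F by unfold_locales (rule subalgebra_sigma_gen[OF Xm])
  have A: "?A \<in> events" by (rule graph_event[OF E])
  have C: "?C \<in> events" by (rule spin_vector_event[OF \<tau>])
  have CF: "?C \<in> sets ?F"
  proof -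
    have "?X -` ({\<tau>} \<times> space (weight_space n)) \<inter> space M \<in> sets ?F"
      unfolding sigma_gen_def by (intro in_vimage_algebra pair_measureI singleton_spin_space \<tau>) auto
    moreover have "?X -` ({\<tau>} \<times> space (weight_space n)) \<inter> space M = ?C"
      using measurable_space[OF vectors_measurable(2)] by auto
    ultimately show ?thesis by simp
  qed
  have gm: "?g \<in> borel_measurable (weight_space n)" using meas by (simp add: weight_space_def)
  have gcond: "AE \<omega> in M. \<omega> \<in> ?C \<longrightarrow> real_cond_exp M ?F (indicator ?A) \<omega> = ?g (weight_vector \<omega>)"
    using graph_cond_law[OF E]
  proof eventually_elim
    case (elim \<omega>)
    show ?case
    proof
      assume "\<omega> \<in> ?C"
      then have t: "\<sigma> w \<omega> = \<tau> w" if "w \<in> {1..n}" for w using that by (auto simp: spin_vector_def)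
      have "graph_prob a b n (\<lambda>w. \<sigma> w \<omega>) (\<lambda>w. \<phi> w \<omega>) E = ?g (weight_vector \<omega>)"
        unfolding graph_prob_def
      proof (rule prod.cong[OF refl])
        fix p assume "p \<in> vert_pairs n"
        then obtain i j where p: "p = (i, j)" "i \<in> {1..n}" "j \<in> {1..n}" by (auto simp: vert_pairs_def)
        have "edge_prob a b n (\<lambda>w. \<sigma> w \<omega>) (\<lambda>w. \<phi> w \<omega>) i j = edge_prob a b n \<tau> (weight_vector \<omega>) i j"
          using t p by (simp add: edge_prob_def weight_vector_def)
        then show "(case p of (i, j) \<Rightarrow> if {i, j} \<in> E then edge_prob a b n (\<lambda>w. \<sigma> w \<omega>) (\<lambda>w. \<phi> w \<omega>) i j
             else 1 - edge_prob a b n (\<lambda>w. \<sigma> w \<omega>) (\<lambda>w. \<phi> w \<omega>) i j) =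
           (case p of (i, j) \<Rightarrow> if {i, j} \<in> E then edge_prob a b n \<tau> (weight_vector \<omega>) i j
             else 1 - edge_prob a b n \<tau> (weight_vector \<omega>) i j)"
          unfolding p(1) by simp
      qed
      then show "real_cond_exp M ?F (indicator ?A) \<omega> = ?g (weight_vector \<omega>)"
        using elim by (simp add: cond_prob_given_def spin_vector_def[abs_def] weight_vector_def[abs_def])
    qed
  qed
  have "prob {\<omega> \<in> space M. spin_vector \<omega> = \<tau> \<and> G \<omega> = E} = (\<integral>\<omega>\<in>?C. indicator ?A \<omega> \<partial>M)"
  proof -
    have "(\<integral>\<omega>\<in>?C. (indicator ?A \<omega> :: real) \<partial>M) = (\<integral>\<omega>. indicator (?C \<inter> ?A) \<omega> \<partial>M)"
      unfolding set_lebesgue_integral_def by (intro Bochner_Integration.integral_cong) (auto simp: indicator_def)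
    moreover have "?C \<inter> ?A = {\<omega> \<in> space M. spin_vector \<omega> = \<tau> \<and> G \<omega> = E}" by auto
    ultimately show ?thesis using A C by simp
  qed
  also have "\<dots> = (\<integral>\<omega>\<in>?C. real_cond_exp M ?F (indicator ?A) \<omega> \<partial>M)"
    by (rule S.real_cond_exp_intA[OF integrable_indicator_event[OF A] CF])
  also have "\<dots> = (\<integral>\<omega>. indicator ?C \<omega> * ?g (weight_vector \<omega>) \<partial>M)"
    unfolding set_lebesgue_integral_def
  proof (rule integral_cong_AE)
    show "AE \<omega> in M. indicator ?C \<omega> *\<^sub>R real_cond_exp M ?F (indicator ?A) \<omega> = indicator ?C \<omega> * ?g (weight_vector \<omega>)"
      using gcond by eventually_elim (auto simp: indicator_def)
    show "(\<lambda>\<omega>. indicator ?C \<omega> *\<^sub>R real_cond_exp M ?F (indicator ?A) \<omega>) \<in> borel_measurable M" using C by measurable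
    have "(\<lambda>\<omega>. ?g (weight_vector \<omega>)) \<in> borel_measurable M" by (rule measurable_compose[OF vectors_measurable(2) gm])
    then show "(\<lambda>\<omega>. indicator ?C \<omega> * ?g (weight_vector \<omega>)) \<in> borel_measurable M" using C by measurable
  qed
  also have "\<dots> = (\<integral>\<omega>. indicator {\<tau>} (spin_vector \<omega>) * ?g (weight_vector \<omega>) \<partial>M)"
    by (intro Bochner_Integration.integral_cong) (auto simp: indicator_def)
  also have "\<dots> = (\<integral>\<omega>. indicator {\<tau>} (spin_vector \<omega>) \<partial>M) * (\<integral>\<omega>. ?g (weight_vector \<omega>) \<partial>M)"
  proof (rule indep_var_lebesgue_integral)
    show "indep_var borel (\<lambda>\<omega>. indicator {\<tau>} (spin_vector \<omega>) :: real) borel (\<lambda>\<omega>. ?g (weight_vector \<omega>))"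
      by (rule indep_rv_compose[OF vectors_indep _ gm]) (use singleton_spin_space[OF \<tau>] in measurable)
    have "integrable M (indicator ?C :: _ \<Rightarrow> real)" by (rule integrable_indicator_event[OF C])
    then show "integrable M (\<lambda>\<omega>. indicator {\<tau>} (spin_vector \<omega>) :: real)"
      by (rule Bochner_Integration.integrable_cong[THEN iffD1, rotated 2]) (auto simp: indicator_def)
    have "AE \<psi> in distr M (weight_space n) weight_vector. \<bar>?g \<psi>\<bar> \<le> 1"
      using bounded unfolding weight_space_def distr_weight_vector[OF n sets] .
    then have "AE \<omega> in M. \<bar>?g (weight_vector \<omega>)\<bar> \<le> 1"
      by (rule AE_distrD[OF vectors_measurable(2)])
    then show "integrable M (\<lambda>\<omega>. ?g (weight_vector \<omega>))"
      by (intro integrable_const_bound[where B=1] measurable_compose[OF vectors_measurable(2) gm]) auto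
  qed
  also have "(\<integral>\<omega>. indicator {\<tau>} (spin_vector \<omega>) \<partial>M) = prob ?C"
  proof -
    have "(\<integral>\<omega>. (indicator {\<tau>} (spin_vector \<omega>) :: real) \<partial>M) = (\<integral>\<omega>. indicator ?C \<omega> \<partial>M)"
      by (intro Bochner_Integration.integral_cong) (auto simp: indicator_def)
    then show ?thesis using C by simp
  qed
  also have "prob ?C = (1 / real q) ^ n" by (rule prob_spin_vector[OF n q \<tau>])
  also have "(\<integral>\<omega>. ?g (weight_vector \<omega>) \<partial>M) = (\<integral>\<psi>. ?g \<psi> \<partial>distr M (weight_space n) weight_vector)"
    by (rule integral_distr[OF vectors_measurable(2) gm, symmetric])
  also have "distr M (weight_space n) weight_vector = (\<Pi>\<^sub>M w\<in>{1..n}. \<nu>)"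
    unfolding weight_space_def by (rule distr_weight_vector[OF n sets])
  finally show ?thesis .
qed

end

text \<open>The probability that \<open>i\<close> and \<open>j\<close> have the spins \<open>s\<close> and \<open>t\<close> and the graph is \<open>E\<close>.\<close>

definition pair_graph_prob ::
  "nat \<Rightarrow> real \<Rightarrow> real \<Rightarrow> nat \<Rightarrow> real measure \<Rightarrow> nat \<Rightarrow> nat \<Rightarrow> nat \<Rightarrow> nat \<Rightarrow> nat set set \<Rightarrow> real" where
  "pair_graph_prob q a b n \<nu> i j s t E = (\<Sum>\<tau>\<in>{1..n} \<rightarrow>\<^sub>E {1..q}. of_bool (\<tau> i = s) * of_bool (\<tau> j = t) *
     ((1 / real q) ^ n * (\<integral>\<phi>. graph_prob a b n \<tau> \<phi> E \<partial>(\<Pi>\<^sub>M w\<in>{1..n}. \<nu>))))"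

context dcsbm_two_vertices
begin

lemma vertex_pair_law:
  assumes n: "n \<ge> 1" and xy: "x \<in> {1..n}" "y \<in> {1..n}"
  shows "prob {\<omega> \<in> space M. u \<omega> = x \<and> v \<omega> = y} = 1 / (real n)\<^sup>2"
proof -
  have um: "random_variable (count_space (verts n)) u" and vm: "random_variable (count_space (verts n)) v"
    using uv_indep by (auto simp: indep_var_eq)
  have "prob (u -` {x} \<inter> space M) = measure (distr M (count_space (verts n)) u) {x}"
    using xy by (subst measure_distr[OF um]) auto
  then have pu: "prob (u -` {x} \<inter> space M) = 1 / real n"
    unfolding u_uniform using xy by (simp add: measure_uniform_count_measure)
  have "prob (v -` {y} \<inter> space M) = measure (distr M (count_space (verts n)) v) {y}"
    using xy by (subst measure_distr[OF vm]) auto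
  then have pv: "prob (v -` {y} \<inter> space M) = 1 / real n"
    unfolding v_uniform using xy by (simp add: measure_uniform_count_measure)
  have "{\<omega> \<in> space M. u \<omega> = x \<and> v \<omega> = y} = (\<lambda>\<omega>. (u \<omega>, v \<omega>)) -` ({x} \<times> {y}) \<inter> space M" by auto
  also have "prob \<dots> = prob (u -` {x} \<inter> space M) * prob (v -` {y} \<inter> space M)"
    by (rule indep_varD[OF uv_indep]) (use xy in auto)
  finally show ?thesis unfolding pu pv by (simp add: power2_eq_square)
qed

lemma vertices_spins_graph_law:
  assumes n: "n \<ge> 1" and xy: "x \<in> {1..n}" "y \<in> {1..n}" and \<tau>: "\<tau> \<in> {1..n} \<rightarrow>\<^sub>E {1..q}" and E: "E \<in> graphs n"
  shows "prob {\<omega> \<in> space M. u \<omega> = x \<and> v \<omega> = y \<and> spin_vector \<omega> = \<tau> \<and> G \<omega> = E} =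
    1 / (real n)\<^sup>2 * prob {\<omega> \<in> space M. spin_vector \<omega> = \<tau> \<and> G \<omega> = E}"
proof -
  let ?Y = "\<lambda>\<omega>. ((spin_vector \<omega>, weight_vector \<omega>), G \<omega>)"
  have ind: "indep_rv (count_space (verts n) \<Otimes>\<^sub>M count_space (verts n)) (\<lambda>\<omega>. (u \<omega>, v \<omega>))
         ((spin_space q n \<Otimes>\<^sub>M weight_space n) \<Otimes>\<^sub>M count_space (graphs n)) ?Y"
    using uv_model_indep by (simp add: spin_vector_def[abs_def] weight_vector_def[abs_def])
  have "{x} \<times> {y} \<in> sets (count_space (verts n) \<Otimes>\<^sub>M count_space (verts n))" using xy by (intro pair_measureI) auto
  moreover have "({\<tau>} \<times> space (weight_space n)) \<times> {E} \<in> sets ((spin_space q n \<Otimes>\<^sub>M weight_space n) \<Otimes>\<^sub>M count_space (graphs n))"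
    using E by (intro pair_measureI singleton_spin_space \<tau>) auto
  ultimately have "prob (((\<lambda>\<omega>. (u \<omega>, v \<omega>)) -` ({x} \<times> {y}) \<inter> space M) \<inter> (?Y -` (({\<tau>} \<times> space (weight_space n)) \<times> {E}) \<inter> space M)) =
    prob ((\<lambda>\<omega>. (u \<omega>, v \<omega>)) -` ({x} \<times> {y}) \<inter> space M) * prob (?Y -` (({\<tau>} \<times> space (weight_space n)) \<times> {E}) \<inter> space M)"
    by (rule indep_rv_prob[OF ind])
  moreover have "(\<lambda>\<omega>. (u \<omega>, v \<omega>)) -` ({x} \<times> {y}) \<inter> space M = {\<omega> \<in> space M. u \<omega> = x \<and> v \<omega> = y}" by auto
  moreover have "?Y -` (({\<tau>} \<times> space (weight_space n)) \<times> {E}) \<inter> space M = {\<omega> \<in> space M. spin_vector \<omega> = \<tau> \<and> G \<omega> = E}"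
    using measurable_space[OF vectors_measurable(2)] by auto
  moreover have "{\<omega> \<in> space M. u \<omega> = x \<and> v \<omega> = y} \<inter> {\<omega> \<in> space M. spin_vector \<omega> = \<tau> \<and> G \<omega> = E} =
    {\<omega> \<in> space M. u \<omega> = x \<and> v \<omega> = y \<and> spin_vector \<omega> = \<tau> \<and> G \<omega> = E}" by auto
  ultimately show ?thesis using vertex_pair_law[OF n xy] by simp
qed

lemma u_v_measurable:
  "random_variable (count_space (verts n)) u" "random_variable (count_space (verts n)) v"
  using uv_indep by (auto simp: indep_var_eq)

lemma u_v_range: "\<omega> \<in> space M \<Longrightarrow> u \<omega> \<in> {1..n}" "\<omega> \<in> space M \<Longrightarrow> v \<omega> \<in> {1..n}"
  using u_v_measurable[THEN measurable_space] by auto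

lemma joint_event:
  assumes xy: "x \<in> {1..n}" "y \<in> {1..n}" and \<tau>: "\<tau> \<in> {1..n} \<rightarrow>\<^sub>E {1..q}" and E: "E \<in> graphs n"
  shows "{\<omega> \<in> space M. u \<omega> = x \<and> v \<omega> = y \<and> spin_vector \<omega> = \<tau> \<and> G \<omega> = E} \<in> events"
proof -
  have "{\<omega> \<in> space M. u \<omega> = x} \<in> events" "{\<omega> \<in> space M. v \<omega> = y} \<in> events"
    using measurable_sets[OF u_v_measurable(1), of "{x}"] measurable_sets[OF u_v_measurable(2), of "{y}"] xy
    by (simp_all add: vimage_def Int_def conj_commute)
  then have "({\<omega> \<in> space M. u \<omega> = x} \<inter> {\<omega> \<in> space M. v \<omega> = y}) \<inter> ({\<omega> \<in> space M. spin_vector \<omega> = \<tau>} \<inter> {\<omega> \<in> space M. G \<omega> = E}) \<in> events"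
    by (intro sets.Int spin_vector_event[OF \<tau>] graph_event[OF E])
  moreover have "({\<omega> \<in> space M. u \<omega> = x} \<inter> {\<omega> \<in> space M. v \<omega> = y}) \<inter> ({\<omega> \<in> space M. spin_vector \<omega> = \<tau>} \<inter> {\<omega> \<in> space M. G \<omega> = E})
     = {\<omega> \<in> space M. u \<omega> = x \<and> v \<omega> = y \<and> spin_vector \<omega> = \<tau> \<and> G \<omega> = E}" by auto
  ultimately show ?thesis by simp
qed

lemma finite_spins: "finite ({1..n} \<rightarrow>\<^sub>E {1..q})" by (intro finite_PiE) auto

text \<open>An event decided by \<open>u\<close>, \<open>v\<close>, the spins and the graph is a finite union of atoms.\<close>

lemma atoms_event:
  assumes xy: "x \<in> {1..n}" "y \<in> {1..n}" and E: "E \<in> graphs n"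
  shows "{\<omega> \<in> space M. u \<omega> = x \<and> v \<omega> = y \<and> G \<omega> = E \<and> P (spin_vector \<omega>)} \<in> events"
    "prob {\<omega> \<in> space M. u \<omega> = x \<and> v \<omega> = y \<and> G \<omega> = E \<and> P (spin_vector \<omega>)} =
      (\<Sum>\<tau>\<in>{1..n} \<rightarrow>\<^sub>E {1..q}. of_bool (P \<tau>) * prob {\<omega> \<in> space M. u \<omega> = x \<and> v \<omega> = y \<and> spin_vector \<omega> = \<tau> \<and> G \<omega> = E})"
proof -
  let ?T = "{1..n} \<rightarrow>\<^sub>E {1..q}"
  let ?at = "\<lambda>\<tau>. {\<omega> \<in> space M. u \<omega> = x \<and> v \<omega> = y \<and> spin_vector \<omega> = \<tau> \<and> G \<omega> = E}"
  have eq: "{\<omega> \<in> space M. u \<omega> = x \<and> v \<omega> = y \<and> G \<omega> = E \<and> P (spin_vector \<omega>)} = (\<Union>\<tau>\<in>{\<tau> \<in> ?T. P \<tau>}. ?at \<tau>)"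
    using spin_vector_range by auto
  have fin: "finite {\<tau> \<in> ?T. P \<tau>}" using finite_spins by simp
  have ev: "?at ` {\<tau> \<in> ?T. P \<tau>} \<subseteq> events" using joint_event[OF xy _ E] by auto
  show "{\<omega> \<in> space M. u \<omega> = x \<and> v \<omega> = y \<and> G \<omega> = E \<and> P (spin_vector \<omega>)} \<in> events"
    unfolding eq using fin ev by (intro sets.finite_UN) auto
  have "prob (\<Union>\<tau>\<in>{\<tau> \<in> ?T. P \<tau>}. ?at \<tau>) = (\<Sum>\<tau>\<in>{\<tau> \<in> ?T. P \<tau>}. prob (?at \<tau>))"
    by (rule finite_measure_finite_Union[OF fin ev]) (auto simp: disjoint_family_on_def)
  also have "\<dots> = (\<Sum>\<tau>\<in>?T. of_bool (P \<tau>) * prob (?at \<tau>))"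
    using finite_spins by (intro sum.mono_neutral_cong_left) auto
  finally show "prob {\<omega> \<in> space M. u \<omega> = x \<and> v \<omega> = y \<and> G \<omega> = E \<and> P (spin_vector \<omega>)} = (\<Sum>\<tau>\<in>?T. of_bool (P \<tau>) * prob (?at \<tau>))"
    unfolding eq .
qed

text \<open>The bound \<open>B\<close> is needed for distinct vertices only: the diagonal \<open>u = v\<close> has probability \<open>1 / n\<close>.\<close>

lemma posterior_deviation:
  assumes n: "n \<ge> 1" and q: "q \<ge> 1" and ab: "a > 0" "b > 0" and prob_\<nu>: "prob_space \<nu>" and sets: "sets \<nu> = sets borel"
    and nn: "AE x in \<nu>. 0 \<le> x" and s: "s \<in> {1..q}" and \<epsilon>: "\<epsilon> > 0"
    and B: "\<And>x y s'. x \<in> {1..n} \<Longrightarrow> y \<in> {1..n} \<Longrightarrow> x \<noteq> y \<Longrightarrow> s' \<in> {1..q} \<Longrightarrow>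
      (\<Sum>t\<in>{1..q}. \<Sum>E\<in>graphs n. \<bar>pair_graph_prob q a b n \<nu> x y s t E - pair_graph_prob q a b n \<nu> x y s' t E\<bar>) \<le> B"
    and B0: "0 \<le> B"
  shows "\<P>(\<omega> in M. \<bar>spin_posterior M q n \<sigma> G u v s \<omega> - 1 / real q\<bar> > \<epsilon>) \<le> 2 / \<epsilon> * (B + 2 / real n)"
proof -
  interpret two_block a b n by unfold_locales (use ab n in auto)
  let ?T = "{1..n} \<rightarrow>\<^sub>E {1..q}"
  let ?pg = "pair_graph_prob q a b n \<nu>"
  define K where "K = verts n \<times> verts n \<times> {1..q} \<times> graphs n"
  define Z where "Z = (\<lambda>\<omega>. (u \<omega>, v \<omega>, \<sigma> (v \<omega>) \<omega>, G \<omega>))"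
  define A where "A = {\<omega> \<in> space M. \<sigma> (u \<omega>) \<omega> = s}"
  define wt where "wt \<tau> E = (1 / real q) ^ n * (\<integral>\<phi>. graph_prob a b n \<tau> \<phi> E \<partial>(\<Pi>\<^sub>M w\<in>{1..n}. \<nu>))" for \<tau> E
  have finG: "finite (graphs n)" unfolding graphs_eq using finite_pairs by auto
  have finK: "finite K" using finG by (simp add: K_def)
  have AEn: "AE \<psi> in (\<Pi>\<^sub>M w\<in>{1..n}. \<nu>). \<forall>w\<in>{1..n}. 0 \<le> \<psi> w"
    by (intro AE_finite_allI AE_PiM_component[OF prob_\<nu> _ nn]) auto
  have bd: "AE \<psi> in (\<Pi>\<^sub>M w\<in>{1..n}. \<nu>). \<bar>graph_prob a b n \<tau> \<psi> E\<bar> \<le> 1" for \<tau> E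
    using AEn by eventually_elim (use graph_prob_range in \<open>auto simp: abs_of_nonneg\<close>)
  have law: "prob {\<omega> \<in> space M. spin_vector \<omega> = \<tau> \<and> G \<omega> = E} = wt \<tau> E" if "\<tau> \<in> ?T" "E \<in> graphs n" for \<tau> E
    unfolding wt_def by (rule spins_graph_law[OF n q sets that bd graph_prob_measurable])
  have wt0: "0 \<le> wt \<tau> E" for \<tau> E
    unfolding wt_def using AEn by (intro mult_nonneg_nonneg integral_nonneg_AE) (auto elim!: eventually_mono intro: graph_prob_range)
  have sig: "\<sigma> w \<omega> = spin_vector \<omega> w" if "w \<in> {1..n}" for w \<omega> using that by (simp add: spin_vector_def)
  have sub_K: "Z \<omega> \<in> K" if "\<omega> \<in> space M" for \<omega>
  proof -
    have "\<sigma> (v \<omega>) \<omega> \<in> {1..q}"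
      using spin_vector_range[OF that] u_v_range(2)[OF that] by (simp add: sig PiE_iff)
    then show ?thesis using u_v_range[OF that] measurable_space[OF graph_measurable that] by (simp add: Z_def K_def)
  qed
  have fibre: "{\<omega> \<in> space M. Z \<omega> = (x, y, t, E)} = {\<omega> \<in> space M. u \<omega> = x \<and> v \<omega> = y \<and> G \<omega> = E \<and> spin_vector \<omega> y = t}"
    if "(x, y, t, E) \<in> K" for x y t E using that by (auto simp: Z_def K_def sig)
  have Afibre: "{\<omega> \<in> A. Z \<omega> = (x, y, t, E)} = {\<omega> \<in> space M. u \<omega> = x \<and> v \<omega> = y \<and> G \<omega> = E \<and> (spin_vector \<omega> x = s \<and> spin_vector \<omega> y = t)}"
    if "(x, y, t, E) \<in> K" for x y t E using that by (auto simp: A_def Z_def K_def sig)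
  have Zm: "random_variable (count_space K) Z"
  proof (subst measurable_count_space_eq2[OF finK], intro conjI ballI)
    show "Z \<in> space M \<rightarrow> K" using sub_K by auto
    fix z assume z: "z \<in> K"
    obtain x y t E where zz: "z = (x, y, t, E)" by (cases z) auto
    have "Z -` {z} \<inter> space M = {\<omega> \<in> space M. Z \<omega> = (x, y, t, E)}" by (auto simp: zz)
    also have "\<dots> \<in> events" unfolding fibre[OF z[unfolded zz]]
      using z atoms_event(1)[of x y E "\<lambda>\<tau>. \<tau> y = t"] by (simp add: zz K_def)
    finally show "Z -` {z} \<inter> space M \<in> events" .
  qed
  have Am: "A \<in> events"
  proof -
    have "A = (\<Union>z\<in>K. {\<omega> \<in> A. Z \<omega> = z})" using sub_K by (auto simp: A_def)
    moreover have "{\<omega> \<in> A. Z \<omega> = z} \<in> events" if z: "z \<in> K" for z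
    proof -
      obtain x y t E where zz: "z = (x, y, t, E)" by (cases z) auto
      show ?thesis unfolding zz Afibre[OF z[unfolded zz]]
        using z atoms_event(1)[of x y E "\<lambda>\<tau>. \<tau> x = s \<and> \<tau> y = t"] by (simp add: zz K_def)
    qed
    ultimately show ?thesis using finK by (metis (no_types, lifting) sets.finite_UN)
  qed
  have pA: "prob {\<omega> \<in> A. Z \<omega> = (x, y, t, E)} = 1 / (real n)\<^sup>2 * ?pg x y s t E" if z: "(x, y, t, E) \<in> K" for x y t E
  proof -
    have zz: "x \<in> {1..n}" "y \<in> {1..n}" "E \<in> graphs n" using z by (auto simp: K_def)
    have "prob {\<omega> \<in> A. Z \<omega> = (x, y, t, E)} = (\<Sum>\<tau>\<in>?T. of_bool (\<tau> x = s \<and> \<tau> y = t) * (1 / (real n)\<^sup>2 * wt \<tau> E))"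
      unfolding Afibre[OF z] atoms_event(2)[OF zz, of "\<lambda>\<tau>. \<tau> x = s \<and> \<tau> y = t"]
      by (intro sum.cong refl) (simp only: vertices_spins_graph_law[OF n zz(1,2) _ zz(3)] law[OF _ zz(3)])
    then show ?thesis unfolding pair_graph_prob_def wt_def[symmetric] sum_distrib_left by (simp add: of_bool_conj mult_ac)
  qed
  have pZ: "prob {\<omega> \<in> space M. Z \<omega> = (x, y, t, E)} = 1 / (real n)\<^sup>2 * (\<Sum>s'\<in>{1..q}. ?pg x y s' t E)"
    if z: "(x, y, t, E) \<in> K" for x y t E
  proof -
    have zz: "x \<in> {1..n}" "y \<in> {1..n}" "E \<in> graphs n" using z by (auto simp: K_def)
    have "prob {\<omega> \<in> space M. Z \<omega> = (x, y, t, E)} = (\<Sum>\<tau>\<in>?T. of_bool (\<tau> y = t) * (1 / (real n)\<^sup>2 * wt \<tau> E))"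
      unfolding fibre[OF z] atoms_event(2)[OF zz, of "\<lambda>\<tau>. \<tau> y = t"]
      by (intro sum.cong refl) (simp only: vertices_spins_graph_law[OF n zz(1,2) _ zz(3)] law[OF _ zz(3)])
    also have "\<dots> = (\<Sum>\<tau>\<in>?T. \<Sum>s'\<in>{1..q}. 1 / (real n)\<^sup>2 * (of_bool (\<tau> x = s') * of_bool (\<tau> y = t) * wt \<tau> E))"
    proof (rule sum.cong[OF refl])
      fix \<tau> assume "\<tau> \<in> ?T"
      then have "\<tau> x \<in> {1..q}" using zz by (auto simp: PiE_iff)
      then have "(\<Sum>s'\<in>{1..q}. of_bool (\<tau> x = s')) = (1 :: real)" by (simp add: of_bool_def)
      then show "of_bool (\<tau> y = t) * (1 / (real n)\<^sup>2 * wt \<tau> E) = (\<Sum>s'\<in>{1..q}. 1 / (real n)\<^sup>2 * (of_bool (\<tau> x = s') * of_bool (\<tau> y = t) * wt \<tau> E))"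
        unfolding sum_distrib_left[symmetric] sum_distrib_right[symmetric] by simp
    qed
    also have "\<dots> = 1 / (real n)\<^sup>2 * (\<Sum>s'\<in>{1..q}. ?pg x y s' t E)"
      unfolding pair_graph_prob_def wt_def[symmetric] sum_distrib_left by (rule sum.swap)
    finally show ?thesis .
  qed
  have pg0: "0 \<le> ?pg x y s' t E" for x y s' t E
    unfolding pair_graph_prob_def wt_def[symmetric] using wt0 by (intro sum_nonneg mult_nonneg_nonneg) auto
  have total: "(\<Sum>t\<in>{1..q}. \<Sum>E\<in>graphs n. ?pg x y s' t E) \<le> 1" for x y s'
  proof -
    have "(\<Sum>t\<in>{1..q}. \<Sum>E\<in>graphs n. ?pg x y s' t E) = (\<Sum>E\<in>graphs n. \<Sum>\<tau>\<in>?T. of_bool (\<tau> x = s') * (\<Sum>t\<in>{1..q}. of_bool (\<tau> y = t)) * wt \<tau> E)"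
      unfolding pair_graph_prob_def wt_def[symmetric]
      by (subst sum.swap, rule sum.cong[OF refl], subst sum.swap) (simp only: sum_distrib_left sum_distrib_right)
    also have "\<dots> \<le> (\<Sum>E\<in>graphs n. \<Sum>\<tau>\<in>?T. wt \<tau> E)"
    proof (intro sum_mono)
      fix \<tau> E
      have "(\<Sum>t\<in>{1..q}. of_bool (\<tau> y = t)) \<le> (1 :: real)" by (simp add: of_bool_def)
      then have "of_bool (\<tau> x = s') * (\<Sum>t\<in>{1..q}. of_bool (\<tau> y = t)) \<le> (1 :: real)" by (cases "\<tau> x = s'") auto
      from mult_right_mono[OF this wt0[of \<tau> E]]
      show "of_bool (\<tau> x = s') * (\<Sum>t\<in>{1..q}. of_bool (\<tau> y = t)) * wt \<tau> E \<le> wt \<tau> E"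
        by (simp only: mult_1)
    qed
    also have "\<dots> = (\<Sum>p\<in>graphs n \<times> ?T. prob {\<omega> \<in> space M. spin_vector \<omega> = snd p \<and> G \<omega> = fst p})"
      unfolding sum.cartesian_product by (intro sum.cong refl) (auto simp: law)
    also have "\<dots> = prob (\<Union>p\<in>graphs n \<times> ?T. {\<omega> \<in> space M. spin_vector \<omega> = snd p \<and> G \<omega> = fst p})"
    proof (rule finite_measure_finite_Union[symmetric])
      show "(\<lambda>p. {\<omega> \<in> space M. spin_vector \<omega> = snd p \<and> G \<omega> = fst p}) ` (graphs n \<times> ?T) \<subseteq> events"
      proof safe
        fix E \<tau> assume "E \<in> graphs n" "\<tau> \<in> ?T"
        then have "{\<omega> \<in> space M. spin_vector \<omega> = \<tau>} \<inter> {\<omega> \<in> space M. G \<omega> = E} \<in> events"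
          by (intro sets.Int spin_vector_event graph_event)
        moreover have "{\<omega> \<in> space M. spin_vector \<omega> = \<tau>} \<inter> {\<omega> \<in> space M. G \<omega> = E} = {\<omega> \<in> space M. spin_vector \<omega> = snd (E, \<tau>) \<and> G \<omega> = fst (E, \<tau>)}" by auto
        ultimately show "{\<omega> \<in> space M. spin_vector \<omega> = snd (E, \<tau>) \<and> G \<omega> = fst (E, \<tau>)} \<in> events" by simp
      qed
    qed (use finG finite_spins in \<open>auto simp: disjoint_family_on_def\<close>)
    also have "\<dots> \<le> 1" by (rule prob_le_1)
    finally show ?thesis .
  qed
  have diff: "(\<Sum>t\<in>{1..q}. \<Sum>E\<in>graphs n. \<bar>?pg x y s t E - ?pg x y s' t E\<bar>) \<le> B + (if x = y then 2 else 0)"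
    if "x \<in> {1..n}" "y \<in> {1..n}" "s' \<in> {1..q}" for x y s'
  proof (cases "x = y")
    case True
    have "(\<Sum>t\<in>{1..q}. \<Sum>E\<in>graphs n. \<bar>?pg x y s t E - ?pg x y s' t E\<bar>) \<le> (\<Sum>t\<in>{1..q}. \<Sum>E\<in>graphs n. ?pg x y s t E + ?pg x y s' t E)"
      by (intro sum_mono) (use pg0 in \<open>smt (verit)\<close>)
    also have "\<dots> \<le> 1 + 1" unfolding sum.distrib by (intro add_mono total)
    finally show ?thesis using True B0 by simp
  next
    case False then show ?thesis using B that by simp
  qed
  have "(\<Sum>z\<in>K. \<bar>prob {\<omega> \<in> A. Z \<omega> = z} - 1 / real q * prob {\<omega> \<in> space M. Z \<omega> = z}\<bar>) =
    (\<Sum>x\<in>{1..n}. \<Sum>y\<in>{1..n}. \<Sum>t\<in>{1..q}. \<Sum>E\<in>graphs n. \<bar>1 / (real n)\<^sup>2 * ?pg x y s t E - 1 / real q * (1 / (real n)\<^sup>2 * (\<Sum>s'\<in>{1..q}. ?pg x y s' t E))\<bar>)"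
    unfolding K_def sum.cartesian_product'
    by (intro sum.cong refl) (simp add: pA pZ K_def)
  also have "\<dots> \<le> (\<Sum>x\<in>{1..n}. \<Sum>y\<in>{1..n}. \<Sum>t\<in>{1..q}. \<Sum>E\<in>graphs n. 1 / (real n)\<^sup>2 * (1 / real q) * (\<Sum>s'\<in>{1..q}. \<bar>?pg x y s t E - ?pg x y s' t E\<bar>))"
  proof (intro sum_mono)
    fix x y t E
    have eq: "1 / (real n)\<^sup>2 * ?pg x y s t E - 1 / real q * (1 / (real n)\<^sup>2 * (\<Sum>s'\<in>{1..q}. ?pg x y s' t E))
      = 1 / (real n)\<^sup>2 * (1 / real q) * (\<Sum>s'\<in>{1..q}. ?pg x y s t E - ?pg x y s' t E)"
    proof -
      have "c * p - 1 / Q * (c * S) = c * (1 / Q) * (Q * p - S)" if "Q \<noteq> 0" for c p Q S :: real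
        using that by (simp add: field_simps)
      from this[of "real q"] q have "c * p - 1 / real q * (c * S) = c * (1 / real q) * (real q * p - S)" for c p S
        by simp
      moreover have "(\<Sum>s'\<in>{1..q}. ?pg x y s t E - ?pg x y s' t E) = real q * ?pg x y s t E - (\<Sum>s'\<in>{1..q}. ?pg x y s' t E)"
        by (simp add: sum_subtractf)
      ultimately show ?thesis by (simp only:)
    qed
    have "\<bar>1 / (real n)\<^sup>2 * ?pg x y s t E - 1 / real q * (1 / (real n)\<^sup>2 * (\<Sum>s'\<in>{1..q}. ?pg x y s' t E))\<bar>
        = 1 / (real n)\<^sup>2 * (1 / real q) * \<bar>\<Sum>s'\<in>{1..q}. ?pg x y s t E - ?pg x y s' t E\<bar>"
      unfolding eq abs_mult by simp
    also have "\<dots> \<le> 1 / (real n)\<^sup>2 * (1 / real q) * (\<Sum>s'\<in>{1..q}. \<bar>?pg x y s t E - ?pg x y s' t E\<bar>)"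
      by (rule mult_left_mono[OF sum_abs]) simp
    finally show "\<bar>1 / (real n)\<^sup>2 * ?pg x y s t E - 1 / real q * (1 / (real n)\<^sup>2 * (\<Sum>s'\<in>{1..q}. ?pg x y s' t E))\<bar>
      \<le> 1 / (real n)\<^sup>2 * (1 / real q) * (\<Sum>s'\<in>{1..q}. \<bar>?pg x y s t E - ?pg x y s' t E\<bar>)" .
  qed
  also have "\<dots> = (\<Sum>x\<in>{1..n}. \<Sum>y\<in>{1..n}. 1 / (real n)\<^sup>2 * (1 / real q) * (\<Sum>s'\<in>{1..q}. \<Sum>t\<in>{1..q}. \<Sum>E\<in>graphs n. \<bar>?pg x y s t E - ?pg x y s' t E\<bar>))"
  proof (intro sum.cong refl)
    fix x y
    have "(\<Sum>t\<in>{1..q}. \<Sum>E\<in>graphs n. \<Sum>s'\<in>{1..q}. \<bar>?pg x y s t E - ?pg x y s' t E\<bar>) =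
      (\<Sum>t\<in>{1..q}. \<Sum>s'\<in>{1..q}. \<Sum>E\<in>graphs n. \<bar>?pg x y s t E - ?pg x y s' t E\<bar>)"
      by (rule sum.cong[OF refl], rule sum.swap)
    also have "\<dots> = (\<Sum>s'\<in>{1..q}. \<Sum>t\<in>{1..q}. \<Sum>E\<in>graphs n. \<bar>?pg x y s t E - ?pg x y s' t E\<bar>)" by (rule sum.swap)
    finally show "(\<Sum>t\<in>{1..q}. \<Sum>E\<in>graphs n. 1 / (real n)\<^sup>2 * (1 / real q) * (\<Sum>s'\<in>{1..q}. \<bar>?pg x y s t E - ?pg x y s' t E\<bar>)) =
      1 / (real n)\<^sup>2 * (1 / real q) * (\<Sum>s'\<in>{1..q}. \<Sum>t\<in>{1..q}. \<Sum>E\<in>graphs n. \<bar>?pg x y s t E - ?pg x y s' t E\<bar>)"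
      by (simp only: sum_distrib_left[symmetric])
  qed
  also have "\<dots> \<le> (\<Sum>x\<in>{1..n}. \<Sum>y\<in>{1..n}. 1 / (real n)\<^sup>2 * (1 / real q) * (\<Sum>s'\<in>{1..q}. B + (if x = y then 2 else 0)))"
    by (intro sum_mono mult_left_mono diff) auto
  also have "\<dots> = (\<Sum>x\<in>{1..n}. \<Sum>y\<in>{1..n}. 1 / (real n)\<^sup>2 * (B + (if x = y then 2 else 0)))"
    using q by simp
  also have "\<dots> = 1 / (real n)\<^sup>2 * (\<Sum>x\<in>{1..n}. (\<Sum>y\<in>{1..n}. B) + (\<Sum>y\<in>{1..n}. if x = y then 2 else 0))"
    by (simp only: sum_distrib_left[symmetric] sum.distrib[symmetric])
  also have "\<dots> = 1 / (real n)\<^sup>2 * (real n * (real n * B + 2))"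
  proof -
    have "(\<Sum>x\<in>{1..n}. (\<Sum>y\<in>{1..n}. B) + (\<Sum>y\<in>{1..n}. if x = y then 2 else 0)) = (\<Sum>x\<in>{1..n}. real n * B + 2)"
      by (intro sum.cong refl) simp
    then show ?thesis by simp
  qed
  also have "\<dots> = B + 2 / real n" using n by (simp add: power2_eq_square field_simps)
  finally have D: "(\<Sum>z\<in>K. \<bar>prob {\<omega> \<in> A. Z \<omega> = z} - 1 / real q * prob {\<omega> \<in> space M. Z \<omega> = z}\<bar>) \<le> B + 2 / real n" .
  have "\<P>(\<omega> in M. \<bar>spin_posterior M q n \<sigma> G u v s \<omega> - 1 / real q\<bar> > \<epsilon>) \<le>
    2 / \<epsilon> * (\<Sum>z\<in>K. \<bar>prob {\<omega> \<in> A. Z \<omega> = z} - 1 / real q * prob {\<omega> \<in> space M. Z \<omega> = z}\<bar>)"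
    unfolding spin_posterior_def A_def[symmetric] Z_def[symmetric] K_def[symmetric]
    by (rule cond_prob_deviation[OF Zm finK Am \<epsilon>])
  also have "\<dots> \<le> 2 / \<epsilon> * (B + 2 / real n)" using D \<epsilon> by (intro mult_left_mono) auto
  finally show ?thesis .
qed

end

section \<open>Convergence of the posterior\<close>

text \<open>The reduction turns the assumption into the threshold condition \<open>signal a b * mom 2 \<le> 1\<close>: the second moment of
  the thinned law is \<open>2 / q\<close> times that of \<open>\<nu>\<close>.\<close>

lemma pair_graph_prob_diff_tendsto_0:
  fixes \<nu> :: "real measure" and a b m \<delta> :: real and q s s' :: nat
  assumes q: "q \<ge> 2" and ab: "a > 0" "b > 0" and prob_\<nu>: "prob_space \<nu>" and sets_\<nu>: "sets \<nu> = sets borel"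
    and m: "m > 0" "AE x in \<nu>. m \<le> x" and i4: "integrable \<nu> (\<lambda>x. x ^ 4)"
    and KS: "(a - b)\<^sup>2 * (\<integral>x. x\<^sup>2 \<partial>\<nu>) \<le> real q * (a + b)"
    and s: "s \<in> {1..q}" "s' \<in> {1..q}" and \<delta>: "\<delta> > 0"
  shows "eventually (\<lambda>n. \<forall>x\<in>{1..n}. \<forall>y\<in>{1..n}. x \<noteq> y \<longrightarrow>
    (\<Sum>t\<in>{1..q}. \<Sum>E\<in>graphs n. \<bar>pair_graph_prob q a b n \<nu> x y s t E - pair_graph_prob q a b n \<nu> x y s' t E\<bar>) \<le> \<delta>) sequentially"
proof (cases "s = s'")
  case True then show ?thesis using \<delta> by simp
next
  case False
  let ?\<mu> = "thinned_law \<nu> q s s'"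
  note hyp = prob_\<nu> sets_\<nu> q s False m i4
  interpret W: weight_law ?\<mu> by (rule weight_law_thinned[OF hyp])
  have "signal a b * W.mom 2 \<le> 1"
  proof -
    have cancel: "d / (2 * S) * (2 / Q * I) = d * I / (Q * S)" for d S Q I :: real by simp
    have "signal a b * W.mom 2 = ((a - b)\<^sup>2 * (\<integral>x. x\<^sup>2 \<partial>\<nu>)) / (real q * (a + b))"
      unfolding second_moment_thinned[OF hyp] signal_def by (rule cancel)
    also have "\<dots> \<le> 1" using KS ab q by (simp add: divide_le_eq)
    finally show ?thesis .
  qed
  define r where "r = \<delta> * m / (W.mom 1 + 1)"
  have m1: "0 \<le> W.mom 1" by (rule W.mom_nonneg)
  have r: "r > 0" using \<delta> m m1 by (simp add: r_def)
  have r1: "r * W.mom 1 \<le> \<delta> * m"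
  proof -
    have "r * W.mom 1 \<le> r * (W.mom 1 + 1)" using r by simp
    also have "\<dots> = \<delta> * m" using m1 by (simp add: r_def)
    finally show ?thesis .
  qed
  have "eventually (\<lambda>n. \<forall>x\<in>{1..n}. \<forall>y\<in>{1..n}. x \<noteq> y \<longrightarrow>
     weighted_two_block.rho a b n ?\<mu> {1..n} {1..n} {y} x \<le> r * (\<delta> * m)) sequentially"
    by (rule W.pair_information_tendsto_0[OF ab \<open>signal a b * W.mom 2 \<le> 1\<close> thinned_law_not_null[OF hyp]])
      (use r \<delta> m in simp)
  moreover have "eventually (\<lambda>n. n \<ge> 1) sequentially" by (rule eventually_ge_at_top)
  ultimately show ?thesis
  proof eventually_elim
    case (elim n)
    show ?case
    proof (intro ballI impI)
      fix x y assume xy: "x \<in> {1..n}" "y \<in> {1..n}" "x \<noteq> y"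
      let ?rho = "weighted_two_block.rho a b n ?\<mu> {1..n} {1..n} {y} x"
      have rho: "?rho / r \<le> \<delta> * m" using elim xy r by (simp add: divide_le_eq mult.commute)
      have "(\<Sum>t\<in>{1..q}. \<Sum>E\<in>graphs n. \<bar>pair_graph_prob q a b n \<nu> x y s t E - pair_graph_prob q a b n \<nu> x y s' t E\<bar>)
        = (\<Sum>t\<in>{1..q}. \<Sum>E\<in>graphs n. \<bar>\<Sum>\<tau>\<in>{1..n} \<rightarrow>\<^sub>E {1..q}. (of_bool (\<tau> x = s) - of_bool (\<tau> x = s')) * of_bool (\<tau> y = t) *
            ((1 / real q) ^ n * (\<integral>\<phi>. graph_prob a b n \<tau> \<phi> E \<partial>(\<Pi>\<^sub>M w\<in>{1..n}. \<nu>)))\<bar>)"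
        unfolding pair_graph_prob_def sum_subtractf[symmetric] left_diff_distrib ..
      also have "\<dots> \<le> (r * W.mom 1 + ?rho / r) / (2 * m)"
        by (rule integrated_difference[OF hyp ab _ xy(1,2) r]) (use elim in simp)
      also have "\<dots> \<le> (\<delta> * m + \<delta> * m) / (2 * m)" using r1 rho m by (intro divide_right_mono add_mono) auto
      also have "\<dots> = \<delta>" using m by simp
      finally show "(\<Sum>t\<in>{1..q}. \<Sum>E\<in>graphs n. \<bar>pair_graph_prob q a b n \<nu> x y s t E - pair_graph_prob q a b n \<nu> x y s' t E\<bar>) \<le> \<delta>" .
    qed
  qed
qed

theorem theorem1p2:
  fixes q :: nat and a b \<phi>_min \<beta> :: real and W :: "real set" and \<nu> :: "real measure"
    and M :: "nat \<Rightarrow> 'w measure"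
    and \<sigma> :: "nat \<Rightarrow> nat \<Rightarrow> 'w \<Rightarrow> nat" and \<phi> :: "nat \<Rightarrow> nat \<Rightarrow> 'w \<Rightarrow> real"
    and G :: "nat \<Rightarrow> 'w \<Rightarrow> nat set set" and u v :: "nat \<Rightarrow> 'w \<Rightarrow> nat" and s :: nat
  assumes "q \<ge> 2" and "a > 0" and "b > 0" and "\<phi>_min > 0"
    and "prob_space \<nu>" and "sets \<nu> = sets borel"
    and "W \<in> sets borel" and "W \<subseteq> {\<phi>_min..}" and "AE x in \<nu>. x \<in> W"
    and "\<beta> > 8" and "eventually (\<lambda>k. measure \<nu> {k..} \<le> k powr (-\<beta>)) at_top"
    and "(a - b)\<^sup>2 * weight_moment \<nu> W 2 \<le> real q * (a + b)"
    and "\<And>n. n \<ge> 1 \<Longrightarrow> dcsbm_two_vertices (M n) q n a b \<nu> (\<sigma> n) (\<phi> n) (G n) (u n) (v n)"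
    and "s \<in> {1..q}"
  shows "tendsto_in_prob M (\<lambda>n. spin_posterior (M n) q n (\<sigma> n) (G n) (u n) (v n) s) (1 / real q)"
  unfolding tendsto_in_prob_def
proof (intro allI impI)
  fix \<epsilon> :: real assume \<epsilon>: "\<epsilon> > 0"
  let ?P = "\<lambda>n. \<P>(\<omega> in M n. \<bar>spin_posterior (M n) q n (\<sigma> n) (G n) (u n) (v n) s \<omega> - 1 / real q\<bar> > \<epsilon>)"
  have AEm: "AE x in \<nu>. \<phi>_min \<le> x" using assms(9) by eventually_elim (use assms(8) in auto)
  have AEnn: "AE x in \<nu>. 0 \<le> x" using AEm by eventually_elim (use assms(4) in auto)
  have i4: "integrable \<nu> (\<lambda>x. x ^ 4)"
    by (rule tail_imp_integrable_power4[OF assms(5,6) AEnn assms(10,11)])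
  have "weight_moment \<nu> W 2 = (\<integral>x. x\<^sup>2 \<partial>\<nu>)"
    unfolding weight_moment_def set_lebesgue_integral_def
  proof (rule integral_cong_AE)
    show "(\<lambda>x. indicat_real W x *\<^sub>R x\<^sup>2) \<in> borel_measurable \<nu>" "(\<lambda>x. x\<^sup>2) \<in> borel_measurable \<nu>"
      unfolding measurable_cong_sets[OF assms(6) refl] using assms(7) by measurable
    show "AE x in \<nu>. indicat_real W x *\<^sub>R x\<^sup>2 = x\<^sup>2" using assms(9) by eventually_elim simp
  qed
  then have KS: "(a - b)\<^sup>2 * (\<integral>x. x\<^sup>2 \<partial>\<nu>) \<le> real q * (a + b)" using assms(12) by simp
  show "?P \<longlonglongrightarrow> 0"
  proof (rule order_tendstoI)
    fix l :: real assume "l < 0"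
    then show "eventually (\<lambda>n. l < ?P n) sequentially"
      by (intro always_eventually allI) (metis less_le_trans measure_nonneg)
  next
    fix h :: real assume h: "0 < h"
    define \<delta> where "\<delta> = h * \<epsilon> / 8"
    have \<delta>: "\<delta> > 0" using h \<epsilon> by (simp add: \<delta>_def)
    have "eventually (\<lambda>n. \<forall>s'\<in>{1..q}. \<forall>x\<in>{1..n}. \<forall>y\<in>{1..n}. x \<noteq> y \<longrightarrow>
      (\<Sum>t\<in>{1..q}. \<Sum>E\<in>graphs n. \<bar>pair_graph_prob q a b n \<nu> x y s t E - pair_graph_prob q a b n \<nu> x y s' t E\<bar>) \<le> \<delta>) sequentially"
      by (intro eventually_ball_finite finite_atLeastAtMost ballI
          pair_graph_prob_diff_tendsto_0[OF assms(1-3,5,6,4) AEm i4 KS assms(14) _ \<delta>])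
    moreover have "eventually (\<lambda>n. 2 / real n < \<delta>) sequentially"
      using order_tendstoD(2)[OF real_tendsto_divide_at_top[OF tendsto_const filterlim_real_sequentially] \<delta>] .
    moreover have "eventually (\<lambda>n. n \<ge> 1) sequentially" by (rule eventually_ge_at_top)
    ultimately show "eventually (\<lambda>n. ?P n < h) sequentially"
    proof eventually_elim
      case (elim n)
      interpret dcsbm_two_vertices "M n" q n a b \<nu> "\<sigma> n" "\<phi> n" "G n" "u n" "v n" by (rule assms(13)[OF elim(3)])
      have "?P n \<le> 2 / \<epsilon> * (\<delta> + 2 / real n)"
        by (rule posterior_deviation[OF elim(3) _ assms(2,3,5,6) AEnn assms(14) \<epsilon>])
          (use elim(1) assms(1) \<delta> in auto)
      also have "\<dots> \<le> 2 / \<epsilon> * (2 * \<delta>)" using elim(2) \<epsilon> by (intro mult_left_mono) auto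
      also have "\<dots> = h / 2" using \<epsilon> by (simp add: \<delta>_def)
      also have "\<dots> < h" using h by simp
      finally show "?P n < h" .
    qed
  qed
qed

end
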